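(* Define a relation on $\widetilde{\mathcal{C}}^{\,o}_{LEO}$ by declaring that $[(C,D,f)]\ge[(C',D',f')]$ if there is a local map from $(C',D',f')$ to $(C,D,f)$. This relation is a translation-invariant total order on $\widetilde{\mathcal{C}}^{\,o}_{LEO}$. Further, the total order is characterized by the property that $[(C,D,f)]\ge 0$ if and only if $\tilde s_o(C,D,f)\ge0$, where $0$ denotes the identity element of $\widetilde{\mathcal{C}}^{\,o}_{LEO}$.
   Context: Conventions. All complexes are bigraded cochain complexes ($i$ homological, $q$ quantum grading) with differential of bidegree $(1,0)$; "finitely generated free" means free on finitely many homogeneous generators. $\mathbb{F}_2=\mathbb{Z}/2$; $h$ has bidegree $(0,-2)$; $h^{-1}D=D\otimes_{\mathbb{F}_2[h]}\mathbb{F}_2[h,h^{-1}]$; $D_{h=0}=D/hD$. $H^{i,q}$ denotes cohomology in bigrading $(i,q)$. A two-reduced LEO triple $(C,D,f)$ consists of finitely generated free bigraded complexes $C$ over $\mathbb{Z}$ and $D$ over $\mathbb{F}_2[h]$, and a bigraded homotopy equivalence $f\colon C\otimes_{\mathbb{Z}}\mathbb{Z}/(2)\to D\otimes_{\mathbb{F}_2[h]}\mathbb{F}_2[h]/(h)$, such that $h^{-1}D$ is homotopy equivalent to a free graded module of rank 1 over $\mathbb{F}_2[h,h^{-1}]$ supported in homological grading $0$ and even quantum gradings. A local map $(C,D,f)\to(C',D',f')$ is a pair of bigrading-preserving chain maps $\alpha\colon C\to C'$, $\beta\colon D\to D'$ (over $\mathbb{Z}$ and $\mathbb{F}_2[h]$)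 such that $\beta\colon h^{-1}D\to h^{-1}D'$ is a homotopy equivalence and $f'\circ\alpha$ and $\beta\circ f$ are chain homotopic as maps $C\otimes\mathbb{F}_2\to D'_{h=0}$. Two triples are locally equivalent if there are local maps in both directions. $\widetilde{\mathcal{C}}^{\,o}_{LEO}$ is the abelian group of local equivalence classes, with addition $(C\otimes_{\mathbb{Z}}C',D\otimes_{\mathbb{F}_2[h]}D',f\otimes f')$, identity the class of $(\mathbb{Z},\mathbb{F}_2[h],\mathrm{id})$ (generators in bigrading $(0,0)$), and inverse the class of the dual $(\mathrm{Hom}_{\mathbb{Z}}(C,\mathbb{Z}),\mathrm{Hom}_{\mathbb{F}_2[h]}(D,\mathbb{F}_2[h]),\overline f)$, with gradings negated on dual generators and $\overline f$ the transpose of a homotopy inverse of $f$. An even integer $q$ is oddly reduced-full for $(C,D,f)$ if there exist $\check a\in H^{0,q}(C)$ and $a\in H^{0,q}(D)$ with $f(j(\check a))=p(a)\in H^{0,q}(D_{h=0})$ and $i(a)\neq0\in H^{0,q}(h^{-1}D)$, where $j\colon H^{0,q}(C)\to H^{0,q}(C\otimes\mathbb{F}_2)$, $p\colon H^{0,q}(D)\to H^{0,q}(D_{h=0})$ and $i\colon H^{0,q}(D)\to H^{0,q}(h^{-1}D)$ are the natural maps. Define $\tilde s_o(C,D,f)=\max\{q\in2\mathbb{Z}\mid q\text{ is oddly reduced-full}\}$. *)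

theory Defs
  imports "Jordan_Normal_Form.Matrix" "HOL-Library.Z2" "HOL-Library.Poly_Mapping"
    "HOL-Computational_Algebra.Polynomial" "HOL-Algebra.Group"
begin

section \<open>Ground rings\<close>

text \<open>
  The ground rings are \<open>int\<close>, \<open>bit\<close> (the field with two elements), \<open>bit poly\<close> (for
  \<open>F\<^sub>2[h]\<close>) and the group ring \<open>int \<Rightarrow>\<^sub>0 bit\<close> of the integers (for \<open>F\<^sub>2[h,h\<inverse>]\<close>).  They are
  concentrated in homological degree \<open>0\<close>; a quantum grading is given by the family \<open>R\<close> of its
  homogeneous parts, with \<open>h\<close> in quantum degree \<open>-2\<close>.
\<close>

definition trivial_grading :: "int \<Rightarrow> 'r::zero set" where
  "trivial_grading q = (if q = 0 then UNIV else {0})"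

definition h_grading :: "int \<Rightarrow> bit poly set" where
  "h_grading q = {p. \<forall>n. coeff p n \<noteq> 0 \<longrightarrow> q = - 2 * int n}"

definition laurent_grading :: "int \<Rightarrow> (int \<Rightarrow>\<^sub>0 bit) set" where
  "laurent_grading q = {p. \<forall>n. Poly_Mapping.lookup p n \<noteq> 0 \<longrightarrow> q = - 2 * n}"

definition mod2 :: "int \<Rightarrow> bit" where
  "mod2 = of_int"

definition h_to_0 :: "bit poly \<Rightarrow> bit" where
  "h_to_0 p = poly p 0"

definition to_laurent :: "bit poly \<Rightarrow> (int \<Rightarrow>\<^sub>0 bit)" where
  "to_laurent p = (\<Sum>n\<le>degree p. Poly_Mapping.single (int n) (coeff p n))"


section \<open>Bigraded complexes, chain maps and homotopies\<close>

text \<open>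
  A complex on finitely many homogeneous generators consists of the list of the bigradings
  (homological, quantum) of its generators and the matrix of the differential.  Elements are
  coordinate vectors and linear maps are matrices, acting on column vectors.
\<close>

datatype 'r cplx = Cplx (gens: "(int \<times> int) list") (diff: "'r mat")

abbreviation rk :: "'r cplx \<Rightarrow> nat" where "rk C \<equiv> length (gens C)"
abbreviation hdeg :: "'r cplx \<Rightarrow> nat \<Rightarrow> int" where "hdeg C j \<equiv> fst (gens C ! j)"
abbreviation qdeg :: "'r cplx \<Rightarrow> nat \<Rightarrow> int" where "qdeg C j \<equiv> snd (gens C ! j)"

text \<open>Linear maps \<open>C \<rightarrow> C'\<close> that are homogeneous of bidegree \<open>(a, b)\<close>.\<close>

definition homog_map ::
  "(int \<Rightarrow> 'r::comm_ring_1 set) \<Rightarrow> int \<Rightarrow> int \<Rightarrow> 'r cplx \<Rightarrow> 'r cplx \<Rightarrow> 'r mat \<Rightarrow> bool" where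
  "homog_map R a b C C' M \<longleftrightarrow>
     M \<in> carrier_mat (rk C') (rk C) \<and>
     (\<forall>i<rk C'. \<forall>j<rk C. M $$ (i, j) \<noteq> 0 \<longrightarrow>
        hdeg C' i = hdeg C j + a \<and> M $$ (i, j) \<in> R (qdeg C j + b - qdeg C' i))"

definition is_complex :: "(int \<Rightarrow> 'r::comm_ring_1 set) \<Rightarrow> 'r cplx \<Rightarrow> bool" where
  "is_complex R C \<longleftrightarrow> homog_map R 1 0 C C (diff C) \<and> diff C * diff C = 0\<^sub>m (rk C) (rk C)"

definition chain_map ::
  "(int \<Rightarrow> 'r::comm_ring_1 set) \<Rightarrow> 'r cplx \<Rightarrow> 'r cplx \<Rightarrow> 'r mat \<Rightarrow> bool" where
  "chain_map R C C' F \<longleftrightarrow> homog_map R 0 0 C C' F \<and> F * diff C = diff C' * F"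

definition chain_homotopic ::
  "(int \<Rightarrow> 'r::comm_ring_1 set) \<Rightarrow> 'r cplx \<Rightarrow> 'r cplx \<Rightarrow> 'r mat \<Rightarrow> 'r mat \<Rightarrow> bool" where
  "chain_homotopic R C C' F G \<longleftrightarrow>
     (\<exists>K. homog_map R (-1) 0 C C' K \<and> F - G = diff C' * K + K * diff C)"

definition homotopy_equivalence ::
  "(int \<Rightarrow> 'r::comm_ring_1 set) \<Rightarrow> 'r cplx \<Rightarrow> 'r cplx \<Rightarrow> 'r mat \<Rightarrow> bool" where
  "homotopy_equivalence R C C' F \<longleftrightarrow>
     chain_map R C C' F \<and>
     (\<exists>G. chain_map R C' C G \<and>
        chain_homotopic R C C (G * F) (1\<^sub>m (rk C)) \<and>
        chain_homotopic R C' C' (F * G) (1\<^sub>m (rk C')))"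

definition homotopy_equivalent ::
  "(int \<Rightarrow> 'r::comm_ring_1 set) \<Rightarrow> 'r cplx \<Rightarrow> 'r cplx \<Rightarrow> bool" where
  "homotopy_equivalent R C C' \<longleftrightarrow> (\<exists>F. homotopy_equivalence R C C' F)"

text \<open>Extension of scalars along a ring homomorphism \<open>\<phi>\<close>; on maps it is \<^term>\<open>map_mat \<phi>\<close> and
  on elements \<^term>\<open>map_vec \<phi>\<close>.\<close>

definition base_change :: "('r \<Rightarrow> 's) \<Rightarrow> 'r cplx \<Rightarrow> 's cplx" where
  "base_change \<phi> C = Cplx (gens C) (map_mat \<phi> (diff C))"

abbreviation cplx_mod2 :: "int cplx \<Rightarrow> bit cplx" where
  "cplx_mod2 \<equiv> base_change mod2"
abbreviation cplx_h0 :: "bit poly cplx \<Rightarrow> bit cplx" where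
  "cplx_h0 \<equiv> base_change h_to_0"
abbreviation cplx_hinv :: "bit poly cplx \<Rightarrow> (int \<Rightarrow>\<^sub>0 bit) cplx" where
  "cplx_hinv \<equiv> base_change to_laurent"


section \<open>Tensor products\<close>

text \<open>
  The generator \<open>x\<^sub>i \<otimes> y\<^sub>k\<close> of a tensor product has index \<open>i * n + k\<close>, where \<open>n\<close> is the rank of
  the second factor.
\<close>

definition kron :: "'r::times mat \<Rightarrow> 'r mat \<Rightarrow> 'r mat" where
  "kron A B = mat (dim_row A * dim_row B) (dim_col A * dim_col B)
     (\<lambda>(i, j). A $$ (i div dim_row B, j div dim_col B) * B $$ (i mod dim_row B, j mod dim_col B))"

text \<open>The map \<open>x \<mapsto> (-1)^i x\<close> on elements \<open>x\<close> of homological degree \<open>i\<close>.\<close>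

definition sign_mat :: "'r::comm_ring_1 cplx \<Rightarrow> 'r mat" where
  "sign_mat C = mat (rk C) (rk C)
     (\<lambda>(i, j). if i = j then (if even (hdeg C i) then 1 else - 1) else 0)"

text \<open>The differential is \<open>d(x \<otimes> y) = dx \<otimes> y + (-1)^i x \<otimes> dy\<close> for \<open>x\<close> of homological
  degree \<open>i\<close>.\<close>

definition tensor_cplx :: "'r::comm_ring_1 cplx \<Rightarrow> 'r cplx \<Rightarrow> 'r cplx" where
  "tensor_cplx C C' = Cplx
     (map (\<lambda>((i, q), (i', q')). (i + i', q + q')) (List.product (gens C) (gens C')))
     (kron (diff C) (1\<^sub>m (rk C')) + kron (sign_mat C) (diff C'))"


section \<open>Cohomology\<close>

text \<open>The part of \<open>C\<close> in bigrading \<open>(i, q)\<close>.\<close>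

definition bigraded_part ::
  "(int \<Rightarrow> 'r::comm_ring_1 set) \<Rightarrow> 'r cplx \<Rightarrow> int \<Rightarrow> int \<Rightarrow> 'r vec set" where
  "bigraded_part R C i q = {v \<in> carrier_vec (rk C).
     \<forall>j<rk C. v $ j \<noteq> 0 \<longrightarrow> hdeg C j = i \<and> v $ j \<in> R (q - qdeg C j)}"

definition cocycles ::
  "(int \<Rightarrow> 'r::comm_ring_1 set) \<Rightarrow> 'r cplx \<Rightarrow> int \<Rightarrow> int \<Rightarrow> 'r vec set" where
  "cocycles R C i q = {v \<in> bigraded_part R C i q. diff C *\<^sub>v v = 0\<^sub>v (rk C)}"

definition coboundaries ::
  "(int \<Rightarrow> 'r::comm_ring_1 set) \<Rightarrow> 'r cplx \<Rightarrow> int \<Rightarrow> int \<Rightarrow> 'r vec set" where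
  "coboundaries R C i q = (\<lambda>w. diff C *\<^sub>v w) ` bigraded_part R C (i - 1) q"

definition coh_class ::
  "(int \<Rightarrow> 'r::comm_ring_1 set) \<Rightarrow> 'r cplx \<Rightarrow> int \<Rightarrow> int \<Rightarrow> 'r vec \<Rightarrow> 'r vec set" where
  "coh_class R C i q v = (\<lambda>b. v + b) ` coboundaries R C i q"

text \<open>The cohomology group \<open>H\<^sup>i\<^sup>,\<^sup>q(C)\<close> as a set of cosets of the coboundaries.\<close>

definition cohomology ::
  "(int \<Rightarrow> 'r::comm_ring_1 set) \<Rightarrow> 'r cplx \<Rightarrow> int \<Rightarrow> int \<Rightarrow> 'r vec set set" where
  "cohomology R C i q = coh_class R C i q ` cocycles R C i q"

text \<open>The map into the cohomology of \<open>C'\<close> induced by a map \<open>\<phi>\<close> on elements that preserves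
  cocycles and coboundaries: all representatives \<open>v\<close> of the class \<open>A\<close> contribute the same class
  to the union.\<close>

definition coh_map ::
  "(int \<Rightarrow> 's::comm_ring_1 set) \<Rightarrow> 's cplx \<Rightarrow> int \<Rightarrow> int \<Rightarrow> ('r vec \<Rightarrow> 's vec) \<Rightarrow>
     'r vec set \<Rightarrow> 's vec set" where
  "coh_map R C' i q \<phi> A = (\<Union>v\<in>A. coh_class R C' i q (\<phi> v))"


section \<open>Two-reduced LEO triples\<close>

datatype leo = LEO (zpart: "int cplx") (hpart: "bit poly cplx") (cmp: "bit mat")

definition leo_triples :: "leo set" where
  "leo_triples = {X.
     is_complex trivial_grading (zpart X) \<and>
     is_complex h_grading (hpart X) \<and>
     homotopy_equivalence trivial_grading (cplx_mod2 (zpart X)) (cplx_h0 (hpart X)) (cmp X) \<and>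
     (\<exists>q. even q \<and>
        homotopy_equivalent laurent_grading (cplx_hinv (hpart X)) (Cplx [(0, q)] (0\<^sub>m 1 1)))}"

definition local_map :: "leo \<Rightarrow> leo \<Rightarrow> int mat \<Rightarrow> bit poly mat \<Rightarrow> bool" where
  "local_map X X' \<alpha> \<beta> \<longleftrightarrow>
     chain_map trivial_grading (zpart X) (zpart X') \<alpha> \<and>
     chain_map h_grading (hpart X) (hpart X') \<beta> \<and>
     homotopy_equivalence laurent_grading (cplx_hinv (hpart X)) (cplx_hinv (hpart X'))
       (map_mat to_laurent \<beta>) \<and>
     chain_homotopic trivial_grading (cplx_mod2 (zpart X)) (cplx_h0 (hpart X'))
       (cmp X' * map_mat mod2 \<alpha>) (map_mat h_to_0 \<beta> * cmp X)"

definition has_local_map :: "leo \<Rightarrow> leo \<Rightarrow> bool" where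
  "has_local_map X X' \<longleftrightarrow> (\<exists>\<alpha> \<beta>. local_map X X' \<alpha> \<beta>)"

definition local_equiv :: "leo rel" where
  "local_equiv = {(X, X'). X \<in> leo_triples \<and> X' \<in> leo_triples \<and>
     has_local_map X X' \<and> has_local_map X' X}"

definition leo_class :: "leo \<Rightarrow> leo set" where
  "leo_class X = local_equiv `` {X}"

definition tensor_leo :: "leo \<Rightarrow> leo \<Rightarrow> leo" where
  "tensor_leo X X' = LEO (tensor_cplx (zpart X) (zpart X')) (tensor_cplx (hpart X) (hpart X'))
     (kron (cmp X) (cmp X'))"

definition unit_leo :: leo where
  "unit_leo = LEO (Cplx [(0, 0)] (0\<^sub>m 1 1)) (Cplx [(0, 0)] (0\<^sub>m 1 1)) (1\<^sub>m 1)"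

text \<open>The group of local equivalence classes.  The group operation is written multiplicatively, as
  always in HOL-Algebra.\<close>

definition leo_group :: "leo set monoid" where
  "leo_group = \<lparr> carrier = leo_triples // local_equiv,
     mult = (\<lambda>A B. \<Union>X\<in>A. \<Union>Y\<in>B. leo_class (tensor_leo X Y)),
     one = leo_class unit_leo \<rparr>"

text \<open>A pair \<open>(A, B)\<close> belongs to \<open>leo_order\<close> if \<open>B \<ge> A\<close>, that is, if there is a local map from
  a representative of \<open>A\<close> to a representative of \<open>B\<close>.\<close>

definition leo_order :: "leo set rel" where
  "leo_order = {(A, B). A \<in> carrier leo_group \<and> B \<in> carrier leo_group \<and>
     (\<exists>X\<in>A. \<exists>Y\<in>B. has_local_map X Y)}"

definition translation_invariant :: "('a, 'm) monoid_scheme \<Rightarrow> 'a rel \<Rightarrow> bool" where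
  "translation_invariant G r \<longleftrightarrow>
     (\<forall>a\<in>carrier G. \<forall>b\<in>carrier G. \<forall>c\<in>carrier G.
        (a, b) \<in> r \<longrightarrow> (a \<otimes>\<^bsub>G\<^esub> c, b \<otimes>\<^bsub>G\<^esub> c) \<in> r)"


section \<open>The invariant\<close>

definition oddly_reduced_full :: "leo \<Rightarrow> int \<Rightarrow> bool" where
  "oddly_reduced_full X q \<longleftrightarrow> even q \<and>
     (\<exists>a'\<in>cohomology trivial_grading (zpart X) 0 q. \<exists>a\<in>cohomology h_grading (hpart X) 0 q.
        coh_map trivial_grading (cplx_h0 (hpart X)) 0 q (\<lambda>v. cmp X *\<^sub>v v)
          (coh_map trivial_grading (cplx_mod2 (zpart X)) 0 q (map_vec mod2) a')
        = coh_map trivial_grading (cplx_h0 (hpart X)) 0 q (map_vec h_to_0) a \<and>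
        coh_map laurent_grading (cplx_hinv (hpart X)) 0 q (map_vec to_laurent) a
        \<noteq> coh_class laurent_grading (cplx_hinv (hpart X)) 0 q (0\<^sub>v (rk (hpart X))))"

definition s_odd :: "leo \<Rightarrow> int" where
  "s_odd X = (GREATEST q. oddly_reduced_full X q)"

end

theory Submission
  imports Defs
begin

text \<open>
  A local map from the unit to a triple \<open>X\<close> is a pair of cocycles in bidegree zero with compatible
  reductions, the second of which survives inverting \<open>h\<close>; in other words, it is a witness that \<open>0\<close> is
  oddly reduced-full (\<open>has_local_map_unit_iff\<close>).  A local map from \<open>X\<close> to \<open>Y\<close> is a local map from the
  unit to \<open>Y \<otimes> X\<^sup>*\<close>, because tensoring with a dual gives a homomorphism complex
  (\<open>has_local_map_iff_unit_hom\<close>).  Hence, as soon as local equivalence classes form a group, every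
  question about the order reduces to comparing one triple with the unit.

  For the group, the tensor product is strictly associative and unital, it is commutative by the signed
  swap, and the dual is an inverse by the identity, read as coevaluation, and the supertrace, which is
  evaluation (\<open>comm_group_leo_group\<close>).  Over \<open>F\<^sub>2[h,h\<inverse>]\<close> the complexes in question are equivalent
  to a line over a graded field.  So a map between them is an equivalence exactly if it is not
  null-homotopic (\<open>laurent_he_iff\<close>), and being local becomes a property of one cohomology class.

  The heart of the matter is totality: if \<open>0\<close> is not full for \<open>X\<close>, then \<open>X\<close> maps to the unit
  (\<open>has_local_map_to_unit\<close>).  Setting \<open>h = 1\<close> turns the second complex of \<open>X\<close> into a complex over the
  field with two elements, filtered by quantum degree, whose cohomology has a nontrivial class; let \<open>z\<close>
  be a cocycle representing it.  Consider the subspace spanned by the boundaries, the elements of positive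
  filtration level, and the reductions of integral cocycles in bidegree zero.  If \<open>z\<close> belonged to it,
  then subtracting the boundary would leave a cocycle of level zero in the same class whose leading part
  is the reduction of an integral cocycle, and \<open>0\<close> would be full.  So there is a linear functional that
  vanishes on the subspace and not on \<open>z\<close>.  Vanishing on positive levels, it comes from a homogeneous
  functional with values in \<open>F\<^sub>2[h]\<close>; vanishing on boundaries, it is a chain map; and since it does not
  vanish on \<open>z\<close>, it is local.  Finally, composed with the comparison map it vanishes on the reductions of
  integral cocycles.  Integral cocycles are closed under division by two, and for this reason the
  composite lifts to an integral functional that vanishes on them (\<open>integral_lift_of_annihilator\<close>), which
  is the required chain map to \<open>\<int>\<close>.

  A translation-invariant order on a group is determined by the elements above the identity.  Here these are
  the classes for which \<open>0\<close> is full, and this means \<open>s_odd X \<ge> 0\<close>, because every even number below a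
  full degree is full (\<open>s_odd_nonneg_iff\<close>).
\<close>

section \<open>Matrix identities\<close>

text \<open>
  The side conditions compare dimensions and mention no carrier, so that the simplifier can
  discharge them without having to guess an intermediate dimension.
\<close>

lemma mat_assoc:
  fixes A :: "'a::semiring_0 mat"
  assumes "dim_col A = dim_row B" "dim_col B = dim_row C"
  shows "(A * B) * C = A * (B * C)"
  using assms by (intro assoc_mult_mat[of A "dim_row A" "dim_col A" B "dim_col B" C "dim_col C"]) auto

lemma mat_distl:
  fixes A :: "'a::semiring_0 mat"
  assumes "dim_col A = dim_row B" "dim_row B = dim_row C" "dim_col B = dim_col C"
  shows "A * (B + C) = A * B + A * C"
  using assms by (intro mult_add_distrib_mat[of A "dim_row A" "dim_col A" B "dim_col B" C]) auto

lemma mat_distr: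
  fixes A :: "'a::semiring_0 mat"
  assumes "dim_col B = dim_row A" "dim_row B = dim_row C" "dim_col B = dim_col C"
  shows "(B + C) * A = B * A + C * A"
  using assms by (intro add_mult_distrib_mat[of B "dim_row B" "dim_col B" C A "dim_col A"]) auto

lemma mat_minus_distl:
  fixes A :: "'a::ring mat"
  assumes "dim_col A = dim_row B" "dim_row B = dim_row C" "dim_col B = dim_col C"
  shows "A * (B - C) = A * B - A * C"
  using assms by (intro mult_minus_distrib_mat[of A "dim_row A" "dim_col A" B "dim_col B" C]) auto

lemma mat_minus_distr:
  fixes A :: "'a::ring mat"
  assumes "dim_col B = dim_row A" "dim_row B = dim_row C" "dim_col B = dim_col C"
  shows "(B - C) * A = B * A - C * A"
  using assms by (intro minus_mult_distrib_mat[of B "dim_row B" "dim_col B" C A "dim_col A"]) auto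

lemmas mat_expand = mat_assoc mat_distl mat_distr mat_minus_distl mat_minus_distr

lemma mat_mult_index:
  assumes "i < dim_row A" "j < dim_col B" "dim_col A = dim_row B"
  shows "(A * B) $$ (i, j) = (\<Sum>k<dim_row B. A $$ (i, k) * B $$ (k, j))"
  using assms by (simp add: scalar_prod_def atLeast0LessThan)

lemma transpose_mult_dim:
  fixes A :: "'a::comm_semiring_0 mat"
  assumes "dim_col A = dim_row B"
  shows "(A * B)\<^sup>T = B\<^sup>T * A\<^sup>T"
  using assms by (intro transpose_mult[of A "dim_row A" "dim_col A" B "dim_col B"]) auto

subsection \<open>Kronecker products\<close>

lemma pair_index_less:
  fixes i k m n :: nat
  assumes "i < m" "k < n"
  shows "i * n + k < m * n"
proof -
  have "i * n + k < Suc i * n" using assms by simp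
  also have "\<dots> \<le> m * n" using assms by (intro mult_le_mono1) simp
  finally show ?thesis .
qed

lemma sum_pair_index: "(\<Sum>x<m * n. f x) = (\<Sum>i<m. \<Sum>k<n. f (i * n + k))"
  for m n :: nat
proof -
  have "sum f {i * n..<i * n + n} = (\<Sum>k<n. f (i * n + k))" for i
    using sum.shift_bounds_nat_ivl[of f 0 "i * n" n]
    by (simp add: add.commute atLeast0LessThan)
  then show ?thesis by (simp add: sum.nat_group[symmetric])
qed

lemma pair_indexE:
  fixes x m n :: nat
  assumes "x < m * n"
  obtains i k where "x = i * n + k" "i < m" "k < n"
proof
  show "x = (x div n) * n + x mod n" by simp
  show "x div n < m" using assms by (simp add: less_mult_imp_div_less)
  show "x mod n < n" using assms by (cases n) auto
qed

lemma dim_kron [simp]: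
  "dim_row (kron A B) = dim_row A * dim_row B" "dim_col (kron A B) = dim_col A * dim_col B"
  by (simp_all add: kron_def)

lemma kron_index:
  assumes "i < dim_row A" "k < dim_row B" "j < dim_col A" "l < dim_col B"
    and "n = dim_row B" "m = dim_col B"
  shows "kron A B $$ (i * n + k, j * m + l) = A $$ (i, j) * B $$ (k, l)"
  using assms by (simp add: kron_def pair_index_less)

lemma eq_mat_pairI:
  assumes "dim_row M = a * b" "dim_col M = c * d" "dim_row N = a * b" "dim_col N = c * d"
    and "\<And>i k j l. i < a \<Longrightarrow> k < b \<Longrightarrow> j < c \<Longrightarrow> l < d \<Longrightarrow>
      M $$ (i * b + k, j * d + l) = N $$ (i * b + k, j * d + l)"
  shows "M = N"
proof (rule eq_matI)
  fix x y assume "x < dim_row N" "y < dim_col N"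
  then show "M $$ (x, y) = N $$ (x, y)"
    using assms by (metis pair_indexE)
qed (use assms in auto)

lemma kron_mult:
  fixes A :: "'a::comm_semiring_0 mat"
  assumes "dim_col A = dim_row C" "dim_col B = dim_row D"
  shows "kron A B * kron C D = kron (A * C) (B * D)"
proof (rule eq_mat_pairI)
  fix i k j l assume *: "i < dim_row A" "k < dim_row B" "j < dim_col C" "l < dim_col D"
  have "(kron A B * kron C D) $$ (i * dim_row B + k, j * dim_col D + l)
     = (\<Sum>x<dim_row C * dim_row D. kron A B $$ (i * dim_row B + k, x)
         * kron C D $$ (x, j * dim_col D + l))"
    using * assms by (subst mat_mult_index) (auto simp: pair_index_less)
  also have "\<dots> = (\<Sum>a<dim_row C. \<Sum>b<dim_row D.
      (A $$ (i, a) * B $$ (k, b)) * (C $$ (a, j) * D $$ (b, l)))"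
    unfolding sum_pair_index using * assms by (intro sum.cong) (auto simp: kron_index)
  also have "\<dots> = (A * C) $$ (i, j) * (B * D) $$ (k, l)"
    using * assms by (simp add: mat_mult_index sum_product mult_ac del: index_mult_mat(1))
  also have "\<dots> = kron (A * C) (B * D) $$ (i * dim_row B + k, j * dim_col D + l)"
    using * by (subst kron_index) auto
  finally show "(kron A B * kron C D) $$ (i * dim_row B + k, j * dim_col D + l)
     = kron (A * C) (B * D) $$ (i * dim_row B + k, j * dim_col D + l)" .
qed auto

lemma kron_assoc:
  fixes A :: "'a::comm_semiring_0 mat"
  shows "kron (kron A B) C = kron A (kron B C)"
proof (rule eq_mat_pairI)
  fix x k y l assume *: "x < dim_row A * dim_row B" "k < dim_row C"
    "y < dim_col A * dim_col B" "l < dim_col C"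
  obtain i i' where x: "x = i * dim_row B + i'" "i < dim_row A" "i' < dim_row B"
    using *(1) by (rule pair_indexE)
  obtain j j' where y: "y = j * dim_col B + j'" "j < dim_col A" "j' < dim_col B"
    using *(3) by (rule pair_indexE)
  have r: "x * dim_row C + k = i * (dim_row B * dim_row C) + (i' * dim_row C + k)"
    "y * dim_col C + l = j * (dim_col B * dim_col C) + (j' * dim_col C + l)"
    by (simp_all add: x y algebra_simps)
  have "kron A (kron B C) $$ (x * dim_row C + k, y * dim_col C + l)
      = A $$ (i, j) * (B $$ (i', j') * C $$ (k, l))"
    unfolding r using x y * by (simp add: kron_index pair_index_less)
  then show "kron (kron A B) C $$ (x * dim_row C + k, y * dim_col C + l)
     = kron A (kron B C) $$ (x * dim_row C + k, y * dim_col C + l)"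
    using * x y by (simp add: kron_index mult.assoc)
qed (auto simp: mult.assoc)

lemma kron_add_left:
  fixes A :: "'a::comm_semiring_0 mat"
  assumes "dim_row A = dim_row B" "dim_col A = dim_col B"
  shows "kron (A + B) C = kron A C + kron B C"
  by (rule eq_mat_pairI[of _ "dim_row A" "dim_row C" "dim_col A" "dim_col C"])
     (use assms in \<open>auto simp: kron_index pair_index_less ring_distribs\<close>)

lemma kron_add_right:
  fixes A :: "'a::comm_semiring_0 mat"
  assumes "dim_row A = dim_row B" "dim_col A = dim_col B"
  shows "kron C (A + B) = kron C A + kron C B"
  by (rule eq_mat_pairI[of _ "dim_row C" "dim_row A" "dim_col C" "dim_col A"])
     (use assms in \<open>auto simp: kron_index pair_index_less ring_distribs\<close>)

lemma kron_minus_left: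
  fixes A :: "'a::comm_ring mat"
  assumes "dim_row A = dim_row B" "dim_col A = dim_col B"
  shows "kron (A - B) C = kron A C - kron B C"
  by (rule eq_mat_pairI[of _ "dim_row A" "dim_row C" "dim_col A" "dim_col C"])
     (use assms in \<open>auto simp: kron_index pair_index_less ring_distribs\<close>)

lemma kron_minus_right:
  fixes A :: "'a::comm_ring mat"
  assumes "dim_row A = dim_row B" "dim_col A = dim_col B"
  shows "kron C (A - B) = kron C A - kron C B"
  by (rule eq_mat_pairI[of _ "dim_row C" "dim_row A" "dim_col C" "dim_col A"])
     (use assms in \<open>auto simp: kron_index pair_index_less ring_distribs\<close>)

lemma kron_uminus_left:
  fixes A :: "'a::comm_ring mat"
  shows "kron (- A) C = - kron A C"
  by (rule eq_mat_pairI[of _ "dim_row A" "dim_row C" "dim_col A" "dim_col C"])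
     (auto simp: kron_index pair_index_less ring_distribs)

lemma pair_index_eq_iff:
  fixes i k j l n :: nat
  assumes "k < n" "l < n"
  shows "i * n + k = j * n + l \<longleftrightarrow> i = j \<and> k = l"
proof
  assume "i * n + k = j * n + l"
  then have "(i * n + k) div n = (j * n + l) div n" "(i * n + k) mod n = (j * n + l) mod n"
    by simp_all
  then show "i = j \<and> k = l" using assms by simp
qed simp

lemma kron_one: "kron (1\<^sub>m a) (1\<^sub>m b) = (1\<^sub>m (a * b) :: 'a::comm_semiring_1 mat)"
  by (rule eq_mat_pairI[of _ a b a b])
     (auto simp: kron_index pair_index_less pair_index_eq_iff)

lemma kron_one_left [simp]: "kron (1\<^sub>m (Suc 0)) A = (A :: 'a::comm_semiring_1 mat)"
  by (rule eq_matI) (auto simp: kron_def)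

lemma kron_one_right [simp]: "kron A (1\<^sub>m (Suc 0)) = (A :: 'a::comm_semiring_1 mat)"
  by (rule eq_matI) (auto simp: kron_def)

lemma kron_zero_left [simp]: "kron (0\<^sub>m a b) A = (0\<^sub>m (a * dim_row A) (b * dim_col A) :: 'a::comm_semiring_1 mat)"
  by (rule eq_matI) (auto simp: kron_def less_mult_imp_div_less)

lemma kron_zero_right [simp]: "kron A (0\<^sub>m a b) = (0\<^sub>m (dim_row A * a) (dim_col A * b) :: 'a::comm_semiring_1 mat)"
proof (rule eq_matI)
  fix i j assume "i < dim_row (0\<^sub>m (dim_row A * a) (dim_col A * b) :: 'a mat)"
    "j < dim_col (0\<^sub>m (dim_row A * a) (dim_col A * b) :: 'a mat)"
  then show "kron A (0\<^sub>m a b) $$ (i, j) = (0\<^sub>m (dim_row A * a) (dim_col A * b)) $$ (i, j)"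
    by (cases "a = 0"; cases "b = 0") (auto simp: kron_def)
qed auto

lemma transpose_kron: "(kron A B)\<^sup>T = kron (A\<^sup>T) (B\<^sup>T)"
  by (rule eq_mat_pairI[of _ "dim_col A" "dim_col B" "dim_row A" "dim_row B"])
     (auto simp: kron_index pair_index_less)

section \<open>Graded rings and homotopies\<close>

text \<open>
  Closure properties of the homogeneous parts under which products, sums and Kronecker products
  of homogeneous matrices are homogeneous again.
\<close>

locale graded_ring =
  fixes R :: "int \<Rightarrow> 'r::comm_ring_1 set"
  assumes zero_mem [simp]: "0 \<in> R q"
    and add_mem: "x \<in> R q \<Longrightarrow> y \<in> R q \<Longrightarrow> x + y \<in> R q"
    and uminus_mem: "x \<in> R q \<Longrightarrow> - x \<in> R q"
    and one_mem: "1 \<in> R 0"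
    and mult_mem: "x \<in> R q \<Longrightarrow> y \<in> R q' \<Longrightarrow> x * y \<in> R (q + q')"
begin

lemma sum_mem: "(\<And>x. x \<in> A \<Longrightarrow> f x \<in> R q) \<Longrightarrow> sum f A \<in> R q"
  by (induction A rule: infinite_finite_induct) (auto intro: add_mem)

text \<open>
  Zero lies in every homogeneous part, hence the quantum condition can be imposed on all entries
  and not only on the nonzero ones.
\<close>

lemma homog_map_iff:
  "homog_map R a b C C' M \<longleftrightarrow> dim_row M = rk C' \<and> dim_col M = rk C \<and>
     (\<forall>i<rk C'. \<forall>j<rk C. (M $$ (i, j) \<noteq> 0 \<longrightarrow> hdeg C' i = hdeg C j + a) \<and>
        M $$ (i, j) \<in> R (qdeg C j + b - qdeg C' i))"
  unfolding homog_map_def carrier_mat_def by (auto) (metis zero_mem)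

lemma homog_mult:
  assumes N: "homog_map R a' b' C' C'' N" and M: "homog_map R a b C C' M"
    and a: "c = a + a'" "d = b + b'"
  shows "homog_map R c d C C'' (N * M)"
  unfolding homog_map_iff
proof (intro conjI allI impI)
  show dim: "dim_row (N * M) = rk C''" "dim_col (N * M) = rk C"
    using M N by (auto simp: homog_map_iff)
  fix i j assume ij: "i < rk C''" "j < rk C"
  have eq: "(N * M) $$ (i, j) = (\<Sum>k<rk C'. N $$ (i, k) * M $$ (k, j))"
    using ij M N by (subst mat_mult_index) (auto simp: homog_map_iff)
  show "hdeg C'' i = hdeg C j + c" if "(N * M) $$ (i, j) \<noteq> 0"
  proof -
    have "\<exists>k<rk C'. N $$ (i, k) * M $$ (k, j) \<noteq> 0"
      using that unfolding eq by (meson lessThan_iff sum.neutral)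
    then obtain k where "k < rk C'" "N $$ (i, k) * M $$ (k, j) \<noteq> 0" by blast
    moreover from this have "N $$ (i, k) \<noteq> 0" "M $$ (k, j) \<noteq> 0" by auto
    ultimately show ?thesis using M N ij a by (auto simp: homog_map_iff)
  qed
  show "(N * M) $$ (i, j) \<in> R (qdeg C j + d - qdeg C'' i)"
    unfolding eq
  proof (rule sum_mem)
    fix k assume "k \<in> {..<rk C'}"
    then have "N $$ (i, k) \<in> R (qdeg C' k + b' - qdeg C'' i)" "M $$ (k, j) \<in> R (qdeg C j + b - qdeg C' k)"
      using M N ij by (auto simp: homog_map_iff)
    from mult_mem[OF this] show "N $$ (i, k) * M $$ (k, j) \<in> R (qdeg C j + d - qdeg C'' i)"
      by (simp add: a algebra_simps)
  qed
qed

lemma homog_add: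
  "homog_map R a b C C' M \<Longrightarrow> homog_map R a b C C' N \<Longrightarrow> homog_map R a b C C' (M + N)"
  unfolding homog_map_iff by (auto intro: add_mem) (metis add.right_neutral)

lemma homog_uminus: "homog_map R a b C C' M \<Longrightarrow> homog_map R a b C C' (- M)"
  unfolding homog_map_iff by (auto intro: uminus_mem)

lemma homog_minus:
  assumes "homog_map R a b C C' M" "homog_map R a b C C' N"
  shows "homog_map R a b C C' (M - N)"
proof -
  have "M - N = M + - N"
    using assms by (intro eq_matI) (auto simp: homog_map_iff)
  then show ?thesis using assms by (simp add: homog_add homog_uminus)
qed

lemma homog_zero: "homog_map R a b C C' (0\<^sub>m (rk C') (rk C))"
  unfolding homog_map_iff by auto

lemma homog_one: "homog_map R 0 0 C C (1\<^sub>m (rk C))"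
  unfolding homog_map_iff by (auto simp: one_mem)

lemma homog_dim: "homog_map R a b C C' M \<Longrightarrow> dim_row M = rk C' \<and> dim_col M = rk C"
  by (simp add: homog_map_iff)

lemma complexD:
  assumes "is_complex R C"
  shows "homog_map R 1 0 C C (diff C)" "dim_row (diff C) = rk C" "dim_col (diff C) = rk C"
    "diff C * diff C = 0\<^sub>m (rk C) (rk C)"
  using assms by (auto simp: is_complex_def homog_map_iff)

lemma chain_mapD:
  assumes "chain_map R C C' F"
  shows "homog_map R 0 0 C C' F" "dim_row F = rk C'" "dim_col F = rk C"
    "F * diff C = diff C' * F"
  using assms by (auto simp: chain_map_def homog_map_iff)

lemma homotopicE:
  assumes "chain_homotopic R C C' F G"
  obtains K where "homog_map R (-1) 0 C C' K" "dim_row K = rk C'" "dim_col K = rk C"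
    "F - G = diff C' * K + K * diff C"
  using assms by (auto simp: chain_homotopic_def homog_map_iff)

lemma chain_map_one: "is_complex R C \<Longrightarrow> chain_map R C C (1\<^sub>m (rk C))"
  by (simp add: chain_map_def homog_one complexD)

lemma chain_map_mult:
  assumes "is_complex R C" "is_complex R C'" "is_complex R C''"
    and "chain_map R C' C'' G" "chain_map R C C' F"
  shows "chain_map R C C'' (G * F)"
proof -
  note D = complexD[OF assms(1)] complexD[OF assms(2)] complexD[OF assms(3)]
    chain_mapD[OF assms(4)] chain_mapD[OF assms(5)]
  have "G * F * diff C = G * (diff C' * F)" by (simp add: D mat_assoc)
  also have "\<dots> = (G * diff C') * F" by (simp add: D mat_assoc del: D(16))
  also have "\<dots> = diff C'' * (G * F)" by (simp add: D mat_assoc)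
  finally show ?thesis using D unfolding chain_map_def by (auto intro!: homog_mult)
qed

lemma homotopic_refl:
  assumes "is_complex R C" "is_complex R C'" "dim_row F = rk C'" "dim_col F = rk C"
  shows "chain_homotopic R C C' F F"
  unfolding chain_homotopic_def
  by (rule exI[of _ "0\<^sub>m (rk C') (rk C)"]) (auto simp: homog_zero complexD assms)

lemma homotopic_sym:
  assumes "is_complex R C" "is_complex R C'" "chain_map R C C' F" "chain_map R C C' G"
    and "chain_homotopic R C C' F G"
  shows "chain_homotopic R C C' G F"
proof -
  note D = complexD[OF assms(1)] complexD[OF assms(2)] chain_mapD[OF assms(3)] chain_mapD[OF assms(4)]
  obtain K where K: "homog_map R (-1) 0 C C' K" "dim_row K = rk C'" "dim_col K = rk C"
    "F - G = diff C' * K + K * diff C" using assms(5) by (rule homotopicE)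
  have "G - F = - (F - G)" using D by (intro eq_matI) auto
  also have "\<dots> = diff C' * (- K) + (- K) * diff C"
    unfolding K(4) using D K by (simp add: mat_expand) (intro eq_matI, auto)
  finally show ?thesis using K homog_uminus unfolding chain_homotopic_def by blast
qed

lemma homotopic_trans:
  assumes "is_complex R C" "is_complex R C'"
    and "chain_map R C C' F" "chain_map R C C' G" "chain_map R C C' H"
    and "chain_homotopic R C C' F G" "chain_homotopic R C C' G H"
  shows "chain_homotopic R C C' F H"
proof -
  note D = complexD[OF assms(1)] complexD[OF assms(2)] chain_mapD[OF assms(3)]
    chain_mapD[OF assms(4)] chain_mapD[OF assms(5)]
  obtain K where K: "homog_map R (-1) 0 C C' K" "dim_row K = rk C'" "dim_col K = rk C"
    "F - G = diff C' * K + K * diff C" using assms(6) by (rule homotopicE)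
  obtain L where L: "homog_map R (-1) 0 C C' L" "dim_row L = rk C'" "dim_col L = rk C"
    "G - H = diff C' * L + L * diff C" using assms(7) by (rule homotopicE)
  have "F - H = (F - G) + (G - H)" using D by (intro eq_matI) auto
  also have "\<dots> = diff C' * (K + L) + (K + L) * diff C"
    unfolding K(4) L(4) using D K L
    by (simp add: mat_expand) (intro eq_matI, auto simp del: index_mult_mat(1) simp: algebra_simps)
  finally show ?thesis using K L homog_add unfolding chain_homotopic_def by blast
qed

lemma homotopic_mult_left:
  assumes "is_complex R C" "is_complex R C'" "is_complex R C''"
    and "chain_map R C C' F" "chain_map R C C' G" "chain_map R C' C'' H"
    and "chain_homotopic R C C' F G"
  shows "chain_homotopic R C C'' (H * F) (H * G)"
proof -
  note D = complexD[OF assms(1)] complexD[OF assms(2)] complexD[OF assms(3)]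
    chain_mapD[OF assms(4)] chain_mapD[OF assms(5)] chain_mapD[OF assms(6)]
  obtain K where K: "homog_map R (-1) 0 C C' K" "dim_row K = rk C'" "dim_col K = rk C"
    "F - G = diff C' * K + K * diff C" using assms(7) by (rule homotopicE)
  have "H * F - H * G = H * (F - G)" using D by (simp add: mat_expand)
  also have "\<dots> = (H * diff C') * K + H * K * diff C"
    unfolding K(4) using D(1-23) K by (simp add: mat_distl mat_assoc)
  also have "\<dots> = diff C'' * (H * K) + H * K * diff C"
    using D K by (simp add: mat_assoc)
  finally show ?thesis
    using homog_mult[OF chain_mapD(1)[OF assms(6)] K(1)] unfolding chain_homotopic_def by auto
qed

lemma homotopic_mult_right:
  assumes "is_complex R C" "is_complex R C'" "is_complex R C''"
    and "chain_map R C' C'' F" "chain_map R C' C'' G" "chain_map R C C' H"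
    and "chain_homotopic R C' C'' F G"
  shows "chain_homotopic R C C'' (F * H) (G * H)"
proof -
  note D = complexD[OF assms(1)] complexD[OF assms(2)] complexD[OF assms(3)]
    chain_mapD[OF assms(4)] chain_mapD[OF assms(5)] chain_mapD[OF assms(6)]
  obtain K where K: "homog_map R (-1) 0 C' C'' K" "dim_row K = rk C''" "dim_col K = rk C'"
    "F - G = diff C'' * K + K * diff C'" using assms(7) by (rule homotopicE)
  have "F * H - G * H = (F - G) * H" using D by (simp add: mat_minus_distr)
  also have "\<dots> = diff C'' * (K * H) + K * (H * diff C)"
    unfolding K(4) using D K by (simp add: mat_expand)
  also have "\<dots> = diff C'' * (K * H) + (K * H) * diff C"
    using D K by (simp add: mat_assoc)
  finally show ?thesis
    using homog_mult[OF K(1) chain_mapD(1)[OF assms(6)]] unfolding chain_homotopic_def by auto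
qed

end

context graded_ring
begin

lemma homotopic_mult:
  assumes "is_complex R C" "is_complex R C'" "is_complex R C''"
    and "chain_map R C C' F" "chain_map R C C' F'" "chain_map R C' C'' G" "chain_map R C' C'' G'"
    and "chain_homotopic R C C' F F'" "chain_homotopic R C' C'' G G'"
  shows "chain_homotopic R C C'' (G * F) (G' * F')"
proof (rule homotopic_trans[OF assms(1,3)])
  show "chain_homotopic R C C'' (G * F) (G * F')"
    using assms by (intro homotopic_mult_left[of C C' C''])
  show "chain_homotopic R C C'' (G * F') (G' * F')"
    using assms by (intro homotopic_mult_right[of C C' C''])
qed (use assms in \<open>auto intro!: chain_map_mult[of C C' C'']\<close>)

lemma he_comp:
  assumes "is_complex R C" "is_complex R C'" "is_complex R C''"
    and "homotopy_equivalence R C C' F" "homotopy_equivalence R C' C'' H"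
  shows "homotopy_equivalence R C C'' (H * F)"
proof -
  obtain G where G: "chain_map R C C' F" "chain_map R C' C G"
    "chain_homotopic R C C (G * F) (1\<^sub>m (rk C))" "chain_homotopic R C' C' (F * G) (1\<^sub>m (rk C'))"
    using assms(4) by (auto simp: homotopy_equivalence_def)
  obtain K where K: "chain_map R C' C'' H" "chain_map R C'' C' K"
    "chain_homotopic R C' C' (K * H) (1\<^sub>m (rk C'))" "chain_homotopic R C'' C'' (H * K) (1\<^sub>m (rk C''))"
    using assms(5) by (auto simp: homotopy_equivalence_def)
  note dims = chain_mapD(2,3)[OF G(1)] chain_mapD(2,3)[OF G(2)]
    chain_mapD(2,3)[OF K(1)] chain_mapD(2,3)[OF K(2)]
  note cm = chain_map_mult[OF assms(1,2,3) K(1) G(1)] chain_map_mult[OF assms(3,2,1) G(2) K(2)]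
    chain_map_mult[OF assms(1,2,1) G(2) G(1)] chain_map_mult[OF assms(3,2,3) K(1) K(2)]
    chain_map_mult[OF assms(2,3,2) K(2) K(1)] chain_map_mult[OF assms(2,1,2) G(1) G(2)]
    chain_map_one[OF assms(1)] chain_map_one[OF assms(2)] chain_map_one[OF assms(3)]
  have "chain_homotopic R C C (G * K * (H * F)) (1\<^sub>m (rk C))"
  proof (rule homotopic_trans[OF assms(1,1)])
    have "chain_homotopic R C C' ((K * H) * F) (1\<^sub>m (rk C') * F)"
      using assms cm G K by (intro homotopic_mult_right[of C C' C']) auto
    then have "chain_homotopic R C C (G * ((K * H) * F)) (G * (1\<^sub>m (rk C') * F))"
      using assms cm G K by (intro homotopic_mult_left[of C C' C]) (auto intro: chain_map_mult[of C C' C'])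
    then show "chain_homotopic R C C (G * K * (H * F)) (G * F)"
      using dims by (simp add: mat_assoc)
  qed (use assms G cm in \<open>auto intro: chain_map_mult[of C C'' C]\<close>)
  moreover have "chain_homotopic R C'' C'' (H * F * (G * K)) (1\<^sub>m (rk C''))"
  proof (rule homotopic_trans[OF assms(3,3)])
    have "chain_homotopic R C'' C' ((F * G) * K) (1\<^sub>m (rk C') * K)"
      using assms cm G K by (intro homotopic_mult_right[of C'' C' C']) auto
    then have "chain_homotopic R C'' C'' (H * ((F * G) * K)) (H * (1\<^sub>m (rk C') * K))"
      using assms cm G K by (intro homotopic_mult_left[of C'' C' C'']) (auto intro: chain_map_mult[of C'' C' C'])
    then show "chain_homotopic R C'' C'' (H * F * (G * K)) (H * K)"
      using dims by (simp add: mat_assoc)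
  qed (use assms K cm in \<open>auto intro: chain_map_mult[of C'' C C'']\<close>)
  ultimately show ?thesis unfolding homotopy_equivalence_def using cm by blast
qed

lemma he_iso:
  assumes "is_complex R C" "is_complex R C'" "chain_map R C C' F" "chain_map R C' C G"
    and "G * F = 1\<^sub>m (rk C)" "F * G = 1\<^sub>m (rk C')"
  shows "homotopy_equivalence R C C' F"
  unfolding homotopy_equivalence_def using assms
  by (auto intro!: exI[of _ G] homotopic_refl)

lemma he_one: "is_complex R C \<Longrightarrow> homotopy_equivalence R C C (1\<^sub>m (rk C))"
  by (rule he_iso[where G = "1\<^sub>m (rk C)"]) (auto simp: chain_map_one)

end

section \<open>Tensor products\<close>

lemma rk_tensor [simp]: "rk (tensor_cplx C C') = rk C * rk C'"
  by (simp add: tensor_cplx_def)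

lemma tensor_gens:
  assumes "i < rk C" "k < rk C'"
  shows "gens (tensor_cplx C C') ! (i * rk C' + k) = (hdeg C i + hdeg C' k, qdeg C i + qdeg C' k)"
proof -
  have "rk C' > 0" using assms by linarith
  then have "(i * rk C' + k) div rk C' = i" "(i * rk C' + k) mod rk C' = k"
    using assms by simp_all
  then show ?thesis
    using assms by (simp add: tensor_cplx_def List.product_nth pair_index_less split_beta)
qed

lemma dim_sign_mat [simp]: "dim_row (sign_mat C) = rk C" "dim_col (sign_mat C) = rk C"
  by (simp_all add: sign_mat_def)

lemma sign_mat_index:
  "i < rk C \<Longrightarrow> j < rk C \<Longrightarrow> sign_mat C $$ (i, j) = (if i = j then (if even (hdeg C i) then 1 else - 1) else 0)"
  by (simp add: sign_mat_def)

lemma sign_mat_mult_left: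
  assumes "dim_row M = rk C" "i < rk C" "j < dim_col M"
  shows "(sign_mat C * M) $$ (i, j) = (if even (hdeg C i) then M $$ (i, j) else - M $$ (i, j))"
proof -
  have "(sign_mat C * M) $$ (i, j) = (\<Sum>k<rk C. (if k = i then (if even (hdeg C i) then 1 else - 1) * M $$ (i, j) else 0))"
    using assms by (subst mat_mult_index, simp, simp, simp, intro sum.cong) (auto simp: sign_mat_index)
  then show ?thesis using assms by simp
qed

lemma sign_mat_mult_right:
  assumes "dim_col M = rk C" "i < dim_row M" "j < rk C"
  shows "(M * sign_mat C) $$ (i, j) = (if even (hdeg C j) then M $$ (i, j) else - M $$ (i, j))"
proof -
  have "(M * sign_mat C) $$ (i, j) = (\<Sum>k<rk C. (if k = j then M $$ (i, j) * (if even (hdeg C j) then 1 else - 1) else 0))"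
    using assms by (subst mat_mult_index, simp, simp, simp, intro sum.cong) (auto simp: sign_mat_index)
  then show ?thesis using assms by simp
qed

lemma sign_mat_square [simp]: "sign_mat C * sign_mat C = 1\<^sub>m (rk C)"
  by (rule eq_matI) (auto simp: sign_mat_mult_left sign_mat_index simp del: index_mult_mat(1))

lemma transpose_sign_mat [simp]: "(sign_mat C)\<^sup>T = sign_mat C"
  by (rule eq_matI) (auto simp: sign_mat_index)

lemma sign_mat_tensor: "sign_mat (tensor_cplx C C') = kron (sign_mat C) (sign_mat C')"
  by (rule eq_mat_pairI[of _ "rk C" "rk C'" "rk C" "rk C'"])
     (auto simp: kron_index sign_mat_index pair_index_less tensor_gens pair_index_eq_iff)

lemma diff_tensor: "diff (tensor_cplx C C') =
    kron (diff C) (1\<^sub>m (rk C')) + kron (sign_mat C) (diff C')"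
  by (simp add: tensor_cplx_def)

context graded_ring
begin

lemma homog_sign: "homog_map R 0 0 C C (sign_mat C)"
  unfolding homog_map_iff by (auto simp: sign_mat_index one_mem uminus_mem)

lemma sign_mat_even_comm:
  assumes "homog_map R a b C C' M" "even a"
  shows "sign_mat C' * M = M * sign_mat C"
proof (rule eq_matI)
  fix i j assume "i < dim_row (M * sign_mat C)" "j < dim_col (M * sign_mat C)"
  then have "i < rk C'" "j < rk C" using assms by (auto simp: homog_map_iff)
  then show "(sign_mat C' * M) $$ (i, j) = (M * sign_mat C) $$ (i, j)"
    using assms by (cases "M $$ (i, j) = 0")
      (auto simp: sign_mat_mult_left sign_mat_mult_right homog_map_iff simp del: index_mult_mat(1))
qed (use homog_dim[OF assms(1)] in auto)

text \<open>
  A map of odd homological degree exchanges even and odd generators, hence anticommutes with the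
  sign; this is the source of every cancellation in tensor products and duals below.
\<close>

lemma sign_mat_odd_comm:
  assumes "homog_map R a b C C' M" "odd a"
  shows "sign_mat C' * M = - (M * sign_mat C)"
proof (rule eq_matI)
  fix i j assume "i < dim_row (- (M * sign_mat C))" "j < dim_col (- (M * sign_mat C))"
  then have ij: "i < rk C'" "j < rk C" using assms by (auto simp: homog_map_iff)
  then have "(- (M * sign_mat C)) $$ (i, j) = - (M * sign_mat C) $$ (i, j)"
    using homog_dim[OF assms(1)] by (intro index_uminus_mat) auto
  then show "(sign_mat C' * M) $$ (i, j) = (- (M * sign_mat C)) $$ (i, j)"
    using assms ij by (cases "M $$ (i, j) = 0")
      (auto simp: sign_mat_mult_left sign_mat_mult_right homog_map_iff simp del: index_mult_mat(1))
qed (use homog_dim[OF assms(1)] in auto)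

lemma homog_kron:
  assumes "homog_map R a b C D A" "homog_map R a' b' C' D' B" "c = a + a'" "d = b + b'"
  shows "homog_map R c d (tensor_cplx C C') (tensor_cplx D D') (kron A B)"
proof -
  have *: "(kron A B $$ (x, y) \<noteq> 0 \<longrightarrow> hdeg (tensor_cplx D D') x = hdeg (tensor_cplx C C') y + c) \<and>
     kron A B $$ (x, y) \<in> R (qdeg (tensor_cplx C C') y + d - qdeg (tensor_cplx D D') x)"
    if xy: "x < rk D * rk D'" "y < rk C * rk C'" for x y
  proof -
    obtain i k where x: "x = i * rk D' + k" "i < rk D" "k < rk D'" using xy(1) by (rule pair_indexE)
    obtain j l where y: "y = j * rk C' + l" "j < rk C" "l < rk C'" using xy(2) by (rule pair_indexE)
    have e: "kron A B $$ (x, y) = A $$ (i, j) * B $$ (k, l)"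
      unfolding x y using homog_dim[OF assms(1)] homog_dim[OF assms(2)] x y by (simp add: kron_index)
    have "A $$ (i, j) \<in> R (qdeg C j + b - qdeg D i)" "B $$ (k, l) \<in> R (qdeg C' l + b' - qdeg D' k)"
      using x y assms by (auto simp: homog_map_iff)
    from mult_mem[OF this] have 1: "A $$ (i, j) * B $$ (k, l) \<in> R (qdeg C j + qdeg C' l + d - (qdeg D i + qdeg D' k))"
      by (simp add: assms algebra_simps)
    have 2: "hdeg D i = hdeg C j + a" "hdeg D' k = hdeg C' l + a'" if "A $$ (i, j) * B $$ (k, l) \<noteq> 0"
    proof -
      have "A $$ (i, j) \<noteq> 0" "B $$ (k, l) \<noteq> 0" using that by auto
      then show "hdeg D i = hdeg C j + a" "hdeg D' k = hdeg C' l + a'"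
        using x y assms by (auto simp: homog_map_iff)
    qed
    show ?thesis unfolding e using 1 2 x y assms by (auto simp: tensor_gens)
  qed
  show ?thesis unfolding homog_map_iff using * homog_dim[OF assms(1)] homog_dim[OF assms(2)] by simp
qed

lemma is_complex_tensor:
  assumes "is_complex R C" "is_complex R C'"
  shows "is_complex R (tensor_cplx C C')"
  unfolding is_complex_def
proof
  note D = complexD[OF assms(1)] complexD[OF assms(2)]
  show "homog_map R 1 0 (tensor_cplx C C') (tensor_cplx C C') (diff (tensor_cplx C C'))"
    unfolding diff_tensor using D by (intro homog_add homog_kron[OF D(1) homog_one] homog_kron[OF homog_sign D(5)]) auto
  have s: "sign_mat C * diff C = - (diff C * sign_mat C)"
    using D by (intro sign_mat_odd_comm) auto
  show "diff (tensor_cplx C C') * diff (tensor_cplx C C') = 0\<^sub>m (rk (tensor_cplx C C')) (rk (tensor_cplx C C'))"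
    unfolding diff_tensor using D
    by (simp add: mat_expand kron_mult s kron_uminus_left) (intro eq_matI; simp del: index_mult_mat(1))
qed

lemma chain_map_kron:
  assumes "is_complex R C" "is_complex R C'" "is_complex R D" "is_complex R D'"
    and "chain_map R C D F" "chain_map R C' D' G"
  shows "chain_map R (tensor_cplx C C') (tensor_cplx D D') (kron F G)"
  unfolding chain_map_def
proof
  note D = complexD[OF assms(1)] complexD[OF assms(2)] complexD[OF assms(3)] complexD[OF assms(4)]
    chain_mapD[OF assms(5)] chain_mapD[OF assms(6)]
  show "homog_map R 0 0 (tensor_cplx C C') (tensor_cplx D D') (kron F G)"
    using chain_mapD(1)[OF assms(5)] chain_mapD(1)[OF assms(6)] by (rule homog_kron) auto
  have s: "sign_mat D * F = F * sign_mat C"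
    using chain_mapD(1)[OF assms(5)] by (rule sign_mat_even_comm) auto
  show "kron F G * diff (tensor_cplx C C') = diff (tensor_cplx D D') * kron F G"
    unfolding diff_tensor using D by (simp add: mat_expand kron_mult s)
qed

text \<open>
  If \<open>K\<close> is a homotopy from \<open>F\<close> to \<open>F'\<close>, then \<open>K \<otimes> G\<close> is one from \<open>F \<otimes> G\<close> to \<open>F' \<otimes> G\<close>: the
  mixed terms cancel because \<open>K\<close> anticommutes with the sign in the differential.
\<close>

lemma homotopic_kron_left:
  assumes "is_complex R C" "is_complex R C'" "is_complex R D" "is_complex R D'"
    and "chain_map R C D F" "chain_map R C D F'" "chain_map R C' D' G" "chain_homotopic R C D F F'"
  shows "chain_homotopic R (tensor_cplx C C') (tensor_cplx D D') (kron F G) (kron F' G)"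
proof -
  note D = complexD[OF assms(1)] complexD[OF assms(2)] complexD[OF assms(3)] complexD[OF assms(4)]
    chain_mapD(2,3)[OF assms(5)] chain_mapD(2,3)[OF assms(6)] chain_mapD[OF assms(7)]
  obtain K where K: "homog_map R (-1) 0 C D K" "dim_row K = rk D" "dim_col K = rk C"
    "F - F' = diff D * K + K * diff C" using assms(8) by (rule homotopicE)
  have s: "sign_mat D * K = - (K * sign_mat C)"
    using K(1) by (rule sign_mat_odd_comm) auto
  have "kron F G - kron F' G = kron (F - F') G" using D by (simp add: kron_minus_left)
  also have "\<dots> = diff (tensor_cplx D D') * kron K G + kron K G * diff (tensor_cplx C C')"
    unfolding K(4) diff_tensor using D K(1-3)
    by (simp add: mat_expand kron_mult s kron_uminus_left kron_add_left)
       (intro eq_matI; simp del: index_mult_mat(1))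
  finally show ?thesis
    unfolding chain_homotopic_def using homog_kron[OF K(1) chain_mapD(1)[OF assms(7)]] by auto
qed

text \<open>
  In the second factor the homotopy carries a sign, \<open>x \<otimes> y \<mapsto> (-1)^i G x \<otimes> K y\<close> for \<open>x\<close> of degree
  \<open>i\<close>, because it has to pass the differential of the first factor.
\<close>

lemma homotopic_kron_right:
  assumes "is_complex R C" "is_complex R C'" "is_complex R D" "is_complex R D'"
    and "chain_map R C D G" "chain_map R C' D' F" "chain_map R C' D' F'" "chain_homotopic R C' D' F F'"
  shows "chain_homotopic R (tensor_cplx C C') (tensor_cplx D D') (kron G F) (kron G F')"
proof -
  note D = complexD[OF assms(1)] complexD[OF assms(2)] complexD[OF assms(3)] complexD[OF assms(4)]
    chain_mapD[OF assms(5)] chain_mapD(2,3)[OF assms(6)] chain_mapD(2,3)[OF assms(7)]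
  obtain K where K: "homog_map R (-1) 0 C' D' K" "dim_row K = rk D'" "dim_col K = rk C'"
    "F - F' = diff D' * K + K * diff C'" using assms(8) by (rule homotopicE)
  have s: "sign_mat D * G = G * sign_mat C" 
    using chain_mapD(1)[OF assms(5)] by (rule sign_mat_even_comm) auto
  have sd: "sign_mat D * diff D = - (diff D * sign_mat D)"
    using D by (intro sign_mat_odd_comm) auto
  have s2: "sign_mat D * (G * sign_mat C) = G"
    unfolding s[symmetric] using D by (simp add: mat_assoc[symmetric])
  have s3: "sign_mat D * (sign_mat D * G) = G"
    using D by (simp add: mat_assoc[symmetric])
  have s4: "diff D * (sign_mat D * G) = - (sign_mat D * (diff D * G))"
    using D sd by (simp add: mat_assoc[symmetric])
  have "kron G F - kron G F' = kron G (F - F')" using D by (simp add: kron_minus_right)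
  also have "\<dots> = diff (tensor_cplx D D') * kron (sign_mat D * G) K + kron (sign_mat D * G) K * diff (tensor_cplx C C')"
    unfolding K(4) diff_tensor using D K(1-3)
    by (simp add: mat_distl mat_distr mat_assoc kron_mult s2 s3 s4 kron_uminus_left kron_add_right)
       (intro eq_matI; simp del: index_mult_mat(1))
  finally show ?thesis
    unfolding chain_homotopic_def
    using homog_kron[OF homog_mult[OF homog_sign chain_mapD(1)[OF assms(5)] refl refl] K(1)] by auto
qed

lemma homotopic_kron:
  assumes "is_complex R C" "is_complex R C'" "is_complex R D" "is_complex R D'"
    and "chain_map R C D F" "chain_map R C D F'" "chain_map R C' D' G" "chain_map R C' D' G'"
    and "chain_homotopic R C D F F'" "chain_homotopic R C' D' G G'"
  shows "chain_homotopic R (tensor_cplx C C') (tensor_cplx D D') (kron F G) (kron F' G')"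
proof (rule homotopic_trans)
  show "chain_homotopic R (tensor_cplx C C') (tensor_cplx D D') (kron F G) (kron F' G)"
    using assms by (intro homotopic_kron_left)
  show "chain_homotopic R (tensor_cplx C C') (tensor_cplx D D') (kron F' G) (kron F' G')"
    using assms by (intro homotopic_kron_right)
qed (use assms in \<open>auto intro!: is_complex_tensor chain_map_kron\<close>)

lemma he_kron:
  assumes "is_complex R C" "is_complex R C'" "is_complex R D" "is_complex R D'"
    and "homotopy_equivalence R C D F" "homotopy_equivalence R C' D' G"
  shows "homotopy_equivalence R (tensor_cplx C C') (tensor_cplx D D') (kron F G)"
proof -
  obtain F' where F: "chain_map R C D F" "chain_map R D C F'"
    "chain_homotopic R C C (F' * F) (1\<^sub>m (rk C))" "chain_homotopic R D D (F * F') (1\<^sub>m (rk D))"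
    using assms(5) by (auto simp: homotopy_equivalence_def)
  obtain G' where G: "chain_map R C' D' G" "chain_map R D' C' G'"
    "chain_homotopic R C' C' (G' * G) (1\<^sub>m (rk C'))" "chain_homotopic R D' D' (G * G') (1\<^sub>m (rk D'))"
    using assms(6) by (auto simp: homotopy_equivalence_def)
  note dims = chain_mapD(2,3)[OF F(1)] chain_mapD(2,3)[OF F(2)] chain_mapD(2,3)[OF G(1)] chain_mapD(2,3)[OF G(2)]
  have "chain_homotopic R (tensor_cplx C C') (tensor_cplx C C') (kron (F' * F) (G' * G)) (kron (1\<^sub>m (rk C)) (1\<^sub>m (rk C')))"
    using assms F G by (intro homotopic_kron) (auto intro: chain_map_one chain_map_mult[of C D C] chain_map_mult[of C' D' C'])
  moreover have "chain_homotopic R (tensor_cplx D D') (tensor_cplx D D') (kron (F * F') (G * G')) (kron (1\<^sub>m (rk D)) (1\<^sub>m (rk D')))"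
    using assms F G by (intro homotopic_kron) (auto intro: chain_map_one chain_map_mult[of D C D] chain_map_mult[of D' C' D'])
  ultimately have "chain_homotopic R (tensor_cplx C C') (tensor_cplx C C') (kron F' G' * kron F G) (1\<^sub>m (rk (tensor_cplx C C')))"
    "chain_homotopic R (tensor_cplx D D') (tensor_cplx D D') (kron F G * kron F' G') (1\<^sub>m (rk (tensor_cplx D D')))"
    using dims by (simp_all add: kron_mult kron_one)
  then show ?thesis unfolding homotopy_equivalence_def
    using assms F G by (auto intro!: chain_map_kron exI[of _ "kron F' G'"])
qed

end

lemma cplx_eqI: "gens C = gens C' \<Longrightarrow> diff C = diff C' \<Longrightarrow> C = C'"
  by (cases C; cases C') auto

text \<open>
  Generators are ordered lexicographically, so both bracketings produce the same list and the same
  matrix: the tensor product is strictly associative.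
\<close>

lemma tensor_assoc: "tensor_cplx (tensor_cplx A B) C = tensor_cplx A (tensor_cplx B C)"
  if "dim_row (diff A) = rk A" "dim_col (diff A) = rk A" "dim_row (diff B) = rk B" "dim_col (diff B) = rk B"
    "dim_row (diff C) = rk C" "dim_col (diff C) = rk C"
proof (rule cplx_eqI)
  show "gens (tensor_cplx (tensor_cplx A B) C) = gens (tensor_cplx A (tensor_cplx B C))"
  proof (rule nth_equalityI)
    fix x assume "x < rk (tensor_cplx (tensor_cplx A B) C)"
    then obtain y k where x: "x = y * rk C + k" "y < rk A * rk B" "k < rk C"
      by (auto elim: pair_indexE)
    obtain i j where y: "y = i * rk B + j" "i < rk A" "j < rk B" using x(2) by (rule pair_indexE)
    have x': "x = i * rk (tensor_cplx B C) + (j * rk C + k)" by (simp add: x y algebra_simps)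
    have "gens (tensor_cplx (tensor_cplx A B) C) ! x = (hdeg A i + hdeg B j + hdeg C k, qdeg A i + qdeg B j + qdeg C k)"
      unfolding x using x y by (subst tensor_gens) (auto simp: tensor_gens)
    moreover have "gens (tensor_cplx A (tensor_cplx B C)) ! x = (hdeg A i + hdeg B j + hdeg C k, qdeg A i + qdeg B j + qdeg C k)"
      unfolding x' using x y by (subst tensor_gens) (auto simp: tensor_gens pair_index_less)
    ultimately show "gens (tensor_cplx (tensor_cplx A B) C) ! x = gens (tensor_cplx A (tensor_cplx B C)) ! x" by simp
  qed simp
  show "diff (tensor_cplx (tensor_cplx A B) C) = diff (tensor_cplx A (tensor_cplx B C))"
    using that
    by (simp add: diff_tensor sign_mat_tensor kron_add_left kron_add_right kron_one[symmetric] kron_assoc)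
       (intro eq_matI; simp)
qed

lemma sign_mat_line: "sign_mat (Cplx [(0, q)] M) = 1\<^sub>m 1"
  by (rule eq_matI) (auto simp: sign_mat_def)

lemma tensor_unit_left: "tensor_cplx (Cplx [(0, 0)] (0\<^sub>m 1 1)) C = C"
  if "dim_row (diff C) = rk C" "dim_col (diff C) = rk C"
  by (rule cplx_eqI)
     (auto simp: diff_tensor sign_mat_line that, auto simp: tensor_cplx_def intro!: nth_equalityI)

lemma tensor_unit_right: "tensor_cplx C (Cplx [(0, 0)] (0\<^sub>m 1 1)) = C"
  if "dim_row (diff C) = rk C" "dim_col (diff C) = rk C"
  by (rule cplx_eqI)
     (auto simp: diff_tensor that, auto simp: tensor_cplx_def intro!: nth_equalityI simp: List.product_nth split_beta prod_eq_iff)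

lemma tensor_line: "tensor_cplx (Cplx [(0, p)] (0\<^sub>m 1 1)) (Cplx [(0, q)] (0\<^sub>m 1 1)) = Cplx [(0, p + q)] (0\<^sub>m 1 1)"
  by (rule cplx_eqI) (simp_all add: diff_tensor, simp_all add: tensor_cplx_def)

section \<open>Extension of scalars\<close>

lemma rk_base_change [simp]: "gens (base_change \<phi> C) = gens C"
  by (simp add: base_change_def)

lemma diff_base_change [simp]: "diff (base_change \<phi> C) = map_mat \<phi> (diff C)"
  by (simp add: base_change_def)

locale graded_ring_hom = S: graded_ring S + R: graded_ring R + semiring_hom \<phi>
  for R :: "int \<Rightarrow> 'r::comm_ring_1 set" and S :: "int \<Rightarrow> 's::comm_ring_1 set" and \<phi> :: "'r \<Rightarrow> 's" +
  assumes map_mem: "x \<in> R q \<Longrightarrow> \<phi> x \<in> S q"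
begin

sublocale comm_ring_hom \<phi> ..

lemma map_mat_mult: "dim_col A = dim_row B \<Longrightarrow> map_mat \<phi> (A * B) = map_mat \<phi> A * map_mat \<phi> B"
  by (intro mat_hom_mult[of A "dim_row A" "dim_col A" B "dim_col B"]) auto

lemma map_mat_add: "dim_row A = dim_row B \<Longrightarrow> dim_col A = dim_col B \<Longrightarrow> map_mat \<phi> (A + B) = map_mat \<phi> A + map_mat \<phi> B"
  by (rule eq_matI) (auto simp: hom_add)

lemma map_mat_minus: "dim_row A = dim_row B \<Longrightarrow> dim_col A = dim_col B \<Longrightarrow> map_mat \<phi> (A - B) = map_mat \<phi> A - map_mat \<phi> B"
  by (rule eq_matI) (auto simp: hom_minus)

lemma map_mat_uminus: "map_mat \<phi> (- A) = - map_mat \<phi> A"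
  by (rule eq_matI) (auto simp: hom_uminus)

lemma map_mat_zero [simp]: "map_mat \<phi> (0\<^sub>m a b) = 0\<^sub>m a b"
  by (rule eq_matI) auto

lemma map_mat_one [simp]: "map_mat \<phi> (1\<^sub>m a) = 1\<^sub>m a"
  by (rule eq_matI) auto

lemma map_mat_kron: "map_mat \<phi> (kron A B) = kron (map_mat \<phi> A) (map_mat \<phi> B)"
  by (rule eq_mat_pairI[of _ "dim_row A" "dim_row B" "dim_col A" "dim_col B"])
     (auto simp: kron_index pair_index_less hom_mult)

lemma map_mat_sign: "map_mat \<phi> (sign_mat C) = sign_mat (base_change \<phi> C)"
  by (rule eq_matI) (auto simp: sign_mat_index hom_uminus)

lemma homog_base_change:
  "homog_map R a b C C' M \<Longrightarrow> homog_map S a b (base_change \<phi> C) (base_change \<phi> C') (map_mat \<phi> M)"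
  unfolding S.homog_map_iff R.homog_map_iff by (auto intro: map_mem) (metis hom_zero)

lemma is_complex_base_change:
  assumes "is_complex R C" shows "is_complex S (base_change \<phi> C)"
  using homog_base_change[OF R.complexD(1)[OF assms]] R.complexD[OF assms]
  by (simp add: is_complex_def map_mat_mult[symmetric])

lemma chain_map_base_change:
  assumes "is_complex R C" "is_complex R C'" "chain_map R C C' F"
  shows "chain_map S (base_change \<phi> C) (base_change \<phi> C') (map_mat \<phi> F)"
  using homog_base_change[OF R.chain_mapD(1)[OF assms(3)]]
    R.complexD[OF assms(1)] R.complexD[OF assms(2)] R.chain_mapD[OF assms(3)]
  by (simp add: chain_map_def map_mat_mult[symmetric])

lemma base_change_tensor:
  assumes "is_complex R C" "is_complex R C'"
  shows "base_change \<phi> (tensor_cplx C C') = tensor_cplx (base_change \<phi> C) (base_change \<phi> C')"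
  using R.complexD[OF assms(1)] R.complexD[OF assms(2)]
  by (intro cplx_eqI) (auto simp: tensor_cplx_def map_mat_add map_mat_kron map_mat_sign)

end

section \<open>The ground rings\<close>

interpretation triv: graded_ring "trivial_grading :: int \<Rightarrow> 'r::comm_ring_1 set"
  by unfold_locales (auto simp: trivial_grading_def split: if_splits)

lemma h_grading_iff: "p \<in> h_grading q \<longleftrightarrow> (\<forall>n. q \<noteq> - 2 * int n \<longrightarrow> coeff p n = 0)"
  by (auto simp: h_grading_def simp del: bit_not_zero_iff)

lemma laurent_grading_iff:
  "p \<in> laurent_grading q \<longleftrightarrow> (\<forall>n. q \<noteq> - 2 * n \<longrightarrow> Poly_Mapping.lookup p n = 0)"
  by (auto simp: laurent_grading_def simp del: bit_not_zero_iff)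

interpretation hgr: graded_ring h_grading
proof
  fix x y :: "bit poly" and q q' :: int
  show "0 \<in> h_grading q" by (simp add: h_grading_def)
  show "1 \<in> h_grading 0" by (auto simp: h_grading_def)
  show "- x \<in> h_grading q" if "x \<in> h_grading q" using that by (simp add: h_grading_def)
  show "x + y \<in> h_grading q" if "x \<in> h_grading q" "y \<in> h_grading q"
    using that unfolding h_grading_iff by simp
  show "x * y \<in> h_grading (q + q')" if xy: "x \<in> h_grading q" "y \<in> h_grading q'"
    unfolding h_grading_iff coeff_mult
  proof (intro allI impI sum.neutral ballI)
    fix n i assume "q + q' \<noteq> - 2 * int n" "i \<in> {..n}"
    then have "q \<noteq> - 2 * int i \<or> q' \<noteq> - 2 * int (n - i)" by auto
    then show "coeff x i * coeff y (n - i) = 0"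
      using xy unfolding h_grading_iff by (metis mult_zero_left mult_zero_right)
  qed
qed

interpretation laur: graded_ring laurent_grading
proof
  fix x y :: "int \<Rightarrow>\<^sub>0 bit" and q q' :: int
  show "0 \<in> laurent_grading q" by (simp add: laurent_grading_def)
  show "1 \<in> laurent_grading 0" by (auto simp: laurent_grading_def lookup_one when_def split: if_splits)
  show "- x \<in> laurent_grading q" if "x \<in> laurent_grading q" using that by (simp add: laurent_grading_def)
  show "x + y \<in> laurent_grading q" if "x \<in> laurent_grading q" "y \<in> laurent_grading q"
    using that unfolding laurent_grading_iff by (simp add: lookup_add)
  show "x * y \<in> laurent_grading (q + q')" if "x \<in> laurent_grading q" "y \<in> laurent_grading q'"
  proof -
    have "q + q' = - 2 * n" if "Poly_Mapping.lookup (x * y) n \<noteq> 0" for n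
    proof -
      have "n \<in> Poly_Mapping.keys (x * y)" using that by (simp add: in_keys_iff)
      then obtain i j where "i \<in> Poly_Mapping.keys x" "j \<in> Poly_Mapping.keys y" "n = i + j"
        using keys_mult[of x y] by blast
      then show ?thesis using \<open>x \<in> laurent_grading q\<close> \<open>y \<in> laurent_grading q'\<close>
        unfolding laurent_grading_def by (auto simp: in_keys_iff algebra_simps)
    qed
    then show ?thesis by (simp add: laurent_grading_def)
  qed
qed

interpretation mod2: graded_ring_hom trivial_grading trivial_grading mod2
  by unfold_locales (auto simp: mod2_def trivial_grading_def split: if_splits)

interpretation h0: graded_ring_hom h_grading trivial_grading h_to_0
proof unfold_locales
  show "h_to_0 x \<in> trivial_grading q" if "x \<in> h_grading q" for x q
    using that by (auto simp: h_to_0_def trivial_grading_def h_grading_def poly_0_coeff_0)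
qed (simp_all add: h_to_0_def)

lemma lookup_to_laurent: "Poly_Mapping.lookup (to_laurent p) n = (if n \<ge> 0 then coeff p (nat n) else 0)"
proof -
  have "Poly_Mapping.lookup (to_laurent p) n = (\<Sum>k\<le>degree p. if int k = n then coeff p k else 0)"
    unfolding to_laurent_def lookup_sum by (intro sum.cong) (auto simp: lookup_single when_def)
  also have "\<dots> = (if n \<ge> 0 then coeff p (nat n) else 0)"
  proof (cases "n \<ge> 0 \<and> nat n \<le> degree p")
    case True
    then have "(\<Sum>k\<le>degree p. if int k = n then coeff p k else 0) = (\<Sum>k\<le>degree p. if k = nat n then coeff p (nat n) else 0)"
      by (intro sum.cong) auto
    then show ?thesis using True by simp
  next
    case False
    then have "(\<Sum>k\<le>degree p. if int k = n then coeff p k else 0) = 0"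
      by (intro sum.neutral) auto
    moreover have "n \<ge> 0 \<Longrightarrow> coeff p (nat n) = 0" using False by (auto simp: coeff_eq_0)
    ultimately show ?thesis by simp
  qed
  finally show ?thesis .
qed

lemma to_laurent_add: "to_laurent (p + q) = to_laurent p + to_laurent q"
  by (rule poly_mapping_eqI) (simp add: lookup_to_laurent lookup_add)

lemma lookup_single_times:
  fixes f :: "int \<Rightarrow>\<^sub>0 'a::comm_semiring_1"
  shows "Poly_Mapping.lookup (Poly_Mapping.single k c * f) n = c * Poly_Mapping.lookup f (n - k)"
proof -
  have "n = k + q \<longleftrightarrow> q = n - k" for q :: int by auto
  then show ?thesis
    by (simp add: times_poly_mapping.rep_eq prod_fun_def lookup_single when_mult mult_when)
qed

lemma to_laurent_pCons: "to_laurent (pCons a p) = Poly_Mapping.single 0 a + Poly_Mapping.single 1 1 * to_laurent p"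
proof (rule poly_mapping_eqI)
  fix n :: int
  have "Poly_Mapping.lookup (Poly_Mapping.single 1 1 * to_laurent p) n = Poly_Mapping.lookup (to_laurent p) (n - 1)"
    by (simp add: lookup_single_times)
  then show "Poly_Mapping.lookup (to_laurent (pCons a p)) n =
     Poly_Mapping.lookup (Poly_Mapping.single 0 a + Poly_Mapping.single 1 1 * to_laurent p) n"
    by (auto simp: lookup_add lookup_single lookup_to_laurent coeff_pCons when_def nat_diff_distrib split: nat.split)
qed

lemma to_laurent_smult: "to_laurent (smult a p) = Poly_Mapping.single 0 a * to_laurent p"
  by (cases a) (auto simp: to_laurent_def)

lemma to_laurent_mult: "to_laurent (p * q) = to_laurent p * to_laurent q"
proof (induction p)
  case 0
  show ?case by (simp add: to_laurent_def)
next
  case (pCons a p)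
  have "to_laurent (pCons a p * q) = to_laurent (smult a q) + to_laurent (pCons 0 (p * q))"
    by (simp add: to_laurent_add)
  then show ?case
    unfolding to_laurent_smult to_laurent_pCons pCons.IH by (simp add: algebra_simps)
qed

interpretation hinv: graded_ring_hom h_grading laurent_grading to_laurent
proof unfold_locales
  show "to_laurent 0 = 0" by (simp add: to_laurent_def)
  show "to_laurent 1 = 1" by (simp add: to_laurent_def)
qed (auto simp: to_laurent_add to_laurent_mult h_grading_def laurent_grading_def lookup_to_laurent split: if_splits)

section \<open>Complexes that become a line after inverting h\<close>

context graded_ring
begin

lemma is_complex_line: "is_complex R (Cplx [(0, q)] (0\<^sub>m 1 1))"
  by (simp add: is_complex_def homog_map_iff)

lemma chain_map_zero:
  assumes "is_complex R C" "is_complex R C'"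
  shows "chain_map R C C' (0\<^sub>m (rk C') (rk C))"
  using complexD[OF assms(1)] complexD[OF assms(2)] by (simp add: chain_map_def homog_zero)

text \<open>
  The differentials of a line vanish, hence so does every expression \<open>d K + K d\<close>.
\<close>

lemma homotopic_line_eq:
  assumes "chain_homotopic R (Cplx [(0, p)] (0\<^sub>m 1 1)) (Cplx [(0, q)] (0\<^sub>m 1 1)) F G"
    and "dim_row F = 1" "dim_col F = 1" "dim_row G = 1" "dim_col G = 1"
  shows "F = G"
proof -
  have "F - G = 0\<^sub>m 1 1"
    using assms(1) by (rule homotopicE) simp
  then have "(F - G) $$ (i, j) = 0" if "i < 1" "j < 1" for i j using that by simp
  then show ?thesis using assms(2-) by (intro eq_matI) auto
qed

lemma null_homotopic_mult:
  assumes "is_complex R A" "is_complex R B" "is_complex R C" "is_complex R D"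
    and "chain_map R A B F" "chain_map R B C G" "chain_map R C D H"
    and "chain_homotopic R B C G (0\<^sub>m (rk C) (rk B))"
  shows "chain_homotopic R A D (H * G * F) (0\<^sub>m (rk D) (rk A))"
proof -
  note dims = chain_mapD(2,3)[OF assms(5)] chain_mapD(2,3)[OF assms(6)] chain_mapD(2,3)[OF assms(7)]
  have z: "chain_map R B C (0\<^sub>m (rk C) (rk B))" using assms by (intro chain_map_zero)
  have "chain_homotopic R B D (H * G) (H * 0\<^sub>m (rk C) (rk B))"
    using assms z by (intro homotopic_mult_left[of B C D])
  then have "chain_homotopic R A D (H * G * F) (H * 0\<^sub>m (rk C) (rk B) * F)"
    using assms chain_map_mult[OF assms(2,3,4,7,6)] chain_map_mult[OF assms(2,3,4,7) z]
    by (intro homotopic_mult_right[of A B D])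
  then show ?thesis using dims by simp
qed

end

lemma laurent_homogeneous_single:
  assumes "x \<in> laurent_grading r" "x \<noteq> 0"
  obtains n where "r = - 2 * n" "x = Poly_Mapping.single n 1"
proof -
  obtain n where n: "Poly_Mapping.lookup x n \<noteq> 0"
    using assms(2) by (metis lookup_zero poly_mapping_eqI)
  then have r: "r = - 2 * n" using assms(1) by (auto simp: laurent_grading_def)
  have "x = Poly_Mapping.single n 1"
  proof (rule poly_mapping_eqI)
    fix m
    show "Poly_Mapping.lookup x m = Poly_Mapping.lookup (Poly_Mapping.single n 1) m"
      using assms(1) r n by (cases "m = n") (auto simp: laurent_grading_iff lookup_single)
  qed
  with r show thesis by (rule that)
qed

text \<open>
  The ring \<open>F\<^sub>2[h,h\<inverse>]\<close> is a graded field: its nonzero homogeneous elements are the powers of \<open>h\<close>.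
\<close>

lemma laurent_homogeneous_unit:
  assumes "x \<in> laurent_grading r" "x \<noteq> 0"
  obtains y where "y \<in> laurent_grading (- r)" "x * y = 1"
proof -
  obtain n where n: "r = - 2 * n" "x = Poly_Mapping.single n 1"
    using assms by (rule laurent_homogeneous_single)
  have "Poly_Mapping.single (- n) 1 \<in> laurent_grading (- r)"
    using n by (auto simp: laurent_grading_def lookup_single when_def split: if_splits)
  moreover have "x * Poly_Mapping.single (- n) 1 = 1" using n by (simp add: mult_single)
  ultimately show thesis by (rule that)
qed

abbreviation laurent_line :: "int \<Rightarrow> (int \<Rightarrow>\<^sub>0 bit) cplx" where
  "laurent_line q \<equiv> Cplx [(0, q)] (0\<^sub>m 1 1)"

lemma laurent_chain_map_iso:
  assumes "chain_map laurent_grading (laurent_line p) (laurent_line q) N" "N \<noteq> 0\<^sub>m 1 1"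
  obtains N' where "chain_map laurent_grading (laurent_line q) (laurent_line p) N'"
    "N' * N = 1\<^sub>m 1" "N * N' = 1\<^sub>m 1"
proof -
  note D = laur.chain_mapD[OF assms(1)]
  have "N $$ (0, 0) \<noteq> 0"
  proof
    assume "N $$ (0, 0) = 0"
    then have "N = 0\<^sub>m 1 1" using D by (intro eq_matI) auto
    then show False using assms(2) by simp
  qed
  moreover have "N $$ (0, 0) \<in> laurent_grading (p - q)" using D by (auto simp: laur.homog_map_iff)
  ultimately obtain y where y: "y \<in> laurent_grading (- (p - q))" "N $$ (0, 0) * y = 1"
    by (meson laurent_homogeneous_unit)
  define N' where "N' = mat 1 1 (\<lambda>_. y)"
  have "chain_map laurent_grading (laurent_line q) (laurent_line p) N'"
    using y(1) by (simp add: chain_map_def laur.homog_map_iff N'_def)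
  moreover have "N' * N = 1\<^sub>m 1" "N * N' = 1\<^sub>m 1"
    using y(2) D by (auto intro!: eq_matI simp: N'_def scalar_prod_def mult.commute)
  ultimately show thesis by (rule that)
qed

text \<open>
  Transported to the two lines, \<open>\<beta>\<close> becomes a homogeneous one by one matrix, which is invertible as
  soon as it is nonzero.  Conversely, a null-homotopic equivalence would make the identity of a line
  equal to zero.
\<close>

lemma laurent_he_iff:
  assumes A: "is_complex laurent_grading A" "homotopy_equivalent laurent_grading A (laurent_line p)"
    and B: "is_complex laurent_grading B" "homotopy_equivalent laurent_grading B (laurent_line q)"
    and \<beta>: "chain_map laurent_grading A B \<beta>"
  shows "homotopy_equivalence laurent_grading A B \<beta> \<longleftrightarrow>
    \<not> chain_homotopic laurent_grading A B \<beta> (0\<^sub>m (rk B) (rk A))"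
proof -
  note L = laur.is_complex_line
  obtain F F' where F: "chain_map laurent_grading A (laurent_line p) F"
    "chain_map laurent_grading (laurent_line p) A F'"
    "chain_homotopic laurent_grading A A (F' * F) (1\<^sub>m (rk A))"
    "chain_homotopic laurent_grading (laurent_line p) (laurent_line p) (F * F') (1\<^sub>m 1)"
    using A(2) by (auto simp: homotopy_equivalent_def homotopy_equivalence_def)
  obtain G G' where G: "chain_map laurent_grading B (laurent_line q) G"
    "chain_map laurent_grading (laurent_line q) B G'"
    "chain_homotopic laurent_grading B B (G' * G) (1\<^sub>m (rk B))"
    "chain_homotopic laurent_grading (laurent_line q) (laurent_line q) (G * G') (1\<^sub>m 1)"
    using B(2) by (auto simp: homotopy_equivalent_def homotopy_equivalence_def)
  note dims = laur.chain_mapD(2,3)[OF F(1)] laur.chain_mapD(2,3)[OF F(2)]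
    laur.chain_mapD(2,3)[OF G(1)] laur.chain_mapD(2,3)[OF G(2)] laur.chain_mapD(2,3)[OF \<beta>]
  have FF': "F * F' = 1\<^sub>m 1" using laur.homotopic_line_eq[OF F(4)] dims by simp
  show ?thesis
  proof
    assume "homotopy_equivalence laurent_grading A B \<beta>"
    then obtain \<gamma> where \<gamma>: "chain_map laurent_grading B A \<gamma>"
      "chain_homotopic laurent_grading A A (\<gamma> * \<beta>) (1\<^sub>m (rk A))"
      by (auto simp: homotopy_equivalence_def)
    note dims = dims laur.chain_mapD(2,3)[OF \<gamma>(1)]
    show "\<not> chain_homotopic laurent_grading A B \<beta> (0\<^sub>m (rk B) (rk A))"
    proof
      assume null: "chain_homotopic laurent_grading A B \<beta> (0\<^sub>m (rk B) (rk A))"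
      have "chain_homotopic laurent_grading (laurent_line p) (laurent_line p)
          ((F * \<gamma>) * \<beta> * F') (0\<^sub>m (rk (laurent_line p)) (rk (laurent_line p)))"
        by (rule laur.null_homotopic_mult[of _ A B])
          (use A B L F \<gamma> \<beta> null in \<open>auto intro: laur.chain_map_mult[of B A]\<close>)
      then have 1: "(F * \<gamma>) * \<beta> * F' = 0\<^sub>m 1 1"
        by (intro laur.homotopic_line_eq[of p p]) (use dims in auto)
      have "chain_homotopic laurent_grading (laurent_line p) A ((\<gamma> * \<beta>) * F') (1\<^sub>m (rk A) * F')"
        by (rule laur.homotopic_mult_right[of _ A A])
          (use A B L F \<gamma> \<beta> in \<open>auto intro: laur.chain_map_mult[of A B] laur.chain_map_one\<close>)
      then have "chain_homotopic laurent_grading (laurent_line p) (laurent_line p)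
           (F * ((\<gamma> * \<beta>) * F')) (F * (1\<^sub>m (rk A) * F'))"
        by (rule laur.homotopic_mult_left[of _ A, rotated -1])
          (use A B L F \<gamma> \<beta> dims in \<open>auto intro!: laur.chain_map_mult[of _ A A] laur.chain_map_mult[of A B] laur.chain_map_one\<close>)
      then have 2: "F * ((\<gamma> * \<beta>) * F') = F * (1\<^sub>m (rk A) * F')"
        by (intro laur.homotopic_line_eq[of p p]) (use dims in auto)
      have "1\<^sub>m 1 = (0\<^sub>m 1 1 :: (int \<Rightarrow>\<^sub>0 bit) mat)"
        using 1 2 dims FF' by (simp add: mat_assoc)
      then have "(1\<^sub>m 1 :: (int \<Rightarrow>\<^sub>0 bit) mat) $$ (0, 0) = 0" by simp
      then show False by simp
    qed
  next
    assume nn: "\<not> chain_homotopic laurent_grading A B \<beta> (0\<^sub>m (rk B) (rk A))"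
    \<comment> \<open>the map of lines corresponding to \<open>\<beta>\<close>\<close>
    define N where "N = G * (\<beta> * F')"
    have \<beta>F': "chain_map laurent_grading (laurent_line p) B (\<beta> * F')"
      using A B L F \<beta> by (intro laur.chain_map_mult[of _ A])
    have N: "chain_map laurent_grading (laurent_line p) (laurent_line q) N"
      unfolding N_def by (rule laur.chain_map_mult[of _ B]) (use A B L G \<beta>F' in auto)
    have FA: "homotopy_equivalence laurent_grading A (laurent_line p) F"
      using F by (auto simp: homotopy_equivalence_def)
    have GB: "homotopy_equivalence laurent_grading (laurent_line q) B G'"
      using G by (auto simp: homotopy_equivalence_def)
    have NF: "chain_map laurent_grading A (laurent_line q) (N * F)"
      by (rule laur.chain_map_mult[of _ "laurent_line p"]) (use A L F N in auto)
    have GNF: "chain_map laurent_grading A B (G' * (N * F))"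
      by (rule laur.chain_map_mult[of _ "laurent_line q"]) (use A B L G NF in auto)
    have hom: "chain_homotopic laurent_grading A B (G' * (N * F)) \<beta>"
    proof -
      note oA = laur.chain_map_one[OF A(1)] and oB = laur.chain_map_one[OF B(1)]
      note FF = laur.chain_map_mult[OF A(1) L A(1) F(2) F(1)] and GG = laur.chain_map_mult[OF B(1) L B(1) G(2) G(1)]
      have "chain_homotopic laurent_grading A B ((G' * G) * (\<beta> * (F' * F))) (1\<^sub>m (rk B) * (\<beta> * 1\<^sub>m (rk A)))"
        by (rule laur.homotopic_mult[OF A(1) B(1) B(1) laur.chain_map_mult[OF A(1) A(1) B(1) \<beta> FF]
              laur.chain_map_mult[OF A(1) A(1) B(1) \<beta> oA] GG oB
              laur.homotopic_mult_left[OF A(1) A(1) B(1) FF oA \<beta> F(3)] G(3)])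
      then show ?thesis using dims by (simp add: mat_assoc N_def)
    qed
    have "N \<noteq> 0\<^sub>m 1 1"
    proof
      assume "N = 0\<^sub>m 1 1"
      then have "chain_homotopic laurent_grading A B (0\<^sub>m (rk B) (rk A)) \<beta>"
        using hom dims by simp
      then have "chain_homotopic laurent_grading A B \<beta> (0\<^sub>m (rk B) (rk A))"
        by (rule laur.homotopic_sym[OF A(1) B(1) laur.chain_map_zero[OF A(1) B(1)] \<beta>])
      with nn show False by simp
    qed
    then obtain N' where N': "chain_map laurent_grading (laurent_line q) (laurent_line p) N'"
      "N' * N = 1\<^sub>m 1" "N * N' = 1\<^sub>m 1"
      using N laurent_chain_map_iso by blast
    have "homotopy_equivalence laurent_grading (laurent_line p) (laurent_line q) N"
      using L N N' by (intro laur.he_iso[where G = N']) auto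
    then have he: "homotopy_equivalence laurent_grading A B (G' * (N * F))"
      using A B L FA GB by (intro laur.he_comp[of _ "laurent_line q"] laur.he_comp[of _ "laurent_line p"])
    then obtain \<gamma> where \<gamma>: "chain_map laurent_grading B A \<gamma>"
      "chain_homotopic laurent_grading A A (\<gamma> * (G' * (N * F))) (1\<^sub>m (rk A))"
      "chain_homotopic laurent_grading B B ((G' * (N * F)) * \<gamma>) (1\<^sub>m (rk B))"
      by (auto simp: homotopy_equivalence_def)
    have hom': "chain_homotopic laurent_grading A B \<beta> (G' * (N * F))"
      by (rule laur.homotopic_sym[OF A(1) B(1) GNF \<beta> hom])
    have "chain_homotopic laurent_grading A A (\<gamma> * \<beta>) (1\<^sub>m (rk A))"
    proof (rule laur.homotopic_trans)
      show "chain_homotopic laurent_grading A A (\<gamma> * \<beta>) (\<gamma> * (G' * (N * F)))"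
        using A B hom' GNF \<beta> \<gamma> by (intro laur.homotopic_mult_left[of A B])
      show "chain_homotopic laurent_grading A A (\<gamma> * (G' * (N * F))) (1\<^sub>m (rk A))" by fact
    qed (use A B GNF \<beta> \<gamma> in \<open>auto intro: laur.chain_map_one laur.chain_map_mult[of A B]\<close>)
    moreover have "chain_homotopic laurent_grading B B (\<beta> * \<gamma>) (1\<^sub>m (rk B))"
    proof (rule laur.homotopic_trans)
      show "chain_homotopic laurent_grading B B (\<beta> * \<gamma>) ((G' * (N * F)) * \<gamma>)"
        using A B hom' GNF \<beta> \<gamma> by (intro laur.homotopic_mult_right[of B A])
      show "chain_homotopic laurent_grading B B ((G' * (N * F)) * \<gamma>) (1\<^sub>m (rk B))" by fact
    qed (use A B GNF \<beta> \<gamma> in \<open>auto intro: laur.chain_map_one laur.chain_map_mult[of B A]\<close>)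
    ultimately show "homotopy_equivalence laurent_grading A B \<beta>"
      using \<beta> \<gamma> by (auto simp: homotopy_equivalence_def)
  qed
qed

section \<open>The preorder of local maps\<close>

lemma leo_triplesD:
  assumes "X \<in> leo_triples"
  shows "is_complex trivial_grading (zpart X)" "is_complex h_grading (hpart X)"
    "is_complex trivial_grading (cplx_mod2 (zpart X))" "is_complex trivial_grading (cplx_h0 (hpart X))"
    "is_complex laurent_grading (cplx_hinv (hpart X))"
    "homotopy_equivalence trivial_grading (cplx_mod2 (zpart X)) (cplx_h0 (hpart X)) (cmp X)"
    "chain_map trivial_grading (cplx_mod2 (zpart X)) (cplx_h0 (hpart X)) (cmp X)"
    "\<exists>q. even q \<and> homotopy_equivalent laurent_grading (cplx_hinv (hpart X)) (laurent_line q)"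
  using assms by (auto simp: leo_triples_def homotopy_equivalence_def intro: mod2.is_complex_base_change
    h0.is_complex_base_change hinv.is_complex_base_change)

text \<open>
  The localisation condition turns into the nonvanishing of a class, which can be tested on a
  single element and is compatible with passing to homomorphism complexes.
\<close>

lemma local_map_iff:
  assumes "X \<in> leo_triples" "Y \<in> leo_triples"
  shows "local_map X Y \<alpha> \<beta> \<longleftrightarrow>
     chain_map trivial_grading (zpart X) (zpart Y) \<alpha> \<and>
     chain_map h_grading (hpart X) (hpart Y) \<beta> \<and>
     \<not> chain_homotopic laurent_grading (cplx_hinv (hpart X)) (cplx_hinv (hpart Y))
       (map_mat to_laurent \<beta>) (0\<^sub>m (rk (hpart Y)) (rk (hpart X))) \<and>
     chain_homotopic trivial_grading (cplx_mod2 (zpart X)) (cplx_h0 (hpart Y))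
       (cmp Y * map_mat mod2 \<alpha>) (map_mat h_to_0 \<beta> * cmp X)"
proof -
  note X = leo_triplesD[OF assms(1)] and Y = leo_triplesD[OF assms(2)]
  obtain p where p: "homotopy_equivalent laurent_grading (cplx_hinv (hpart X)) (laurent_line p)"
    using X(8) by blast
  obtain q where q: "homotopy_equivalent laurent_grading (cplx_hinv (hpart Y)) (laurent_line q)"
    using Y(8) by blast
  show ?thesis unfolding local_map_def
    using laurent_he_iff[OF X(5) p Y(5) q] hinv.chain_map_base_change[OF X(2) Y(2)]
    by (metis rk_base_change)
qed

lemma has_local_map_refl:
  assumes "X \<in> leo_triples"
  shows "has_local_map X X"
proof -
  note X = leo_triplesD[OF assms]
  note D = triv.chain_mapD(2,3)[OF X(7)]
  have "local_map X X (1\<^sub>m (rk (zpart X))) (1\<^sub>m (rk (hpart X)))"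
    unfolding local_map_def using X D laur.he_one[OF X(5)]
    by (auto intro: triv.chain_map_one hgr.chain_map_one triv.homotopic_refl)
  then show ?thesis by (auto simp: has_local_map_def)
qed

text \<open>
  The comparison homotopies are pasted along
  \<open>f'' \<alpha>' \<alpha> \<simeq> \<beta>' f' \<alpha> \<simeq> \<beta>' \<beta> f\<close>.
\<close>

lemma has_local_map_trans:
  assumes "X \<in> leo_triples" "Y \<in> leo_triples" "Z \<in> leo_triples"
    and "has_local_map X Y" "has_local_map Y Z"
  shows "has_local_map X Z"
proof -
  note X = leo_triplesD[OF assms(1)] and Y = leo_triplesD[OF assms(2)] and Z = leo_triplesD[OF assms(3)]
  obtain \<alpha> \<beta> where 1: "chain_map trivial_grading (zpart X) (zpart Y) \<alpha>"
    "chain_map h_grading (hpart X) (hpart Y) \<beta>"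
    "homotopy_equivalence laurent_grading (cplx_hinv (hpart X)) (cplx_hinv (hpart Y)) (map_mat to_laurent \<beta>)"
    "chain_homotopic trivial_grading (cplx_mod2 (zpart X)) (cplx_h0 (hpart Y))
       (cmp Y * map_mat mod2 \<alpha>) (map_mat h_to_0 \<beta> * cmp X)"
    using assms(4) unfolding has_local_map_def local_map_def by blast
  obtain \<alpha>' \<beta>' where 2: "chain_map trivial_grading (zpart Y) (zpart Z) \<alpha>'"
    "chain_map h_grading (hpart Y) (hpart Z) \<beta>'"
    "homotopy_equivalence laurent_grading (cplx_hinv (hpart Y)) (cplx_hinv (hpart Z)) (map_mat to_laurent \<beta>')"
    "chain_homotopic trivial_grading (cplx_mod2 (zpart Y)) (cplx_h0 (hpart Z))
       (cmp Z * map_mat mod2 \<alpha>') (map_mat h_to_0 \<beta>' * cmp Y)"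
    using assms(5) unfolding has_local_map_def local_map_def by blast
  let ?CX = "cplx_mod2 (zpart X)" and ?CY = "cplx_mod2 (zpart Y)" and ?CZ = "cplx_mod2 (zpart Z)"
  let ?DX = "cplx_h0 (hpart X)" and ?DY = "cplx_h0 (hpart Y)" and ?DZ = "cplx_h0 (hpart Z)"
  let ?a = "map_mat mod2 \<alpha>" and ?a' = "map_mat mod2 \<alpha>'" and ?b = "map_mat h_to_0 \<beta>" and ?b' = "map_mat h_to_0 \<beta>'"
  note a = mod2.chain_map_base_change[OF X(1) Y(1) 1(1)] mod2.chain_map_base_change[OF Y(1) Z(1) 2(1)]
  note b = h0.chain_map_base_change[OF X(2) Y(2) 1(2)] h0.chain_map_base_change[OF Y(2) Z(2) 2(2)]
  note dims = triv.chain_mapD(2,3)[OF 1(1)] triv.chain_mapD(2,3)[OF 2(1)]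
    hgr.chain_mapD(2,3)[OF 1(2)] hgr.chain_mapD(2,3)[OF 2(2)]
    triv.chain_mapD(2,3)[OF X(7)] triv.chain_mapD(2,3)[OF Y(7)] triv.chain_mapD(2,3)[OF Z(7)]
  have c1: "chain_map trivial_grading ?CY ?DZ (cmp Z * ?a')" "chain_map trivial_grading ?CY ?DZ (?b' * cmp Y)"
    using X Y Z a b by (auto intro: triv.chain_map_mult[of _ ?CZ] triv.chain_map_mult[of _ ?DY])
  have c2: "chain_map trivial_grading ?CX ?DY (cmp Y * ?a)" "chain_map trivial_grading ?CX ?DY (?b * cmp X)"
    using X Y Z a b by (auto intro: triv.chain_map_mult[of _ ?CY] triv.chain_map_mult[of _ ?DX])
  have "chain_homotopic trivial_grading ?CX ?DZ ((cmp Z * ?a') * ?a) (?b' * (?b * cmp X))"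
  proof (rule triv.homotopic_trans[OF X(3) Z(4)])
    show "chain_homotopic trivial_grading ?CX ?DZ ((cmp Z * ?a') * ?a) ((?b' * cmp Y) * ?a)"
      using X Y Z a c1 2(4) by (intro triv.homotopic_mult_right[of _ ?CY])
    have "chain_homotopic trivial_grading ?CX ?DZ (?b' * (cmp Y * ?a)) (?b' * (?b * cmp X))"
      using X Y Z b c2 1(4) by (intro triv.homotopic_mult_left[of _ ?DY])
    then show "chain_homotopic trivial_grading ?CX ?DZ ((?b' * cmp Y) * ?a) (?b' * (?b * cmp X))"
      using dims by (simp add: mat_assoc)
    show "chain_map trivial_grading ?CX ?DZ (cmp Z * ?a' * ?a)"
      "chain_map trivial_grading ?CX ?DZ (?b' * cmp Y * ?a)"
      "chain_map trivial_grading ?CX ?DZ (?b' * (?b * cmp X))"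
      using X Y Z a b c1 c2 by (auto intro: triv.chain_map_mult[of _ ?CY] triv.chain_map_mult[of _ ?DY])
  qed
  then have "local_map X Z (\<alpha>' * \<alpha>) (\<beta>' * \<beta>)"
    unfolding local_map_def
    using X Y Z 1 2 dims
    by (auto simp: mod2.map_mat_mult h0.map_mat_mult hinv.map_mat_mult mat_assoc
       intro: triv.chain_map_mult[of _ "zpart Y"] hgr.chain_map_mult[of _ "hpart Y"] laur.he_comp[of _ "cplx_hinv (hpart Y)"])
  then show ?thesis by (auto simp: has_local_map_def)
qed

lemma tensor_leo_sel [simp]:
  "zpart (tensor_leo X Y) = tensor_cplx (zpart X) (zpart Y)"
  "hpart (tensor_leo X Y) = tensor_cplx (hpart X) (hpart Y)"
  "cmp (tensor_leo X Y) = kron (cmp X) (cmp Y)"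
  by (simp_all add: tensor_leo_def)

lemma tensor_leo_triples:
  assumes "X \<in> leo_triples" "Y \<in> leo_triples"
  shows "tensor_leo X Y \<in> leo_triples"
proof -
  note X = leo_triplesD[OF assms(1)] and Y = leo_triplesD[OF assms(2)]
  obtain p F where p: "even p" "homotopy_equivalence laurent_grading (cplx_hinv (hpart X)) (laurent_line p) F"
    using X(8) by (auto simp: homotopy_equivalent_def)
  obtain q G where q: "even q" "homotopy_equivalence laurent_grading (cplx_hinv (hpart Y)) (laurent_line q) G"
    using Y(8) by (auto simp: homotopy_equivalent_def)
  have "homotopy_equivalent laurent_grading (cplx_hinv (tensor_cplx (hpart X) (hpart Y))) (laurent_line (p + q))"
    unfolding homotopy_equivalent_def hinv.base_change_tensor[OF X(2) Y(2)] tensor_line[symmetric]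
    using X Y p q by (auto intro!: exI[of _ "kron F G"] laur.he_kron laur.is_complex_line[unfolded One_nat_def])
  moreover have "homotopy_equivalence trivial_grading (cplx_mod2 (tensor_cplx (zpart X) (zpart Y)))
      (cplx_h0 (tensor_cplx (hpart X) (hpart Y))) (kron (cmp X) (cmp Y))"
    unfolding mod2.base_change_tensor[OF X(1) Y(1)] h0.base_change_tensor[OF X(2) Y(2)]
    using X Y by (intro triv.he_kron)
  moreover have "even (p + q)" using p q by simp
  ultimately show ?thesis
    unfolding leo_triples_def mem_Collect_eq tensor_leo_sel
    using triv.is_complex_tensor[OF X(1) Y(1)] hgr.is_complex_tensor[OF X(2) Y(2)] by blast
qed

lemma tensor_local_map:
  assumes "X \<in> leo_triples" "X' \<in> leo_triples" "Y \<in> leo_triples" "Y' \<in> leo_triples"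
    and "has_local_map X X'" "has_local_map Y Y'"
  shows "has_local_map (tensor_leo X Y) (tensor_leo X' Y')"
proof -
  note X = leo_triplesD[OF assms(1)] and X' = leo_triplesD[OF assms(2)]
  note Y = leo_triplesD[OF assms(3)] and Y' = leo_triplesD[OF assms(4)]
  obtain \<alpha> \<beta> where 1: "chain_map trivial_grading (zpart X) (zpart X') \<alpha>"
    "chain_map h_grading (hpart X) (hpart X') \<beta>"
    "homotopy_equivalence laurent_grading (cplx_hinv (hpart X)) (cplx_hinv (hpart X')) (map_mat to_laurent \<beta>)"
    "chain_homotopic trivial_grading (cplx_mod2 (zpart X)) (cplx_h0 (hpart X'))
       (cmp X' * map_mat mod2 \<alpha>) (map_mat h_to_0 \<beta> * cmp X)"
    using assms(5) unfolding has_local_map_def local_map_def by blast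
  obtain \<alpha>' \<beta>' where 2: "chain_map trivial_grading (zpart Y) (zpart Y') \<alpha>'"
    "chain_map h_grading (hpart Y) (hpart Y') \<beta>'"
    "homotopy_equivalence laurent_grading (cplx_hinv (hpart Y)) (cplx_hinv (hpart Y')) (map_mat to_laurent \<beta>')"
    "chain_homotopic trivial_grading (cplx_mod2 (zpart Y)) (cplx_h0 (hpart Y'))
       (cmp Y' * map_mat mod2 \<alpha>') (map_mat h_to_0 \<beta>' * cmp Y)"
    using assms(6) unfolding has_local_map_def local_map_def by blast
  note a = mod2.chain_map_base_change[OF X(1) X'(1) 1(1)] mod2.chain_map_base_change[OF Y(1) Y'(1) 2(1)]
  note b = h0.chain_map_base_change[OF X(2) X'(2) 1(2)] h0.chain_map_base_change[OF Y(2) Y'(2) 2(2)]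
  note dims = triv.chain_mapD(2,3)[OF 1(1)] triv.chain_mapD(2,3)[OF 2(1)]
    hgr.chain_mapD(2,3)[OF 1(2)] hgr.chain_mapD(2,3)[OF 2(2)]
    triv.chain_mapD(2,3)[OF X(7)] triv.chain_mapD(2,3)[OF X'(7)] triv.chain_mapD(2,3)[OF Y(7)] triv.chain_mapD(2,3)[OF Y'(7)]
  have "chain_homotopic trivial_grading (tensor_cplx (cplx_mod2 (zpart X)) (cplx_mod2 (zpart Y)))
     (tensor_cplx (cplx_h0 (hpart X')) (cplx_h0 (hpart Y')))
     (kron (cmp X' * map_mat mod2 \<alpha>) (cmp Y' * map_mat mod2 \<alpha>'))
     (kron (map_mat h_to_0 \<beta> * cmp X) (map_mat h_to_0 \<beta>' * cmp Y))"
    using X X' Y Y' 1(4) 2(4)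
      triv.chain_map_mult[OF X(3) X'(3) X'(4) X'(7) a(1)] triv.chain_map_mult[OF X(3) X(4) X'(4) b(1) X(7)]
      triv.chain_map_mult[OF Y(3) Y'(3) Y'(4) Y'(7) a(2)] triv.chain_map_mult[OF Y(3) Y(4) Y'(4) b(2) Y(7)]
    by (intro triv.homotopic_kron)
  then have "local_map (tensor_leo X Y) (tensor_leo X' Y') (kron \<alpha> \<alpha>') (kron \<beta> \<beta>')"
    unfolding local_map_def tensor_leo_sel mod2.base_change_tensor[OF X(1) Y(1)] h0.base_change_tensor[OF X'(2) Y'(2)]
      hinv.base_change_tensor[OF X(2) Y(2)] hinv.base_change_tensor[OF X'(2) Y'(2)]
    using dims 1 2 X X' Y Y'
    by (auto simp: kron_mult mod2.map_mat_kron h0.map_mat_kron hinv.map_mat_kron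
      intro!: triv.chain_map_kron hgr.chain_map_kron laur.he_kron)
  then show ?thesis by (auto simp: has_local_map_def)
qed

lemma tensor_leo_assoc:
  assumes "X \<in> leo_triples" "Y \<in> leo_triples" "Z \<in> leo_triples"
  shows "tensor_leo (tensor_leo X Y) Z = tensor_leo X (tensor_leo Y Z)"
  using assms[THEN leo_triplesD(1)] assms[THEN leo_triplesD(2)]
  by (simp add: tensor_leo_def tensor_assoc kron_assoc triv.complexD hgr.complexD)

lemma base_change_line: "f 0 = 0 \<Longrightarrow> base_change f (Cplx [(0, q)] (0\<^sub>m 1 1)) = Cplx [(0, q)] (0\<^sub>m 1 1)"
  by (rule cplx_eqI) auto

lemma unit_leo_triples: "unit_leo \<in> leo_triples"
proof -
  have "homotopy_equivalence trivial_grading (Cplx [(0, 0)] (0\<^sub>m 1 1)) (Cplx [(0, 0)] (0\<^sub>m 1 1)) (1\<^sub>m 1 :: bit mat)"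
    using triv.he_one[OF triv.is_complex_line[of 0]] by simp
  moreover have "homotopy_equivalent laurent_grading (laurent_line 0) (laurent_line 0)"
    using laur.he_one[OF laur.is_complex_line[of 0]] by (auto simp: homotopy_equivalent_def)
  ultimately show ?thesis
    unfolding leo_triples_def unit_leo_def
    by (auto simp: base_change_line[unfolded One_nat_def] triv.is_complex_line[unfolded One_nat_def]
       hgr.is_complex_line[unfolded One_nat_def] intro!: exI[of _ 0])
qed

lemma tensor_leo_unit:
  assumes "X \<in> leo_triples"
  shows "tensor_leo unit_leo X = X" "tensor_leo X unit_leo = X"
  using leo_triplesD(1,2)[OF assms]
  by (simp_all add: tensor_leo_def unit_leo_def tensor_unit_left[simplified] tensor_unit_right[simplified] triv.complexD hgr.complexD)


section \<open>Commutativity\<close>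

lemma sum_single_pair:
  fixes f :: "nat \<Rightarrow> nat \<Rightarrow> 'a::comm_monoid_add"
  assumes "i < m" "k < n" "\<And>j l. j < m \<Longrightarrow> l < n \<Longrightarrow> (j, l) \<noteq> (i, k) \<Longrightarrow> f j l = 0"
  shows "(\<Sum>j<m. \<Sum>l<n. f j l) = f i k"
proof -
  have "(\<Sum>j<m. \<Sum>l<n. f j l) = (\<Sum>(j, l)\<in>{..<m} \<times> {..<n}. f j l)"
    by (simp add: sum.cartesian_product)
  also have "\<dots> = (\<Sum>(j, l)\<in>{(i, k)}. f j l)"
    using assms by (intro sum.mono_neutral_right) auto
  finally show ?thesis by simp
qed

text \<open>
  The Koszul symmetry \<open>x \<otimes> y \<mapsto> (-1)^(i k) y \<otimes> x\<close> for \<open>x\<close> of degree \<open>i\<close> and \<open>y\<close> of degree \<open>k\<close>.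
\<close>

definition swap_mat :: "'r::comm_ring_1 cplx \<Rightarrow> 'r cplx \<Rightarrow> 'r mat" where
  "swap_mat C C' = mat (rk C' * rk C) (rk C * rk C')
     (\<lambda>(x, y). if x div rk C = y mod rk C' \<and> x mod rk C = y div rk C'
        then (if odd (hdeg C (x mod rk C)) \<and> odd (hdeg C' (x div rk C)) then - 1 else 1) else 0)"

lemma dim_swap_mat [simp]:
  "dim_row (swap_mat C C') = rk C' * rk C" "dim_col (swap_mat C C') = rk C * rk C'"
  by (simp_all add: swap_mat_def)

abbreviation swap_sign :: "'r::comm_ring_1 cplx \<Rightarrow> 'r cplx \<Rightarrow> nat \<Rightarrow> nat \<Rightarrow> 'r" where
  "swap_sign C C' i k \<equiv> (if odd (hdeg C i) \<and> odd (hdeg C' k) then - 1 else 1)"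

lemma swap_mat_index:
  assumes "i < rk C" "k < rk C'" "j < rk C" "l < rk C'"
  shows "swap_mat C C' $$ (k * rk C + i, j * rk C' + l) =
    (if i = j \<and> k = l then swap_sign C C' i k else 0)"
proof -
  have "rk C > 0" "rk C' > 0" using assms by linarith+
  then have "(k * rk C + i) div rk C = k" "(k * rk C + i) mod rk C = i"
     "(j * rk C' + l) div rk C' = j" "(j * rk C' + l) mod rk C' = l"
    using assms by simp_all
  then show ?thesis using assms by (auto simp: swap_mat_def pair_index_less)
qed

lemma swap_mat_mult_left:
  assumes "dim_row M = rk C * rk C'" "i < rk C" "k < rk C'" "y < dim_col M"
  shows "(swap_mat C C' * M) $$ (k * rk C + i, y) = swap_sign C C' i k * M $$ (i * rk C' + k, y)"
proof -
  have "(swap_mat C C' * M) $$ (k * rk C + i, y) =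
      (\<Sum>j<rk C. \<Sum>l<rk C'. swap_mat C C' $$ (k * rk C + i, j * rk C' + l) * M $$ (j * rk C' + l, y))"
    using assms by (subst mat_mult_index) (simp_all add: sum_pair_index pair_index_less)
  also have "\<dots> = swap_sign C C' i k * M $$ (i * rk C' + k, y)"
    using assms(2,3) by (subst sum_single_pair[of i _ k]) (auto simp: swap_mat_index)
  finally show ?thesis .
qed

lemma swap_mat_mult_right:
  assumes "dim_col M = rk C' * rk C" "i < rk C" "k < rk C'" "x < dim_row M"
  shows "(M * swap_mat C C') $$ (x, i * rk C' + k) = M $$ (x, k * rk C + i) * swap_sign C C' i k"
proof -
  have "(M * swap_mat C C') $$ (x, i * rk C' + k) =
      (\<Sum>l<rk C'. \<Sum>j<rk C. M $$ (x, l * rk C + j) * swap_mat C C' $$ (l * rk C + j, i * rk C' + k))"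
    using assms by (subst mat_mult_index) (simp_all add: sum_pair_index pair_index_less)
  also have "\<dots> = M $$ (x, k * rk C + i) * swap_sign C C' i k"
    using assms(2,3) by (subst sum_single_pair[of k _ i]) (auto simp: swap_mat_index)
  finally show ?thesis .
qed

lemma swap_mat_inverse: "swap_mat C' C * swap_mat C C' = 1\<^sub>m (rk C * rk C')"
  by (rule eq_mat_pairI[of _ "rk C" "rk C'" "rk C" "rk C'"])
     (auto simp: swap_mat_mult_left swap_mat_index pair_index_less pair_index_eq_iff simp del: index_mult_mat(1))

context graded_ring
begin

lemma homog_swap: "homog_map R 0 0 (tensor_cplx C C') (tensor_cplx C' C) (swap_mat C C')"
  unfolding homog_map_iff
proof (intro conjI allI impI)
  fix x y assume x: "x < rk (tensor_cplx C' C)" and y: "y < rk (tensor_cplx C C')"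
  obtain k i where x: "x = k * rk C + i" "k < rk C'" "i < rk C" using x by (auto elim: pair_indexE)
  obtain j l where y: "y = j * rk C' + l" "j < rk C" "l < rk C'" using y by (auto elim: pair_indexE)
  show "hdeg (tensor_cplx C' C) x = hdeg (tensor_cplx C C') y + 0" if "swap_mat C C' $$ (x, y) \<noteq> 0"
    using that x y by (auto simp: swap_mat_index tensor_gens split: if_splits)
  show "swap_mat C C' $$ (x, y) \<in> R (qdeg (tensor_cplx C C') y + 0 - qdeg (tensor_cplx C' C) x)"
    using x y by (auto simp: swap_mat_index tensor_gens one_mem uminus_mem)
qed auto

lemma chain_map_swap:
  assumes "is_complex R C" "is_complex R C'"
  shows "chain_map R (tensor_cplx C C') (tensor_cplx C' C) (swap_mat C C')"
  unfolding chain_map_def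
proof
  note D = complexD[OF assms(1)] complexD[OF assms(2)]
  show "swap_mat C C' * diff (tensor_cplx C C') = diff (tensor_cplx C' C) * swap_mat C C'"
  proof (rule eq_mat_pairI)
    fix k i j l assume *: "k < rk C'" "i < rk C" "j < rk C" "l < rk C'"
    have dC: "diff C $$ (i, j) = 0 \<or> hdeg C i = hdeg C j + 1"
      using D(1) * by (auto simp: homog_map_iff)
    have dC': "diff C' $$ (k, l) = 0 \<or> hdeg C' k = hdeg C' l + 1"
      using D(5) * by (auto simp: homog_map_iff)
    have "(swap_mat C C' * diff (tensor_cplx C C')) $$ (k * rk C + i, j * rk C' + l)
       = swap_sign C C' i k * (diff C $$ (i, j) * (if k = l then 1 else 0) + sign_mat C $$ (i, j) * diff C' $$ (k, l))"
      using * D by (subst swap_mat_mult_left) (auto simp: diff_tensor pair_index_less kron_index)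
    moreover have "(diff (tensor_cplx C' C) * swap_mat C C') $$ (k * rk C + i, j * rk C' + l)
       = (diff C' $$ (k, l) * (if i = j then 1 else 0) + sign_mat C' $$ (k, l) * diff C $$ (i, j)) * swap_sign C C' j l"
      using * D by (subst swap_mat_mult_right) (auto simp: diff_tensor pair_index_less kron_index)
    ultimately show "(swap_mat C C' * diff (tensor_cplx C C')) $$ (k * rk C + i, j * rk C' + l)
       = (diff (tensor_cplx C' C) * swap_mat C C') $$ (k * rk C + i, j * rk C' + l)"
      using * dC dC' by (auto simp: sign_mat_index)
  qed (use D in \<open>auto simp: diff_tensor\<close>)
qed (rule homog_swap)

end

lemma (in graded_ring_hom) map_mat_swap:
  "map_mat \<phi> (swap_mat C C') = swap_mat (base_change \<phi> C) (base_change \<phi> C')"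
  by (rule eq_matI) (auto simp: swap_mat_def hom_uminus)

text \<open>
  In characteristic two the Koszul signs disappear, so the symmetry commutes with arbitrary
  matrices and the two comparison maps agree strictly.
\<close>

lemma swap_mat_natural_bit:
  fixes A B :: "bit mat"
  assumes "dim_row A = rk D" "dim_col A = rk C" "dim_row B = rk D'" "dim_col B = rk C'"
  shows "kron B A * swap_mat C C' = swap_mat D D' * kron A B"
proof (rule eq_mat_pairI)
  fix k i j l assume *: "k < rk D'" "i < rk D" "j < rk C" "l < rk C'"
  show "(kron B A * swap_mat C C') $$ (k * rk D + i, j * rk C' + l) = (swap_mat D D' * kron A B) $$ (k * rk D + i, j * rk C' + l)"
    using * assms
    by (subst swap_mat_mult_left, simp, simp, simp, simp add: pair_index_less,
        subst swap_mat_mult_right, simp, simp, simp, simp add: pair_index_less)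
       (simp add: kron_index)
qed (use assms in auto)

lemma tensor_leo_commute:
  assumes "X \<in> leo_triples" "Y \<in> leo_triples"
  shows "has_local_map (tensor_leo X Y) (tensor_leo Y X)"
proof -
  note X = leo_triplesD[OF assms(1)] and Y = leo_triplesD[OF assms(2)]
  note dims = triv.chain_mapD(2,3)[OF X(7)] triv.chain_mapD(2,3)[OF Y(7)]
  have "homotopy_equivalence laurent_grading (tensor_cplx (cplx_hinv (hpart X)) (cplx_hinv (hpart Y)))
     (tensor_cplx (cplx_hinv (hpart Y)) (cplx_hinv (hpart X))) (swap_mat (cplx_hinv (hpart X)) (cplx_hinv (hpart Y)))"
    using X Y by (intro laur.he_iso[OF _ _ laur.chain_map_swap laur.chain_map_swap])
      (auto simp: swap_mat_inverse intro: laur.is_complex_tensor)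
  then have "local_map (tensor_leo X Y) (tensor_leo Y X) (swap_mat (zpart X) (zpart Y)) (swap_mat (hpart X) (hpart Y))"
    unfolding local_map_def tensor_leo_sel mod2.base_change_tensor[OF X(1) Y(1)] h0.base_change_tensor[OF Y(2) X(2)]
      hinv.base_change_tensor[OF X(2) Y(2)] hinv.base_change_tensor[OF Y(2) X(2)]
      mod2.map_mat_swap h0.map_mat_swap hinv.map_mat_swap
    using X Y dims
    by (auto simp: swap_mat_natural_bit[where D = "cplx_h0 (hpart X)" and D' = "cplx_h0 (hpart Y)"]
      intro!: triv.chain_map_swap hgr.chain_map_swap triv.homotopic_refl triv.is_complex_tensor)
  then show ?thesis by (auto simp: has_local_map_def)
qed

section \<open>Homomorphism complexes and duals\<close>

lemma all_pair_index_iff: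
  fixes m n :: nat
  shows "(\<forall>x<m * n. P x) \<longleftrightarrow> (\<forall>i<m. \<forall>k<n. P (i * n + k))"
proof
  assume P: "\<forall>i<m. \<forall>k<n. P (i * n + k)"
  show "\<forall>x<m * n. P x"
  proof (intro allI impI)
    fix x assume "x < m * n"
    then show "P x" using P by (metis pair_indexE)
  qed
qed (auto intro: pair_index_less)

text \<open>
  Coordinates of the element of \<open>C \<otimes> B\<^sup>*\<close> whose coefficient at the \<open>i\<close>-th generator of \<open>C\<close> tensor
  the \<open>k\<close>-th dual generator of \<open>B\<close> is the entry \<open>(i, k)\<close>, that is, of a linear map from \<open>B\<close> to \<open>C\<close>.
\<close>

definition vectorize :: "'r mat \<Rightarrow> 'r mat" where
  "vectorize M = mat (dim_row M * dim_col M) 1 (\<lambda>(x, _). M $$ (x div dim_col M, x mod dim_col M))"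

lemma dim_vectorize [simp]: "dim_row (vectorize M) = dim_row M * dim_col M" "dim_col (vectorize M) = 1"
  by (simp_all add: vectorize_def)

lemma vectorize_index:
  assumes "i < dim_row M" "k < dim_col M" "n = dim_col M"
  shows "vectorize M $$ (i * n + k, 0) = M $$ (i, k)"
  using assms by (simp add: vectorize_def pair_index_less)

lemma vectorize_eqI:
  assumes "dim_row V = a * b" "dim_col V = 1" "dim_row M = a" "dim_col M = b"
    and "\<And>i k. i < a \<Longrightarrow> k < b \<Longrightarrow> V $$ (i * b + k, 0) = M $$ (i, k)"
  shows "V = vectorize M"
proof (rule eq_matI)
  fix x y assume xy: "x < dim_row (vectorize M)" "y < dim_col (vectorize M)"
  then obtain i k where "x = i * b + k" "i < a" "k < b" using assms by (auto elim: pair_indexE)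
  then show "V $$ (x, y) = vectorize M $$ (x, y)" using assms xy by (simp add: vectorize_index)
qed (use assms in auto)

lemma vectorize_surj:
  assumes "dim_row V = a * b" "dim_col V = 1"
  obtains M where "V = vectorize M" "dim_row M = a" "dim_col M = b"
proof
  show "V = vectorize (mat a b (\<lambda>(i, k). V $$ (i * b + k, 0)))"
    by (rule vectorize_eqI[of _ a b]) (use assms in auto)
qed auto

lemma vectorize_inject:
  assumes "vectorize M = vectorize N" "dim_row M = dim_row N" "dim_col M = dim_col N"
  shows "M = N"
proof (rule eq_matI)
  fix i k assume "i < dim_row N" "k < dim_col N"
  then show "M $$ (i, k) = N $$ (i, k)"
    using assms vectorize_index[of i M k "dim_col M"] vectorize_index[of i N k "dim_col N"] by simp
qed (use assms in auto)

lemma vectorize_add: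
  "dim_row M = dim_row N \<Longrightarrow> dim_col M = dim_col N \<Longrightarrow> vectorize (M + N) = vectorize M + vectorize N"
  by (rule sym, rule vectorize_eqI[of _ "dim_row M" "dim_col M"]) (auto simp: vectorize_index pair_index_less)

lemma vectorize_minus:
  "dim_row M = dim_row N \<Longrightarrow> dim_col M = dim_col N \<Longrightarrow> vectorize (M - N) = vectorize M - vectorize N"
  by (rule sym, rule vectorize_eqI[of _ "dim_row M" "dim_col M"]) (auto simp: vectorize_index pair_index_less)

lemma vectorize_zero: "vectorize (0\<^sub>m a b) = 0\<^sub>m (a * b) 1"
  by (rule sym, rule vectorize_eqI[of _ a b]) (auto simp: pair_index_less)

lemma map_mat_vectorize: "map_mat f (vectorize M) = vectorize (map_mat f M)"
  by (rule vectorize_eqI[of _ "dim_row M" "dim_col M"]) (auto simp: vectorize_index pair_index_less)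

lemma kron_mult_vectorize:
  fixes A :: "'r::comm_semiring_1 mat"
  assumes "dim_col A = dim_row M" "dim_col B = dim_col M"
  shows "kron A B * vectorize M = vectorize (A * M * B\<^sup>T)"
proof (rule vectorize_eqI[of _ "dim_row A" "dim_row B"])
  fix i k assume ik: "i < dim_row A" "k < dim_row B"
  have "(kron A B * vectorize M) $$ (i * dim_row B + k, 0)
     = (\<Sum>j<dim_row M. \<Sum>l<dim_col M. kron A B $$ (i * dim_row B + k, j * dim_col M + l) * vectorize M $$ (j * dim_col M + l, 0))"
    using ik assms by (subst mat_mult_index) (simp_all add: pair_index_less sum_pair_index)
  also have "\<dots> = (\<Sum>j<dim_row M. \<Sum>l<dim_col M. A $$ (i, j) * B $$ (k, l) * M $$ (j, l))"
    using ik assms by (intro sum.cong refl) (simp add: kron_index vectorize_index)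
  also have "\<dots> = (\<Sum>l<dim_col M. \<Sum>j<dim_row M. A $$ (i, j) * B $$ (k, l) * M $$ (j, l))"
    by (rule sum.swap)
  also have "\<dots> = (\<Sum>l<dim_col M. (A * M) $$ (i, l) * B\<^sup>T $$ (l, k))"
    using ik assms by (intro sum.cong refl) (simp add: mat_mult_index sum_distrib_left sum_distrib_right mult_ac del: index_mult_mat(1))
  also have "\<dots> = (A * M * B\<^sup>T) $$ (i, k)"
    using ik assms by (subst mat_mult_index[of i "A * M"]) (auto simp del: index_mult_mat(1))
  finally show "(kron A B * vectorize M) $$ (i * dim_row B + k, 0) = (A * M * B\<^sup>T) $$ (i, k)" .
qed auto

abbreviation unit_cplx :: "'r::comm_ring_1 cplx" where
  "unit_cplx \<equiv> Cplx [(0, 0)] (0\<^sub>m 1 1)"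

text \<open>
  The differential is \<open>(\<delta> \<phi>)(x) = - (-1)^p \<phi> (d x)\<close> for \<open>\<phi>\<close> of degree \<open>p\<close>, the sign for which
  evaluation is a chain map.
\<close>

definition dual_cplx :: "'r::comm_ring_1 cplx \<Rightarrow> 'r cplx" where
  "dual_cplx C = Cplx (map (\<lambda>(i, q). (- i, - q)) (gens C)) (- ((diff C)\<^sup>T * sign_mat C))"

lemma rk_dual [simp]: "rk (dual_cplx C) = rk C"
  by (simp add: dual_cplx_def)

lemma gens_dual: "i < rk C \<Longrightarrow> gens (dual_cplx C) ! i = (- hdeg C i, - qdeg C i)"
  by (simp add: dual_cplx_def split_beta)

lemma diff_dual: "diff (dual_cplx C) = - ((diff C)\<^sup>T * sign_mat C)"
  by (simp add: dual_cplx_def)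

lemma sign_mat_dual [simp]: "sign_mat (dual_cplx C) = sign_mat C"
  by (rule eq_matI) (auto simp: sign_mat_index gens_dual)

context graded_ring
begin

lemma homog_dual: "homog_map R a b C C' M \<Longrightarrow> homog_map R a b (dual_cplx C') (dual_cplx C) M\<^sup>T"
  unfolding homog_map_iff by (auto simp: gens_dual algebra_simps)

lemma is_complex_dual:
  assumes "is_complex R C"
  shows "is_complex R (dual_cplx C)"
  unfolding is_complex_def
proof
  note D = complexD[OF assms]
  have h: "homog_map R 1 0 (dual_cplx C) (dual_cplx C) (diff C)\<^sup>T"
    by (rule homog_dual[OF D(1)])
  have s: "sign_mat C * (diff C)\<^sup>T = - ((diff C)\<^sup>T * sign_mat C)"
    using sign_mat_odd_comm[OF h] by simp
  have "homog_map R 0 0 (dual_cplx C) (dual_cplx C) (sign_mat C)"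
    using homog_sign[of "dual_cplx C"] by simp
  then show "homog_map R 1 0 (dual_cplx C) (dual_cplx C) (diff (dual_cplx C))"
    unfolding diff_dual by (intro homog_uminus homog_mult[OF h]) auto
  have dd: "(diff C)\<^sup>T * (diff C)\<^sup>T = 0\<^sub>m (rk C) (rk C)"
    using D by (simp flip: transpose_mult_dim)
  have "(diff C)\<^sup>T * sign_mat C * ((diff C)\<^sup>T * sign_mat C) = (diff C)\<^sup>T * (sign_mat C * (diff C)\<^sup>T) * sign_mat C"
    using D by (simp add: mat_assoc)
  also have "\<dots> = - (((diff C)\<^sup>T * (diff C)\<^sup>T) * sign_mat C * sign_mat C)"
    unfolding s using D by (simp add: mat_assoc)
  also have "\<dots> = 0\<^sub>m (rk C) (rk C)"
    unfolding dd by (simp add: mat_assoc) (intro eq_matI; simp)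
  finally show "diff (dual_cplx C) * diff (dual_cplx C) = 0\<^sub>m (rk (dual_cplx C)) (rk (dual_cplx C))"
    unfolding diff_dual using D by simp
qed

lemma chain_map_dual:
  assumes "is_complex R C" "is_complex R C'" "chain_map R C C' F"
  shows "chain_map R (dual_cplx C') (dual_cplx C) F\<^sup>T"
  unfolding chain_map_def
proof
  note D = complexD[OF assms(1)] complexD[OF assms(2)] chain_mapD[OF assms(3)]
  show h: "homog_map R 0 0 (dual_cplx C') (dual_cplx C) F\<^sup>T"
    by (rule homog_dual[OF chain_mapD(1)[OF assms(3)]])
  have s: "sign_mat C * F\<^sup>T = F\<^sup>T * sign_mat C'"
    using sign_mat_even_comm[OF h] by simp
  have "F\<^sup>T * diff (dual_cplx C') = - ((diff C' * F)\<^sup>T * sign_mat C')"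
    unfolding diff_dual using D by (simp add: transpose_mult_dim mat_assoc)
  also have "\<dots> = - ((F * diff C)\<^sup>T * sign_mat C')" using D by simp
  also have "\<dots> = - ((diff C)\<^sup>T * (F\<^sup>T * sign_mat C'))"
    using D(1-11) by (simp add: transpose_mult_dim mat_assoc)
  also have "\<dots> = diff (dual_cplx C) * F\<^sup>T"
    unfolding diff_dual s[symmetric] using D by (simp add: mat_assoc)
  finally show "F\<^sup>T * diff (dual_cplx C') = diff (dual_cplx C) * F\<^sup>T" .
qed

text \<open>
  The transposed homotopy is \<open>- s K\<^sup>T\<close> with the sign matrix \<open>s\<close>, which compensates the signs in the
  two dual differentials.
\<close>

lemma homotopic_dual:
  assumes "is_complex R C" "is_complex R C'" "chain_map R C C' F" "chain_map R C C' G"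
    and "chain_homotopic R C C' F G"
  shows "chain_homotopic R (dual_cplx C') (dual_cplx C) F\<^sup>T G\<^sup>T"
proof -
  note D = complexD[OF assms(1)] complexD[OF assms(2)] chain_mapD(2,3)[OF assms(3)] chain_mapD(2,3)[OF assms(4)]
  obtain K where K: "homog_map R (-1) 0 C C' K" "dim_row K = rk C'" "dim_col K = rk C"
    "F - G = diff C' * K + K * diff C" using assms(5) by (rule homotopicE)
  have kd: "homog_map R 0 0 C C' (diff C' * K)"
    by (rule homog_mult[OF D(5) K(1)]) auto
  have s: "sign_mat C * (diff C' * K)\<^sup>T = (diff C' * K)\<^sup>T * sign_mat C'"
    using sign_mat_even_comm[OF homog_dual[OF kd]] by simp
  have s1: "sign_mat C * (sign_mat C * K\<^sup>T) = K\<^sup>T"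
    using K by (simp add: mat_assoc[symmetric])
  have s2: "sign_mat C * (K\<^sup>T * ((diff C')\<^sup>T * sign_mat C')) = (diff C' * K)\<^sup>T"
  proof -
    have "sign_mat C * (K\<^sup>T * ((diff C')\<^sup>T * sign_mat C')) = (sign_mat C * (diff C' * K)\<^sup>T) * sign_mat C'"
      using D K(1-3) by (simp add: transpose_mult_dim mat_assoc)
    also have "\<dots> = (diff C' * K)\<^sup>T" unfolding s using D K(1-3) by (simp add: mat_assoc)
    finally show ?thesis .
  qed
  have "F\<^sup>T - G\<^sup>T = (F - G)\<^sup>T" using D by (intro eq_matI) auto
  also have "\<dots> = (diff C' * K)\<^sup>T + (K * diff C)\<^sup>T"
    unfolding K(4) using D K(1-3) by (intro transpose_add[of _ "rk C'" "rk C"]) (auto intro: carrier_matI)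
  also have "\<dots> = diff (dual_cplx C) * (- (sign_mat C * K\<^sup>T)) + (- (sign_mat C * K\<^sup>T)) * diff (dual_cplx C')"
    unfolding diff_dual using D K(1-3)
    by (simp add: mat_assoc s1 s2 transpose_mult_dim[of K]) (intro eq_matI; simp del: index_mult_mat(1) add: add.commute)
  finally have e: "F\<^sup>T - G\<^sup>T = diff (dual_cplx C) * (- (sign_mat C * K\<^sup>T)) + (- (sign_mat C * K\<^sup>T)) * diff (dual_cplx C')" .
  have "homog_map R (-1) 0 (dual_cplx C') (dual_cplx C) (- (sign_mat C * K\<^sup>T))"
    using homog_mult[OF homog_sign[of "dual_cplx C"] homog_dual[OF K(1)]] by (intro homog_uminus) auto
  then show ?thesis unfolding chain_homotopic_def using e by blast
qed

lemma dual_line: "dual_cplx (Cplx [(0, q)] (0\<^sub>m 1 1)) = Cplx [(0, - q)] (0\<^sub>m 1 1)"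
  by (rule cplx_eqI) (auto simp: dual_cplx_def sign_mat_line intro!: eq_matI)

lemma homotopy_inverse_dual:
  assumes "is_complex R C" "is_complex R C'" "chain_map R C C' F" "chain_map R C' C G"
    "chain_homotopic R C C (G * F) (1\<^sub>m (rk C))" "chain_homotopic R C' C' (F * G) (1\<^sub>m (rk C'))"
  shows "homotopy_equivalence R (dual_cplx C) (dual_cplx C') G\<^sup>T"
proof -
  note dims = chain_mapD(2,3)[OF assms(3)] chain_mapD(2,3)[OF assms(4)]
  have "chain_homotopic R (dual_cplx C) (dual_cplx C) (G * F)\<^sup>T (1\<^sub>m (rk C))\<^sup>T"
    by (rule homotopic_dual[OF assms(1,1) chain_map_mult[OF assms(1,2,1,4,3)] chain_map_one[OF assms(1)] assms(5)])
  moreover have "chain_homotopic R (dual_cplx C') (dual_cplx C') (F * G)\<^sup>T (1\<^sub>m (rk C'))\<^sup>T"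
    by (rule homotopic_dual[OF assms(2,2) chain_map_mult[OF assms(2,1,2,3,4)] chain_map_one[OF assms(2)] assms(6)])
  ultimately show ?thesis
    unfolding homotopy_equivalence_def
    using chain_map_dual[OF assms(1,2,3)] chain_map_dual[OF assms(2,1,4)] dims
    by (auto simp: transpose_mult_dim)
qed

lemma hom_complex_degrees:
  assumes "i < rk C" "k < rk B"
  shows "hdeg (tensor_cplx C (dual_cplx B)) (i * rk B + k) = hdeg C i - hdeg B k"
    and "qdeg (tensor_cplx C (dual_cplx B)) (i * rk B + k) = qdeg C i - qdeg B k"
  using assms tensor_gens[of i C k "dual_cplx B"] by (auto simp: gens_dual)

lemma homog_vectorize:
  assumes "dim_row M = rk C" "dim_col M = rk B"
  shows "homog_map R a b unit_cplx (tensor_cplx C (dual_cplx B)) (vectorize M) \<longleftrightarrow> homog_map R a b B C M"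
proof -
  let ?T = "tensor_cplx C (dual_cplx B)"
  have "(vectorize M $$ (i * rk B + k, 0) \<noteq> 0 \<longrightarrow> hdeg ?T (i * rk B + k) = 0 + a) \<and>
      vectorize M $$ (i * rk B + k, 0) \<in> R (0 + b - qdeg ?T (i * rk B + k)) \<longleftrightarrow>
    (M $$ (i, k) \<noteq> 0 \<longrightarrow> hdeg C i = hdeg B k + a) \<and> M $$ (i, k) \<in> R (qdeg B k + b - qdeg C i)"
    if ik: "i < rk C" "k < rk B" for i k
  proof -
    have e: "0 + b - (qdeg C i - qdeg B k) = qdeg B k + b - qdeg C i"
      "hdeg C i - hdeg B k = 0 + a \<longleftrightarrow> hdeg C i = hdeg B k + a" by auto
    have v: "vectorize M $$ (i * rk B + k, 0) = M $$ (i, k)"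
      using ik assms by (intro vectorize_index) auto
    show ?thesis unfolding v hom_complex_degrees[OF ik] e ..
  qed
  then show ?thesis
    unfolding homog_map_iff using assms by (simp add: all_pair_index_iff)
qed

lemma homog_vectorize_transpose:
  assumes "dim_row M = rk C" "dim_col M = rk B"
  shows "homog_map R a b (tensor_cplx C (dual_cplx B)) unit_cplx (vectorize M)\<^sup>T \<longleftrightarrow> homog_map R a b C B M\<^sup>T"
proof -
  let ?T = "tensor_cplx C (dual_cplx B)"
  have *: "((vectorize M)\<^sup>T $$ (0, i * rk B + k) \<noteq> 0 \<longrightarrow> 0 = hdeg ?T (i * rk B + k) + a) \<and>
      (vectorize M)\<^sup>T $$ (0, i * rk B + k) \<in> R (qdeg ?T (i * rk B + k) + b - 0) \<longleftrightarrow>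
    (M\<^sup>T $$ (k, i) \<noteq> 0 \<longrightarrow> hdeg B k = hdeg C i + a) \<and> M\<^sup>T $$ (k, i) \<in> R (qdeg C i + b - qdeg B k)"
    if ik: "i < rk C" "k < rk B" for i k
  proof -
    have e: "qdeg C i - qdeg B k + b - 0 = qdeg C i + b - qdeg B k"
      "0 = hdeg C i - hdeg B k + a \<longleftrightarrow> hdeg B k = hdeg C i + a" by auto
    have v: "(vectorize M)\<^sup>T $$ (0, i * rk B + k) = M\<^sup>T $$ (k, i)"
      using ik assms by (simp add: vectorize_index pair_index_less)
    show ?thesis unfolding v hom_complex_degrees[OF ik] e ..
  qed
  show ?thesis
  proof -
    have "(\<forall>x<rk C * rk B. ((vectorize M)\<^sup>T $$ (0, x) \<noteq> 0 \<longrightarrow> 0 = hdeg ?T x + a) \<and>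
        (vectorize M)\<^sup>T $$ (0, x) \<in> R (qdeg ?T x + b - 0)) \<longleftrightarrow>
      (\<forall>i<rk C. \<forall>k<rk B. (M\<^sup>T $$ (k, i) \<noteq> 0 \<longrightarrow> hdeg B k = hdeg C i + a) \<and>
        M\<^sup>T $$ (k, i) \<in> R (qdeg C i + b - qdeg B k))"
      unfolding all_pair_index_iff using * by (intro all_cong1 imp_cong refl) blast
    then show ?thesis
      unfolding homog_map_iff using assms by simp blast
  qed
qed

text \<open>
  The tensor product with a dual is the complex of homomorphisms, with differential
  \<open>M \<mapsto> d M - (-1)^a M d\<close> on maps of degree \<open>a\<close>.  Its cocycles in bidegree zero are therefore the
  chain maps, and its coboundaries are the null-homotopic ones.
\<close>

lemma diff_hom_complex:
  assumes "is_complex R C" "is_complex R B" "homog_map R a b B C M"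
  shows "diff (tensor_cplx C (dual_cplx B)) * vectorize M =
     (if even a then vectorize (diff C * M - M * diff B) else vectorize (diff C * M + M * diff B))"
proof -
  note D = complexD[OF assms(1)] complexD[OF assms(2)] homog_dim[OF assms(3), THEN conjunct1]
    homog_dim[OF assms(3), THEN conjunct2]
  have t: "(diff (dual_cplx B))\<^sup>T = - (sign_mat B * diff B)"
    unfolding diff_dual using D by (simp add: transpose_uminus transpose_mult_dim)
  have "diff (tensor_cplx C (dual_cplx B)) * vectorize M =
      vectorize (diff C * M * 1\<^sub>m (rk B)) + vectorize (sign_mat C * M * (diff (dual_cplx B))\<^sup>T)"
    unfolding diff_tensor using D
    by (simp add: mat_distr kron_mult_vectorize is_complex_dual[OF assms(2), THEN complexD(2)]
       is_complex_dual[OF assms(2), THEN complexD(3)])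
  also have "\<dots> = vectorize (diff C * M + - (sign_mat C * M * sign_mat B * diff B))"
    unfolding t using D by (subst vectorize_add[symmetric]) (auto simp: mat_assoc)
  also have "\<dots> = (if even a then vectorize (diff C * M - M * diff B) else vectorize (diff C * M + M * diff B))"
  proof (cases "even a")
    case True
    then have "sign_mat C * M * sign_mat B = M"
      using sign_mat_even_comm[OF assms(3)] D by (simp add: mat_assoc)
    moreover have "diff C * M + - (M * diff B) = diff C * M - M * diff B"
      using D by (intro eq_matI) (auto simp del: index_mult_mat(1))
    ultimately show ?thesis using True by simp
  next
    case False
    then have "sign_mat C * M * sign_mat B = - M"
      using sign_mat_odd_comm[OF assms(3)] D by (simp add: mat_assoc)
    then show ?thesis using False D by simp
  qed
  finally show ?thesis .
qed

lemma chain_map_vectorize: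
  assumes "is_complex R C" "is_complex R B" "dim_row M = rk C" "dim_col M = rk B"
  shows "chain_map R unit_cplx (tensor_cplx C (dual_cplx B)) (vectorize M) \<longleftrightarrow> chain_map R B C M"
proof (cases "homog_map R 0 0 B C M")
  case True
  note D = complexD[OF assms(1)] complexD[OF assms(2)]
  have "vectorize M * diff unit_cplx = vectorize (0\<^sub>m (rk C) (rk B))"
    using assms by (simp add: vectorize_zero)
  moreover have "diff (tensor_cplx C (dual_cplx B)) * vectorize M = vectorize (diff C * M - M * diff B)"
    using diff_hom_complex[OF assms(1,2) True] by simp
  moreover have "vectorize (0\<^sub>m (rk C) (rk B)) = vectorize (diff C * M - M * diff B) \<longleftrightarrow> M * diff B = diff C * M"
  proof
    assume v: "vectorize (0\<^sub>m (rk C) (rk B)) = vectorize (diff C * M - M * diff B)"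
    have z: "0\<^sub>m (rk C) (rk B) = diff C * M - M * diff B"
      by (rule vectorize_inject[OF v]) (use D assms in simp_all)
    show "M * diff B = diff C * M"
    proof (rule eq_matI)
      fix i j assume ij: "i < dim_row (diff C * M)" "j < dim_col (diff C * M)"
      have "(diff C * M - M * diff B) $$ (i, j) = 0"
        using D assms ij by (simp add: z[symmetric])
      then show "(M * diff B) $$ (i, j) = (diff C * M) $$ (i, j)"
        using D assms ij by (simp del: index_mult_mat(1))
    qed (use D assms in auto)
  next
    assume "M * diff B = diff C * M"
    then have "diff C * M - M * diff B = 0\<^sub>m (rk C) (rk B)"
      using D assms by (intro eq_matI) (simp_all del: index_mult_mat(1))
    then show "vectorize (0\<^sub>m (rk C) (rk B)) = vectorize (diff C * M - M * diff B)" by simp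
  qed
  ultimately show ?thesis
    using True homog_vectorize[OF assms(3,4)] by (simp add: chain_map_def)
next
  case False
  then show ?thesis using homog_vectorize[OF assms(3,4)] by (simp add: chain_map_def)
qed

lemma homotopic_vectorize:
  assumes "is_complex R C" "is_complex R B" "dim_row F = rk C" "dim_col F = rk B" "dim_row G = rk C" "dim_col G = rk B"
  shows "chain_homotopic R unit_cplx (tensor_cplx C (dual_cplx B)) (vectorize F) (vectorize G) \<longleftrightarrow>
     chain_homotopic R B C F G"
proof
  note D = complexD[OF assms(1)] complexD[OF assms(2)]
  have key: "vectorize F - vectorize G = diff (tensor_cplx C (dual_cplx B)) * vectorize K + vectorize K * diff unit_cplx
     \<longleftrightarrow> F - G = diff C * K + K * diff B" if K: "homog_map R (-1) 0 B C K" for K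
  proof -
    note dK = homog_dim[OF K]
    have "diff (tensor_cplx C (dual_cplx B)) * vectorize K + vectorize K * diff unit_cplx = vectorize (diff C * K + K * diff B)"
      using diff_hom_complex[OF assms(1,2) K] dK D by (intro eq_matI) (auto simp del: index_mult_mat(1))
    moreover have "vectorize F - vectorize G = vectorize (F - G)"
      using assms by (simp add: vectorize_minus)
    moreover have "vectorize (F - G) = vectorize (diff C * K + K * diff B) \<longleftrightarrow> F - G = diff C * K + K * diff B"
      using assms D dK by (auto intro: vectorize_inject)
    ultimately show ?thesis by simp
  qed
  show "chain_homotopic R B C F G" if h: "chain_homotopic R unit_cplx (tensor_cplx C (dual_cplx B)) (vectorize F) (vectorize G)"
  proof -
    obtain V where V: "homog_map R (-1) 0 unit_cplx (tensor_cplx C (dual_cplx B)) V" "dim_row V = rk C * rk B" "dim_col V = 1"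
      "vectorize F - vectorize G = diff (tensor_cplx C (dual_cplx B)) * V + V * diff unit_cplx"
      using h by (rule homotopicE) simp
    obtain K where K: "V = vectorize K" "dim_row K = rk C" "dim_col K = rk B"
      using V(2,3) by (rule vectorize_surj)
    show ?thesis
      using V key homog_vectorize[OF K(2,3)] unfolding K(1) chain_homotopic_def by blast
  qed
  show "chain_homotopic R unit_cplx (tensor_cplx C (dual_cplx B)) (vectorize F) (vectorize G)" if h: "chain_homotopic R B C F G"
  proof -
    obtain K where K: "homog_map R (-1) 0 B C K" "dim_row K = rk C" "dim_col K = rk B"
      "F - G = diff C * K + K * diff B" using h by (rule homotopicE)
    show ?thesis
      using key[OF K(1)] K(1,4) homog_vectorize[OF K(2,3)] unfolding chain_homotopic_def by blast
  qed
qed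

end

lemma (in graded_ring_hom) base_change_dual:
  assumes "is_complex R C"
  shows "base_change \<phi> (dual_cplx C) = dual_cplx (base_change \<phi> C)"
  using R.complexD[OF assms]
  by (intro cplx_eqI) (auto simp: dual_cplx_def map_mat_uminus map_mat_mult map_mat_sign map_mat_transpose)

section \<open>Duals of triples\<close>

definition homotopy_inverse :: "leo \<Rightarrow> bit mat \<Rightarrow> bool" where
  "homotopy_inverse X g \<longleftrightarrow>
     chain_map trivial_grading (cplx_h0 (hpart X)) (cplx_mod2 (zpart X)) g \<and>
     chain_homotopic trivial_grading (cplx_mod2 (zpart X)) (cplx_mod2 (zpart X)) (g * cmp X) (1\<^sub>m (rk (zpart X))) \<and>
     chain_homotopic trivial_grading (cplx_h0 (hpart X)) (cplx_h0 (hpart X)) (cmp X * g) (1\<^sub>m (rk (hpart X)))"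

text \<open>
  Homotopy inverses are unique up to homotopy, so another choice would give a locally equivalent
  triple.
\<close>

definition dual_leo :: "leo \<Rightarrow> leo" where
  "dual_leo X = LEO (dual_cplx (zpart X)) (dual_cplx (hpart X)) (SOME g. homotopy_inverse X g)\<^sup>T"

lemma dual_leo_cmp:
  assumes "X \<in> leo_triples"
  obtains g where "homotopy_inverse X g" "cmp (dual_leo X) = g\<^sup>T"
proof
  have "\<exists>g. homotopy_inverse X g"
    using leo_triplesD(6)[OF assms] by (auto simp: homotopy_equivalence_def homotopy_inverse_def)
  then show "homotopy_inverse X (SOME g. homotopy_inverse X g)" by (rule someI_ex)
qed (simp add: dual_leo_def)

lemma dual_leo_sel [simp]:
  "zpart (dual_leo X) = dual_cplx (zpart X)" "hpart (dual_leo X) = dual_cplx (hpart X)"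
  by (simp_all add: dual_leo_def)

lemma dual_leo_triples:
  assumes "X \<in> leo_triples"
  shows "dual_leo X \<in> leo_triples"
proof -
  note X = leo_triplesD[OF assms]
  obtain g where g: "homotopy_inverse X g" "cmp (dual_leo X) = g\<^sup>T"
    using assms by (rule dual_leo_cmp)
  have "homotopy_equivalence trivial_grading (dual_cplx (cplx_mod2 (zpart X))) (dual_cplx (cplx_h0 (hpart X))) g\<^sup>T"
    using triv.homotopy_inverse_dual[OF X(3,4,7)] g(1) by (simp add: homotopy_inverse_def)
  moreover obtain q F where q: "even q" "homotopy_equivalence laurent_grading (cplx_hinv (hpart X)) (laurent_line q) F"
    using X(8) by (auto simp: homotopy_equivalent_def)
  have "homotopy_equivalent laurent_grading (dual_cplx (cplx_hinv (hpart X))) (laurent_line (- q))"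
  proof -
    obtain G where "chain_map laurent_grading (cplx_hinv (hpart X)) (laurent_line q) F"
      "chain_map laurent_grading (laurent_line q) (cplx_hinv (hpart X)) G"
      "chain_homotopic laurent_grading (cplx_hinv (hpart X)) (cplx_hinv (hpart X)) (G * F) (1\<^sub>m (rk (cplx_hinv (hpart X))))"
      "chain_homotopic laurent_grading (laurent_line q) (laurent_line q) (F * G) (1\<^sub>m (rk (laurent_line q)))"
      using q(2) by (auto simp: homotopy_equivalence_def)
    from laur.homotopy_inverse_dual[OF X(5) laur.is_complex_line this]
    show ?thesis unfolding laur.dual_line homotopy_equivalent_def by blast
  qed
  moreover have "even (- q)" using q by simp
  ultimately show ?thesis
    unfolding leo_triples_def mem_Collect_eq dual_leo_sel g(2) mod2.base_change_dual[OF X(1)]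
      h0.base_change_dual[OF X(2)] hinv.base_change_dual[OF X(2)]
    using triv.is_complex_dual[OF X(1)] hgr.is_complex_dual[OF X(2)] by blast
qed

lemma unit_leo_sel [simp]:
  "zpart unit_leo = Cplx [(0, 0)] (0\<^sub>m 1 1)" "hpart unit_leo = Cplx [(0, 0)] (0\<^sub>m 1 1)" "cmp unit_leo = 1\<^sub>m 1"
  by (simp_all add: unit_leo_def)

lemma mod2_zero: "mod2 0 = 0" by (simp add: mod2_def)
lemma h_to_0_zero: "h_to_0 0 = 0" by (simp add: h_to_0_def)
lemma to_laurent_zero: "to_laurent 0 = 0" by (simp add: to_laurent_def)

text \<open>
  A pair of maps from \<open>X\<close> to \<open>Y\<close> is a pair of elements of the homomorphism complexes.  If \<open>g\<close> is a
  homotopy inverse of the comparison map of \<open>X\<close>, then \<open>f\<^sub>Y \<alpha> g \<simeq> \<beta>\<close> is equivalent to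
  \<open>f\<^sub>Y \<alpha> \<simeq> \<beta> f\<^sub>X\<close>, by composing with \<open>f\<^sub>X\<close> on one side and with \<open>g\<close> on the other.
\<close>

lemma has_local_map_iff_unit_hom:
  assumes "X \<in> leo_triples" "Y \<in> leo_triples"
  shows "has_local_map X Y \<longleftrightarrow> has_local_map unit_leo (tensor_leo Y (dual_leo X))"
proof -
  note X = leo_triplesD[OF assms(1)] and Y = leo_triplesD[OF assms(2)]
  let ?W = "tensor_leo Y (dual_leo X)"
  have W: "?W \<in> leo_triples" using assms by (intro tensor_leo_triples dual_leo_triples)
  obtain g where g: "homotopy_inverse X g" "cmp (dual_leo X) = g\<^sup>T"
    using assms(1) by (rule dual_leo_cmp)
  have g': "chain_map trivial_grading (cplx_h0 (hpart X)) (cplx_mod2 (zpart X)) g"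
     "chain_homotopic trivial_grading (cplx_mod2 (zpart X)) (cplx_mod2 (zpart X)) (g * cmp X) (1\<^sub>m (rk (zpart X)))"
     "chain_homotopic trivial_grading (cplx_h0 (hpart X)) (cplx_h0 (hpart X)) (cmp X * g) (1\<^sub>m (rk (hpart X)))"
    using g(1) by (auto simp: homotopy_inverse_def)
  note dims = triv.chain_mapD(2,3)[OF X(7)] triv.chain_mapD(2,3)[OF Y(7)] triv.chain_mapD(2,3)[OF g'(1)]
  let ?CX = "cplx_mod2 (zpart X)" and ?DX = "cplx_h0 (hpart X)"
  let ?CY = "cplx_mod2 (zpart Y)" and ?DY = "cplx_h0 (hpart Y)"
  have key: "local_map X Y \<alpha> \<beta> \<longleftrightarrow> local_map unit_leo ?W (vectorize \<alpha>) (vectorize \<beta>)"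
    if d: "dim_row \<alpha> = rk (zpart Y)" "dim_col \<alpha> = rk (zpart X)" "dim_row \<beta> = rk (hpart Y)" "dim_col \<beta> = rk (hpart X)" for \<alpha> \<beta>
  proof -
    have 1: "chain_map trivial_grading (zpart unit_leo) (zpart ?W) (vectorize \<alpha>) \<longleftrightarrow> chain_map trivial_grading (zpart X) (zpart Y) \<alpha>"
      using triv.chain_map_vectorize[OF Y(1) X(1) d(1,2)] by simp
    have 2: "chain_map h_grading (hpart unit_leo) (hpart ?W) (vectorize \<beta>) \<longleftrightarrow> chain_map h_grading (hpart X) (hpart Y) \<beta>"
      using hgr.chain_map_vectorize[OF Y(2) X(2) d(3,4)] by simp
    have 3: "chain_homotopic laurent_grading (cplx_hinv (hpart unit_leo)) (cplx_hinv (hpart ?W)) (map_mat to_laurent (vectorize \<beta>)) (0\<^sub>m (rk (hpart ?W)) (rk (hpart unit_leo)))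
      \<longleftrightarrow> chain_homotopic laurent_grading (cplx_hinv (hpart X)) (cplx_hinv (hpart Y)) (map_mat to_laurent \<beta>) (0\<^sub>m (rk (hpart Y)) (rk (hpart X)))"
      using laur.homotopic_vectorize[OF Y(5) X(5), of "map_mat to_laurent \<beta>" "0\<^sub>m (rk (hpart Y)) (rk (hpart X))"] d
      by (simp add: hinv.base_change_tensor[OF Y(2) hgr.is_complex_dual[OF X(2)]] hinv.base_change_dual[OF X(2)]
          base_change_line[unfolded One_nat_def, of to_laurent, OF to_laurent_zero] map_mat_vectorize vectorize_zero)
    have 4: "chain_homotopic trivial_grading (cplx_mod2 (zpart unit_leo)) (cplx_h0 (hpart ?W)) (cmp ?W * map_mat mod2 (vectorize \<alpha>)) (map_mat h_to_0 (vectorize \<beta>) * cmp unit_leo)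
      \<longleftrightarrow> chain_homotopic trivial_grading ?DX ?DY (cmp Y * map_mat mod2 \<alpha> * g) (map_mat h_to_0 \<beta>)"
      using triv.homotopic_vectorize[OF Y(4) X(4), of "cmp Y * map_mat mod2 \<alpha> * g" "map_mat h_to_0 \<beta>"] d dims
      by (simp add: h0.base_change_tensor[OF Y(2) hgr.is_complex_dual[OF X(2)]] h0.base_change_dual[OF X(2)] g(2)
          base_change_line[unfolded One_nat_def, of mod2, OF mod2_zero] map_mat_vectorize kron_mult_vectorize)
    have 5: "chain_homotopic trivial_grading ?DX ?DY (cmp Y * map_mat mod2 \<alpha> * g) (map_mat h_to_0 \<beta>)
      \<longleftrightarrow> chain_homotopic trivial_grading ?CX ?DY (cmp Y * map_mat mod2 \<alpha>) (map_mat h_to_0 \<beta> * cmp X)"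
      if c: "chain_map trivial_grading (zpart X) (zpart Y) \<alpha>" "chain_map h_grading (hpart X) (hpart Y) \<beta>"
    proof -
      note a = mod2.chain_map_base_change[OF X(1) Y(1) c(1)]
      note b = h0.chain_map_base_change[OF X(2) Y(2) c(2)]
      note fa = triv.chain_map_mult[OF X(3) Y(3) Y(4) Y(7) a]
      note fag = triv.chain_map_mult[OF X(4) X(3) Y(4) fa g'(1)]
      note bf = triv.chain_map_mult[OF X(3) X(4) Y(4) b X(7)]
      note gf = triv.chain_map_mult[OF X(3) X(4) X(3) g'(1) X(7)]
      note fg = triv.chain_map_mult[OF X(4) X(3) X(4) X(7) g'(1)]
      have o: "chain_map trivial_grading ?CX ?CX (1\<^sub>m (rk (zpart X)))" "chain_map trivial_grading ?DX ?DX (1\<^sub>m (rk (hpart X)))"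
        using triv.chain_map_one[OF X(3)] triv.chain_map_one[OF X(4)] by simp_all
      show ?thesis
      proof
        assume "chain_homotopic trivial_grading ?DX ?DY (cmp Y * map_mat mod2 \<alpha> * g) (map_mat h_to_0 \<beta>)"
        from triv.homotopic_mult_right[OF X(3,4) Y(4) fag b X(7) this]
        have 1: "chain_homotopic trivial_grading ?CX ?DY ((cmp Y * map_mat mod2 \<alpha>) * (g * cmp X)) (map_mat h_to_0 \<beta> * cmp X)"
          using dims d by (simp add: mat_assoc)
        from triv.homotopic_mult_left[OF X(3,3) Y(4) gf o(1) fa g'(2)]
        have 2: "chain_homotopic trivial_grading ?CX ?DY ((cmp Y * map_mat mod2 \<alpha>) * (g * cmp X)) (cmp Y * map_mat mod2 \<alpha>)"
          using dims d by simp
        note fagf = triv.chain_map_mult[OF X(3,3) Y(4) fa gf]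
        show "chain_homotopic trivial_grading ?CX ?DY (cmp Y * map_mat mod2 \<alpha>) (map_mat h_to_0 \<beta> * cmp X)"
          by (rule triv.homotopic_trans[OF X(3) Y(4) fa fagf bf triv.homotopic_sym[OF X(3) Y(4) fagf fa 2] 1])
      next
        assume "chain_homotopic trivial_grading ?CX ?DY (cmp Y * map_mat mod2 \<alpha>) (map_mat h_to_0 \<beta> * cmp X)"
        from triv.homotopic_mult_right[OF X(4,3) Y(4) fa bf g'(1) this]
        have 1: "chain_homotopic trivial_grading ?DX ?DY (cmp Y * map_mat mod2 \<alpha> * g) (map_mat h_to_0 \<beta> * (cmp X * g))"
          using dims d by (simp add: mat_assoc)
        from triv.homotopic_mult_left[OF X(4,4) Y(4) fg o(2) b g'(3)]
        have 2: "chain_homotopic trivial_grading ?DX ?DY (map_mat h_to_0 \<beta> * (cmp X * g)) (map_mat h_to_0 \<beta>)"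
          using dims d by simp
        show "chain_homotopic trivial_grading ?DX ?DY (cmp Y * map_mat mod2 \<alpha> * g) (map_mat h_to_0 \<beta>)"
          by (rule triv.homotopic_trans[OF X(4) Y(4) fag triv.chain_map_mult[OF X(4,4) Y(4) b fg] b 1 2])
      qed
    qed
    show ?thesis
      unfolding local_map_iff[OF assms] local_map_iff[OF unit_leo_triples W] 1 2 3 4 using 5 by blast
  qed
  show ?thesis
  proof
    assume "has_local_map X Y"
    then obtain \<alpha> \<beta> where l: "local_map X Y \<alpha> \<beta>" by (auto simp: has_local_map_def)
    then have "chain_map trivial_grading (zpart X) (zpart Y) \<alpha>" "chain_map h_grading (hpart X) (hpart Y) \<beta>"
      by (auto simp: local_map_def)
    from key[OF triv.chain_mapD(2,3)[OF this(1)] hgr.chain_mapD(2,3)[OF this(2)]] l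
    show "has_local_map unit_leo ?W" by (auto simp: has_local_map_def)
  next
    assume "has_local_map unit_leo ?W"
    then obtain a b where l: "local_map unit_leo ?W a b" by (auto simp: has_local_map_def)
    then have ab: "chain_map trivial_grading (zpart unit_leo) (zpart ?W) a" "chain_map h_grading (hpart unit_leo) (hpart ?W) b"
      by (auto simp: local_map_def)
    obtain \<alpha> where \<alpha>: "a = vectorize \<alpha>" "dim_row \<alpha> = rk (zpart Y)" "dim_col \<alpha> = rk (zpart X)"
      using triv.chain_mapD(2,3)[OF ab(1)] by (auto elim: vectorize_surj)
    obtain \<beta> where \<beta>: "b = vectorize \<beta>" "dim_row \<beta> = rk (hpart Y)" "dim_col \<beta> = rk (hpart X)"
      using hgr.chain_mapD(2,3)[OF ab(2)] by (auto elim: vectorize_surj)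
    show "has_local_map X Y"
      using key[OF \<alpha>(2,3) \<beta>(2,3)] l unfolding \<alpha>(1) \<beta>(1) by (auto simp: has_local_map_def)
  qed
qed

section \<open>Evaluation\<close>

lemma sign_mat_char2:
  assumes "- 1 = (1 :: 'r::comm_ring_1)"
  shows "sign_mat (C :: 'r cplx) = 1\<^sub>m (rk C)"
  by (rule eq_matI) (auto simp: sign_mat_index assms)

text \<open>
  The coboundary of the functional \<open>M \<mapsto> tr (N\<^sup>T M)\<close> on a homomorphism complex.
\<close>

lemma (in graded_ring) row_hom_complex:
  assumes "is_complex R C" "is_complex R B" "dim_row N = rk C" "dim_col N = rk B"
  shows "(vectorize N)\<^sup>T * diff (tensor_cplx C (dual_cplx B)) =
    (vectorize ((diff C)\<^sup>T * N + sign_mat C * N * diff (dual_cplx B)))\<^sup>T"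
proof -
  note D = complexD[OF assms(1)] complexD(2,3)[OF is_complex_dual[OF assms(2)]]
  have "(diff (tensor_cplx C (dual_cplx B)))\<^sup>T = kron (diff C)\<^sup>T (1\<^sub>m (rk B)) + kron (sign_mat C) (diff (dual_cplx B))\<^sup>T"
    unfolding diff_tensor using D
    by (subst transpose_add[of _ "rk C * rk B" "rk C * rk B"]) (auto simp: transpose_kron)
  then have "(diff (tensor_cplx C (dual_cplx B)))\<^sup>T * vectorize N =
      vectorize ((diff C)\<^sup>T * N + sign_mat C * N * diff (dual_cplx B))"
    using D assms(3,4) by (simp add: mat_distr kron_mult_vectorize vectorize_add)
  then show ?thesis
    using D assms(3,4) transpose_mult_dim[of "(diff (tensor_cplx C (dual_cplx B)))\<^sup>T" "vectorize N"]
    by (simp add: diff_tensor)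
qed

text \<open>
  This functional is the supertrace, which vanishes on graded commutators and thus on coboundaries
  of the endomorphism complex.
\<close>

lemma (in graded_ring) chain_map_evaluation:
  assumes "is_complex R C"
  shows "chain_map R (tensor_cplx C (dual_cplx C)) unit_cplx (vectorize (sign_mat C))\<^sup>T"
  unfolding chain_map_def
proof
  note D = complexD[OF assms]
  have "homog_map R 0 0 C C (sign_mat C)\<^sup>T" using homog_sign by simp
  then show "homog_map R 0 0 (tensor_cplx C (dual_cplx C)) unit_cplx (vectorize (sign_mat C))\<^sup>T"
    by (subst homog_vectorize_transpose) auto
  have "(diff C)\<^sup>T * sign_mat C + sign_mat C * sign_mat C * diff (dual_cplx C) = 0\<^sub>m (rk C) (rk C)"
    unfolding diff_dual using D by (intro eq_matI) (simp_all del: index_mult_mat(1))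
  then show "(vectorize (sign_mat C))\<^sup>T * diff (tensor_cplx C (dual_cplx C)) = diff unit_cplx * (vectorize (sign_mat C))\<^sup>T"
    using row_hom_complex[OF assms assms, of "sign_mat C"] by (simp add: vectorize_zero)
qed

text \<open>
  For \<open>F - 1 = d K + K d\<close> the functionals \<open>M \<mapsto> tr (F M)\<close> and \<open>M \<mapsto> tr M\<close> differ by the coboundary of
  \<open>M \<mapsto> tr (K M)\<close>.
\<close>

lemma evaluation_homotopic:
  assumes C: "is_complex trivial_grading (C :: bit cplx)"
    and F: "chain_map trivial_grading C C F" "chain_homotopic trivial_grading C C F (1\<^sub>m (rk C))"
  shows "chain_homotopic trivial_grading (tensor_cplx C (dual_cplx C)) unit_cplx
    (vectorize F\<^sup>T)\<^sup>T (vectorize (1\<^sub>m (rk C)))\<^sup>T"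
proof -
  note D = triv.complexD[OF C] triv.chain_mapD(2,3)[OF F(1)]
  obtain K where K: "homog_map trivial_grading (-1) 0 C C K" "dim_row K = rk C" "dim_col K = rk C"
    "F - 1\<^sub>m (rk C) = diff C * K + K * diff C" using F(2) by (rule triv.homotopicE)
  have dd: "diff (dual_cplx C) = (diff C)\<^sup>T"
    unfolding diff_dual using D by (intro eq_matI) (simp_all add: sign_mat_char2)
  have "(vectorize K\<^sup>T)\<^sup>T * diff (tensor_cplx C (dual_cplx C)) = (vectorize ((diff C)\<^sup>T * K\<^sup>T + K\<^sup>T * (diff C)\<^sup>T))\<^sup>T"
    using triv.row_hom_complex[OF C C, of "K\<^sup>T"] K(2,3) D by (simp add: dd sign_mat_char2)
  also have "(diff C)\<^sup>T * K\<^sup>T + K\<^sup>T * (diff C)\<^sup>T = (K * diff C + diff C * K)\<^sup>T"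
    using D K(2,3) by (subst transpose_add[of _ "rk C" "rk C"]) (auto simp: transpose_mult_dim)
  also have "K * diff C + diff C * K = F - 1\<^sub>m (rk C)"
    unfolding K(4) using D K(2,3) by (intro comm_add_mat[of _ "rk C" "rk C"]) auto
  also have "(vectorize (F - 1\<^sub>m (rk C))\<^sup>T)\<^sup>T = (vectorize F\<^sup>T)\<^sup>T - (vectorize (1\<^sub>m (rk C)))\<^sup>T"
    using D by (subst transpose_minus[of _ "rk C" "rk C"])
      (auto simp: vectorize_minus transpose_minus[of _ "rk C * rk C" 1])
  finally have e: "(vectorize F\<^sup>T)\<^sup>T - (vectorize (1\<^sub>m (rk C)))\<^sup>T
     = diff unit_cplx * (vectorize K\<^sup>T)\<^sup>T + (vectorize K\<^sup>T)\<^sup>T * diff (tensor_cplx C (dual_cplx C))"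
    using K(2,3) D by (simp add: diff_tensor dd) (intro eq_matI; simp)
  have "homog_map trivial_grading (-1) 0 (tensor_cplx C (dual_cplx C)) unit_cplx (vectorize K\<^sup>T)\<^sup>T"
    using K by (subst triv.homog_vectorize_transpose) auto
  then show ?thesis unfolding chain_homotopic_def using e by blast
qed

lemma laurent_minus_one: "- 1 = (1 :: int \<Rightarrow>\<^sub>0 bit)"
  by (rule poly_mapping_eqI) simp

text \<open>
  If \<open>F\<close> and \<open>G\<close> are inverse equivalences with the line, then \<open>F G = 1\<close> and the cocycle \<open>G F\<close> has
  trace one, whereas a null-homotopic functional vanishes on cocycles.
\<close>

lemma evaluation_not_null:
  assumes C: "is_complex laurent_grading C" "homotopy_equivalent laurent_grading C (laurent_line q)"
  shows "\<not> chain_homotopic laurent_grading (tensor_cplx C (dual_cplx C)) unit_cplx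
    (vectorize (1\<^sub>m (rk C)))\<^sup>T (0\<^sub>m 1 (rk C * rk C))"
proof
  assume "chain_homotopic laurent_grading (tensor_cplx C (dual_cplx C)) unit_cplx
    (vectorize (1\<^sub>m (rk C)))\<^sup>T (0\<^sub>m 1 (rk C * rk C))"
  then obtain K where K: "dim_row K = 1" "dim_col K = rk C * rk C"
    "(vectorize (1\<^sub>m (rk C)))\<^sup>T - 0\<^sub>m 1 (rk C * rk C) = diff unit_cplx * K + K * diff (tensor_cplx C (dual_cplx C))"
    by (rule laur.homotopicE) simp
  obtain F G where FG: "chain_map laurent_grading C (laurent_line q) F" "chain_map laurent_grading (laurent_line q) C G"
    "chain_homotopic laurent_grading (laurent_line q) (laurent_line q) (F * G) (1\<^sub>m 1)"
    using C(2) by (auto simp: homotopy_equivalent_def homotopy_equivalence_def)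
  note D = laur.complexD[OF C(1)] laur.complexD(2,3)[OF laur.is_complex_dual[OF C(1)]]
  note dims = laur.chain_mapD(2,3)[OF FG(1)] laur.chain_mapD(2,3)[OF FG(2)]
  have FG1: "F * G = 1\<^sub>m 1"
    using dims by (intro laur.homotopic_line_eq[OF FG(3)]) auto
  have M: "chain_map laurent_grading C C (G * F)"
    by (rule laur.chain_map_mult[OF C(1) laur.is_complex_line C(1) FG(2,1)])
  have "diff (tensor_cplx C (dual_cplx C)) * vectorize (G * F) = vectorize (diff C * (G * F) - (G * F) * diff C)"
    using laur.diff_hom_complex[OF C(1) C(1) laur.chain_mapD(1)[OF M]] by simp
  also have "diff C * (G * F) - (G * F) * diff C = 0\<^sub>m (rk C) (rk C)"
    unfolding laur.chain_mapD(4)[OF M] using D dims by (intro eq_matI) (simp_all del: index_mult_mat(1))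
  finally have DM: "diff (tensor_cplx C (dual_cplx C)) * vectorize (G * F) = 0\<^sub>m (rk C * rk C) 1"
    by (simp add: vectorize_zero)
  have "(vectorize (1\<^sub>m (rk C)))\<^sup>T = K * diff (tensor_cplx C (dual_cplx C))"
  proof -
    have "(vectorize (1\<^sub>m (rk C)))\<^sup>T = (vectorize (1\<^sub>m (rk C)))\<^sup>T - (0\<^sub>m 1 (rk C * rk C) :: (int \<Rightarrow>\<^sub>0 bit) mat)"
      by (intro eq_matI) auto
    also have "\<dots> = K * diff (tensor_cplx C (dual_cplx C))"
      unfolding K(3) using K(1,2) D by (simp add: diff_tensor) (intro eq_matI; simp del: index_mult_mat(1))
    finally show ?thesis .
  qed
  then have "(vectorize (1\<^sub>m (rk C)))\<^sup>T * vectorize (G * F) = 0\<^sub>m 1 1"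
    using DM K D dims by (simp add: mat_assoc diff_tensor)
  then have z: "((vectorize (1\<^sub>m (rk C)))\<^sup>T * vectorize (G * F)) $$ (0, 0) = 0" by simp
  have "((vectorize (1\<^sub>m (rk C)))\<^sup>T * vectorize (G * F)) $$ (0, 0) =
     (\<Sum>i<rk C. \<Sum>k<rk C. (vectorize (1\<^sub>m (rk C)))\<^sup>T $$ (0, i * rk C + k) * vectorize (G * F) $$ (i * rk C + k, 0))"
    using dims by (subst mat_mult_index) (auto simp: sum_pair_index pair_index_less intro!: sum.cong)
  also have "\<dots> = (\<Sum>i<rk C. \<Sum>k<rk C. if k = i then (G * F) $$ (i, i) else 0)"
    using dims by (intro sum.cong refl) (auto simp: vectorize_index pair_index_less simp del: index_mult_mat(1))
  also have "\<dots> = (\<Sum>i<rk C. (G * F) $$ (i, i))"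
    by simp
  also have "\<dots> = (\<Sum>i<rk C. F $$ (0, i) * G $$ (i, 0))"
    using dims by (intro sum.cong refl) (subst mat_mult_index, auto simp: mult.commute)
  also have "\<dots> = (F * G) $$ (0, 0)"
    using dims by (subst mat_mult_index) auto
  also have "\<dots> = 1" unfolding FG1 by simp
  finally show False using z by simp
qed

lemma has_local_map_evaluation:
  assumes "X \<in> leo_triples"
  shows "has_local_map (tensor_leo X (dual_leo X)) unit_leo"
proof -
  note X = leo_triplesD[OF assms]
  let ?W = "tensor_leo X (dual_leo X)"
  have W: "?W \<in> leo_triples" using assms by (intro tensor_leo_triples dual_leo_triples)
  obtain g where g: "homotopy_inverse X g" "cmp (dual_leo X) = g\<^sup>T"
    using assms by (rule dual_leo_cmp)
  have g': "chain_map trivial_grading (cplx_h0 (hpart X)) (cplx_mod2 (zpart X)) g"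
     "chain_homotopic trivial_grading (cplx_mod2 (zpart X)) (cplx_mod2 (zpart X)) (g * cmp X) (1\<^sub>m (rk (zpart X)))"
    using g(1) by (auto simp: homotopy_inverse_def)
  note dims = triv.chain_mapD(2,3)[OF X(7)] triv.chain_mapD(2,3)[OF g'(1)]
  let ?\<alpha> = "(vectorize (sign_mat (zpart X)))\<^sup>T" and ?\<beta> = "(vectorize (sign_mat (hpart X)))\<^sup>T"
  let ?C = "cplx_mod2 (zpart X)"
  have a: "map_mat mod2 ?\<alpha> = (vectorize (1\<^sub>m (rk (zpart X))))\<^sup>T"
    by (simp add: map_mat_transpose[symmetric] map_mat_vectorize mod2.map_mat_sign sign_mat_char2)
  have b: "map_mat h_to_0 ?\<beta> = (vectorize (1\<^sub>m (rk (hpart X))))\<^sup>T"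
    by (simp add: map_mat_transpose[symmetric] map_mat_vectorize h0.map_mat_sign sign_mat_char2)
  have c: "map_mat to_laurent ?\<beta> = (vectorize (1\<^sub>m (rk (hpart X))))\<^sup>T"
    by (simp add: map_mat_transpose[symmetric] map_mat_vectorize hinv.map_mat_sign sign_mat_char2 laurent_minus_one)
  have gf: "chain_map trivial_grading ?C ?C (g * cmp X)"
    by (rule triv.chain_map_mult[OF X(3) X(4) X(3) g'(1) X(7)])
  have W2: "is_complex trivial_grading (tensor_cplx ?C (dual_cplx ?C))"
    using X by (intro triv.is_complex_tensor triv.is_complex_dual)
  have U: "is_complex trivial_grading (unit_cplx :: bit cplx)" by (rule triv.is_complex_line)
  have ev: "chain_map trivial_grading (tensor_cplx ?C (dual_cplx ?C)) unit_cplx (vectorize (1\<^sub>m (rk (zpart X))))\<^sup>T"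
    using triv.chain_map_evaluation[OF X(3)] by (simp add: sign_mat_char2)
  have fg: "map_mat h_to_0 ?\<beta> * cmp ?W = (vectorize (g * cmp X)\<^sup>T)\<^sup>T"
  proof -
    have "map_mat h_to_0 ?\<beta> * cmp ?W = ((kron (cmp X)\<^sup>T g) * vectorize (1\<^sub>m (rk (hpart X))))\<^sup>T"
      using dims by (simp add: b g(2) transpose_mult_dim transpose_kron)
    also have "\<dots> = (vectorize (g * cmp X)\<^sup>T)\<^sup>T"
      using dims by (simp add: kron_mult_vectorize transpose_mult_dim)
    finally show ?thesis .
  qed
  have fgc: "chain_map trivial_grading (tensor_cplx ?C (dual_cplx ?C)) unit_cplx (vectorize (g * cmp X)\<^sup>T)\<^sup>T"
  proof -
    have Wc: "cplx_mod2 (zpart ?W) = tensor_cplx ?C (dual_cplx ?C)"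
      using X by (simp add: mod2.base_change_tensor triv.is_complex_dual mod2.base_change_dual)
    have Wd: "cplx_h0 (hpart ?W) = tensor_cplx (cplx_h0 (hpart X)) (dual_cplx (cplx_h0 (hpart X)))"
      using X by (simp add: h0.base_change_tensor hgr.is_complex_dual h0.base_change_dual)
    have "chain_map trivial_grading (cplx_h0 (hpart ?W)) unit_cplx (map_mat h_to_0 ?\<beta>)"
      unfolding Wd b using triv.chain_map_evaluation[OF X(4)] by (simp add: sign_mat_char2)
    from triv.chain_map_mult[OF _ _ U this leo_triplesD(7)[OF W]] show ?thesis
      unfolding fg Wc using W2 leo_triplesD(4)[OF W] by blast
  qed
  have "chain_homotopic trivial_grading (tensor_cplx ?C (dual_cplx ?C)) unit_cplx
      (vectorize (1\<^sub>m (rk (zpart X))))\<^sup>T (vectorize (g * cmp X)\<^sup>T)\<^sup>T"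
    using evaluation_homotopic[OF X(3) gf] g'(2)
    by (intro triv.homotopic_sym[OF W2 U fgc ev]) simp
  moreover obtain q where q: "homotopy_equivalent laurent_grading (cplx_hinv (hpart X)) (laurent_line q)"
    using X(8) by blast
  ultimately have "local_map ?W unit_leo ?\<alpha> ?\<beta>"
    unfolding local_map_iff[OF W unit_leo_triples]
    using triv.chain_map_evaluation[OF X(1)] hgr.chain_map_evaluation[OF X(2)] evaluation_not_null[OF X(5) q]
    unfolding fg a c
    by (simp add: mod2.base_change_tensor[OF X(1) triv.is_complex_dual[OF X(1)]] mod2.base_change_dual[OF X(1)]
       hinv.base_change_tensor[OF X(2) hgr.is_complex_dual[OF X(2)]] hinv.base_change_dual[OF X(2)]
       base_change_line[unfolded One_nat_def, of mod2, OF mod2_zero]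
       base_change_line[unfolded One_nat_def, of h_to_0, OF h_to_0_zero]
       base_change_line[unfolded One_nat_def, of to_laurent, OF to_laurent_zero])
  then show ?thesis by (auto simp: has_local_map_def)
qed

section \<open>The group of local equivalence classes\<close>

lemma equiv_local_equiv: "equiv leo_triples local_equiv"
proof (rule equivI)
  show "local_equiv \<subseteq> leo_triples \<times> leo_triples" by (auto simp: local_equiv_def)
  show "refl_on leo_triples local_equiv"
    by (auto simp: refl_on_def local_equiv_def has_local_map_refl)
  show "sym local_equiv" by (auto simp: sym_def local_equiv_def)
  show "trans local_equiv"
    unfolding trans_def local_equiv_def by (blast intro: has_local_map_trans)
qed

lemma carrier_leo_group: "carrier leo_group = leo_class ` leo_triples"
  by (auto simp: leo_group_def quotient_def leo_class_def)

lemma leo_class_eq_iff: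
  assumes "X \<in> leo_triples" "Y \<in> leo_triples"
  shows "leo_class X = leo_class Y \<longleftrightarrow> has_local_map X Y \<and> has_local_map Y X"
  unfolding leo_class_def using eq_equiv_class_iff[OF equiv_local_equiv assms] assms
  by (auto simp: local_equiv_def)

lemma mem_leo_class_iff:
  assumes "X \<in> leo_triples"
  shows "Y \<in> leo_class X \<longleftrightarrow> Y \<in> leo_triples \<and> has_local_map X Y \<and> has_local_map Y X"
  using assms by (auto simp: leo_class_def local_equiv_def)

text \<open>
  Any two representatives of the factors have locally equivalent products, so the union in the
  definition of the multiplication is over a single class.
\<close>

lemma leo_group_mult:
  assumes "X \<in> leo_triples" "Y \<in> leo_triples"
  shows "leo_class X \<otimes>\<^bsub>leo_group\<^esub> leo_class Y = leo_class (tensor_leo X Y)"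
proof -
  have *: "leo_class (tensor_leo X' Y') = leo_class (tensor_leo X Y)"
    if "X' \<in> leo_class X" "Y' \<in> leo_class Y" for X' Y'
    using that assms
    by (auto simp: mem_leo_class_iff leo_class_eq_iff tensor_leo_triples intro: tensor_local_map)
  have ne: "X \<in> leo_class X" "Y \<in> leo_class Y"
    using assms by (auto simp: mem_leo_class_iff has_local_map_refl)
  have "(\<Union>X'\<in>leo_class X. \<Union>Y'\<in>leo_class Y. leo_class (tensor_leo X' Y')) =
      (\<Union>X'\<in>leo_class X. \<Union>Y'\<in>leo_class Y. leo_class (tensor_leo X Y))"
    by (intro SUP_cong refl *)
  also have "\<dots> = leo_class (tensor_leo X Y)" using ne by blast
  finally show ?thesis by (simp add: leo_group_def)
qed

lemma leo_order_iff:
  assumes "X \<in> leo_triples" "Y \<in> leo_triples"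
  shows "(leo_class X, leo_class Y) \<in> leo_order \<longleftrightarrow> has_local_map X Y"
proof
  assume "(leo_class X, leo_class Y) \<in> leo_order"
  then obtain X' Y' where "X' \<in> leo_class X" "Y' \<in> leo_class Y" "has_local_map X' Y'"
    by (auto simp: leo_order_def)
  then show "has_local_map X Y"
    using assms by (meson mem_leo_class_iff has_local_map_trans)
next
  assume "has_local_map X Y"
  moreover have "X \<in> leo_class X" "Y \<in> leo_class Y"
    using assms by (auto simp: mem_leo_class_iff has_local_map_refl)
  ultimately show "(leo_class X, leo_class Y) \<in> leo_order"
    using assms by (auto simp: leo_order_def carrier_leo_group)
qed

lemma one_leo_group: "\<one>\<^bsub>leo_group\<^esub> = leo_class unit_leo"
  by (simp add: leo_group_def)

text \<open>
  Evaluation is one of the two local maps; the other one is the identity of \<open>X\<close>, read as an element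
  of the endomorphism complex.
\<close>

lemma tensor_dual_leo_class:
  assumes "X \<in> leo_triples"
  shows "leo_class (tensor_leo X (dual_leo X)) = leo_class unit_leo"
  using assms has_local_map_evaluation[OF assms] has_local_map_iff_unit_hom[OF assms assms]
  by (simp add: leo_class_eq_iff tensor_leo_triples dual_leo_triples unit_leo_triples has_local_map_refl)

lemma comm_group_leo_group: "comm_group leo_group"
proof (rule comm_groupI)
  fix x y z assume "x \<in> carrier leo_group" "y \<in> carrier leo_group" "z \<in> carrier leo_group"
  then obtain X Y Z where X: "X \<in> leo_triples" "x = leo_class X" and Y: "Y \<in> leo_triples" "y = leo_class Y"
    and Z: "Z \<in> leo_triples" "z = leo_class Z" by (auto simp: carrier_leo_group)
  show "x \<otimes>\<^bsub>leo_group\<^esub> y \<in> carrier leo_group"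
    using X Y by (auto simp: leo_group_mult carrier_leo_group tensor_leo_triples)
  show "x \<otimes>\<^bsub>leo_group\<^esub> y \<otimes>\<^bsub>leo_group\<^esub> z = x \<otimes>\<^bsub>leo_group\<^esub> (y \<otimes>\<^bsub>leo_group\<^esub> z)"
    using X Y Z by (simp add: leo_group_mult tensor_leo_triples tensor_leo_assoc)
  show "x \<otimes>\<^bsub>leo_group\<^esub> y = y \<otimes>\<^bsub>leo_group\<^esub> x"
    using X Y by (simp add: leo_group_mult leo_class_eq_iff tensor_leo_triples tensor_leo_commute)
next
  show "\<one>\<^bsub>leo_group\<^esub> \<in> carrier leo_group"
    by (auto simp: one_leo_group carrier_leo_group unit_leo_triples)
  fix x assume "x \<in> carrier leo_group"
  then obtain X where X: "X \<in> leo_triples" "x = leo_class X" by (auto simp: carrier_leo_group)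
  show "\<one>\<^bsub>leo_group\<^esub> \<otimes>\<^bsub>leo_group\<^esub> x = x"
    using X by (simp add: one_leo_group leo_group_mult unit_leo_triples tensor_leo_unit)
  have "leo_class (dual_leo X) \<otimes>\<^bsub>leo_group\<^esub> x = leo_class (tensor_leo X (dual_leo X))"
    using X by (simp add: leo_group_mult dual_leo_triples leo_class_eq_iff tensor_leo_triples tensor_leo_commute)
  then show "\<exists>y\<in>carrier leo_group. y \<otimes>\<^bsub>leo_group\<^esub> x = \<one>\<^bsub>leo_group\<^esub>"
    using X by (auto simp: carrier_leo_group dual_leo_triples tensor_dual_leo_class one_leo_group intro!: bexI[of _ "dual_leo X"])
qed

lemma translation_invariant_leo_order: "translation_invariant leo_group leo_order"
  unfolding translation_invariant_def carrier_leo_group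
  by (auto simp: leo_group_mult leo_order_iff tensor_leo_triples intro: tensor_local_map has_local_map_refl)

section \<open>Linear algebra\<close>

text \<open>
  Eliminate one coordinate at a time.  If some \<open>s\<close> in \<open>S\<close> has a nonzero coordinate at \<open>a\<close>, then
  subtracting multiples of \<open>s\<close> moves every vector into the hyperplane where this coordinate vanishes,
  and a functional on the hyperplane is extended so that it vanishes at \<open>s\<close>.
\<close>

lemma separating_functional:
  fixes z :: "'i \<Rightarrow> 'k::field"
  assumes "finite A"
    and "\<And>s i. s \<in> S \<Longrightarrow> i \<notin> A \<Longrightarrow> s i = 0" "\<And>i. i \<notin> A \<Longrightarrow> z i = 0"
    and "(\<lambda>_. 0) \<in> S" "\<And>s t c. s \<in> S \<Longrightarrow> t \<in> S \<Longrightarrow> (\<lambda>i. s i + c * t i) \<in> S"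
    and "z \<notin> S"
  shows "\<exists>l. (\<forall>s\<in>S. (\<Sum>i\<in>A. l i * s i) = 0) \<and> (\<Sum>i\<in>A. l i * z i) \<noteq> 0"
  using assms
proof (induction A arbitrary: S z rule: finite_induct)
  case empty
  then have "z = (\<lambda>_. 0)" by auto
  then show ?case using empty by auto
next
  case (insert a A)
  show ?case
  proof (cases "\<exists>s\<in>S. s a \<noteq> 0")
    case True
    then obtain s where s: "s \<in> S" "s a \<noteq> 0" by blast
    define p where "p v = (\<lambda>i. v i + (- v a / s a) * s i)" for v :: "'i \<Rightarrow> 'k"
    define S' where "S' = {v \<in> S. v a = 0}"
    have pa: "p v a = 0" for v using s(2) by (simp add: p_def)
    have "p z \<notin> S"
    proof
      assume "p z \<in> S"
      from insert.prems(4)[OF this s(1), of "z a / s a"] have "z \<in> S" by (simp add: p_def)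
      then show False using insert.prems(5) by simp
    qed
    have "\<exists>l. (\<forall>s\<in>S'. (\<Sum>i\<in>A. l i * s i) = 0) \<and> (\<Sum>i\<in>A. l i * p z i) \<noteq> 0"
    proof (rule insert.IH)
      show "v i = 0" if "v \<in> S'" "i \<notin> A" for v i
        using that insert.prems(1)[of v i] by (cases "i = a") (simp_all add: S'_def)
      show "(\<lambda>i. v i + c * w i) \<in> S'" if "v \<in> S'" "w \<in> S'" for v w c
        using that insert.prems(4)[of v w c] by (simp add: S'_def)
      show "p z \<notin> S'" using \<open>p z \<notin> S\<close> by (simp add: S'_def)
      show "p z i = 0" if "i \<notin> A" for i
      proof (cases "i = a")
        case False
        then show ?thesis using that insert.prems(1)[OF s(1), of i] insert.prems(2)[of i] by (simp add: p_def)
      qed (simp add: pa)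
    qed (use insert.prems(3) in \<open>simp add: S'_def\<close>)
    then obtain l where l: "\<And>v. v \<in> S' \<Longrightarrow> (\<Sum>i\<in>A. l i * v i) = 0" "(\<Sum>i\<in>A. l i * p z i) \<noteq> 0" by blast
    define m where "m = l(a := - (\<Sum>i\<in>A. l i * s i) / s a)"
    have m: "(\<Sum>i\<in>insert a A. m i * v i) = (\<Sum>i\<in>A. l i * p v i)" for v
    proof -
      have "(\<Sum>i\<in>A. m i * v i) = (\<Sum>i\<in>A. l i * v i)"
        using insert.hyps by (intro sum.cong) (auto simp: m_def)
      then have "(\<Sum>i\<in>insert a A. m i * v i) = (\<Sum>i\<in>A. l i * v i) + (- v a / s a) * (\<Sum>i\<in>A. l i * s i)"
        using insert.hyps by (simp add: m_def)
      also have "\<dots> = (\<Sum>i\<in>A. l i * p v i)"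
        unfolding sum_distrib_left sum.distrib[symmetric] by (intro sum.cong) (simp_all add: p_def algebra_simps)
      finally show ?thesis .
    qed
    have "(\<Sum>i\<in>A. l i * p v i) = 0" if "v \<in> S" for v
    proof (rule l(1))
      have "p v \<in> S" unfolding p_def by (rule insert.prems(4)[OF that s(1)])
      then show "p v \<in> S'" by (simp add: S'_def pa)
    qed
    then show ?thesis using l(2) by (intro exI[of _ m]) (simp add: m del: sum.insert)
  next
    case False
    then have S0: "s a = 0" if "s \<in> S" for s using that by auto
    show ?thesis
    proof (cases "z a = 0")
      case True
      have "\<exists>l. (\<forall>s\<in>S. (\<Sum>i\<in>A. l i * s i) = 0) \<and> (\<Sum>i\<in>A. l i * z i) \<noteq> 0"
      proof (rule insert.IH)
        show "v i = 0" if "v \<in> S" "i \<notin> A" for v i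
          using that insert.prems(1)[of v i] S0 by (cases "i = a") simp_all
        show "z i = 0" if "i \<notin> A" for i
          using that insert.prems(2)[of i] True by (cases "i = a") simp_all
      qed (use insert.prems in simp_all)
      then obtain l where "\<forall>s\<in>S. (\<Sum>i\<in>A. l i * s i) = 0" "(\<Sum>i\<in>A. l i * z i) \<noteq> 0" by blast
      then show ?thesis using S0 True insert.hyps by (intro exI[of _ l]) simp
    next
      case False
      have "(\<Sum>i\<in>insert a A. (if i = a then 1 else 0) * v i) = v a" for v :: "'i \<Rightarrow> 'k"
      proof -
        have "(\<Sum>i\<in>A. (if i = a then 1 else 0) * v i) = 0"
          using insert.hyps by (intro sum.neutral) auto
        then show ?thesis using insert.hyps by simp
      qed
      then show ?thesis using S0 False by (intro exI[of _ "\<lambda>i. if i = a then 1 else 0"]) (simp del: sum.insert)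
    qed
  qed
qed

text \<open>
  As long as all coordinates are even, saturation allows dividing by two.
\<close>

lemma saturated_odd_coordinate:
  fixes v :: "'i \<Rightarrow> int"
  assumes "finite A" "\<And>u i. u \<in> K \<Longrightarrow> i \<notin> A \<Longrightarrow> u i = 0"
    and sat: "\<And>u. (\<lambda>i. 2 * u i) \<in> K \<Longrightarrow> u \<in> K"
    and "v \<in> K" "v \<noteq> (\<lambda>_. 0)"
  shows "\<exists>k\<in>K. \<exists>i\<in>A. odd (k i)"
  using assms(4,5)
proof (induction "\<Sum>i\<in>A. nat \<bar>v i\<bar>" arbitrary: v rule: less_induct)
  case less
  show ?case
  proof (cases "\<exists>i\<in>A. odd (v i)")
    case False
    define u where "u = (\<lambda>i. v i div 2)"
    have vu: "v i = 2 * u i" for i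
      using False assms(2)[OF less.prems(1), of i] by (cases "i \<in> A") (auto simp: u_def)
    then have v: "v = (\<lambda>i. 2 * u i)" by auto
    have u: "u \<in> K" using less.prems(1) v sat by metis
    obtain j where j: "v j \<noteq> 0" using less.prems(2) by auto
    then have "j \<in> A" using assms(2)[OF less.prems(1)] by blast
    have "(\<Sum>i\<in>A. nat \<bar>u i\<bar>) < (\<Sum>i\<in>A. nat \<bar>v i\<bar>)"
      using assms(1) \<open>j \<in> A\<close> j by (intro sum_strict_mono_ex1) (auto simp: vu intro!: bexI[of _ j])
    moreover have "u \<noteq> (\<lambda>_. 0)" using j vu by auto
    ultimately show ?thesis using less.hyps u by blast
  qed (use less.prems in blast)
qed

text \<open>
  A functional modulo two that vanishes on \<open>K\<close> lifts to an integral functional vanishing on \<open>K\<close>,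
  provided that \<open>K\<close> is closed under division by two.  Take \<open>k\<close> in \<open>K\<close> with odd \<open>j\<close>-th coordinate.
  The map \<open>u \<mapsto> k\<^sub>j u - u\<^sub>j k\<close> preserves \<open>K\<close> and removes the coordinate \<open>j\<close>, so a lift on the remaining
  coordinates can be pulled back along it; because \<open>k\<^sub>j\<close> is odd, this does not change the reduction
  modulo two.
\<close>

lemma integral_lift_of_annihilator:
  fixes \<phi> :: "'i \<Rightarrow> bit" and K :: "('i \<Rightarrow> int) set"
  assumes "finite A"
    and "\<And>u i. u \<in> K \<Longrightarrow> i \<notin> A \<Longrightarrow> u i = 0"
    and "\<And>u v a b. u \<in> K \<Longrightarrow> v \<in> K \<Longrightarrow> (\<lambda>i. a * u i - b * v i) \<in> K"
    and "\<And>u. (\<lambda>i. 2 * u i) \<in> K \<Longrightarrow> u \<in> K"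
    and "\<And>u. u \<in> K \<Longrightarrow> (\<Sum>i\<in>A. \<phi> i * mod2 (u i)) = 0"
  shows "\<exists>\<alpha>. (\<forall>i\<in>A. mod2 (\<alpha> i) = \<phi> i) \<and> (\<forall>u\<in>K. (\<Sum>i\<in>A. \<alpha> i * u i) = 0)"
  using assms
proof (induction A arbitrary: K rule: finite_psubset_induct)
  case (psubset A)
  show ?case
  proof (cases "\<exists>k\<in>K. k \<noteq> (\<lambda>_. 0)")
    case False
    define \<alpha> where "\<alpha> i = (if \<phi> i = 0 then 0 else 1 :: int)" for i
    have "mod2 (\<alpha> i) = \<phi> i" for i by (auto simp: \<alpha>_def mod2_def)
    moreover have "(\<Sum>i\<in>A. \<alpha> i * u i) = 0" if "u \<in> K" for u
    proof -
      have "u = (\<lambda>_. 0)" using that False by blast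
      then show ?thesis by simp
    qed
    ultimately show ?thesis by blast
  next
    case True
    then obtain v where v: "v \<in> K" "v \<noteq> (\<lambda>_. 0)" by blast
    have "\<exists>k\<in>K. \<exists>i\<in>A. odd (k i)"
      by (rule saturated_odd_coordinate[where K = K, OF psubset.hyps(1) _ _ v]) (use psubset.prems in blast)+
    then obtain k j where k: "k \<in> K" "j \<in> A" "odd (k j)" by blast
    define K' where "K' = {v \<in> K. v j = 0}"
    let ?B = "A - {j}"
    have B: "finite ?B" "j \<notin> ?B" "A = insert j ?B" using psubset.hyps(1) k(2) by auto
    have sumA: "sum f A = f j + sum f ?B" for f :: "'i \<Rightarrow> 'b::comm_monoid_add"
      using B k(2) psubset.hyps(1) by (simp add: sum.remove)
    have "\<exists>\<alpha>. (\<forall>i\<in>?B. mod2 (\<alpha> i) = \<phi> i) \<and> (\<forall>u\<in>K'. (\<Sum>i\<in>?B. \<alpha> i * u i) = 0)"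
    proof (rule psubset.IH)
      show "?B \<subset> A" using k(2) by auto
      show "u i = 0" if "u \<in> K'" "i \<notin> ?B" for u i
        using that psubset.prems(1)[of u i] by (cases "i = j") (auto simp: K'_def)
      show "(\<lambda>i. a * u i - b * v i) \<in> K'" if "u \<in> K'" "v \<in> K'" for u v a b
        using that psubset.prems(2)[of u v a b] by (simp add: K'_def)
      show "u \<in> K'" if "(\<lambda>i. 2 * u i) \<in> K'" for u
        using that psubset.prems(3)[of u] by (simp add: K'_def)
      show "(\<Sum>i\<in>?B. \<phi> i * mod2 (u i)) = 0" if "u \<in> K'" for u
        using that psubset.prems(4)[of u] by (simp add: K'_def sumA mod2_def)
    qed
    then obtain \<alpha>' where \<alpha>': "\<And>i. i \<in> ?B \<Longrightarrow> mod2 (\<alpha>' i) = \<phi> i"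
      "\<And>u. u \<in> K' \<Longrightarrow> (\<Sum>i\<in>?B. \<alpha>' i * u i) = 0" by blast
    \<comment> \<open>the pullback of \<open>\<alpha>'\<close> along \<open>u \<mapsto> k j * u - u j * k\<close>, in coordinates\<close>
    define \<alpha> where "\<alpha> i = (if i = j then - (\<Sum>i\<in>?B. \<alpha>' i * k i) else k j * \<alpha>' i)" for i
    have kj: "mod2 (k j) = 1" using k(3) by (auto simp: mod2_def elim!: oddE)
    have \<alpha>B: "sum (\<lambda>i. g (\<alpha> i) (h i)) ?B = sum (\<lambda>i. g (k j * \<alpha>' i) (h i)) ?B"
      for g :: "int \<Rightarrow> int \<Rightarrow> int" and h
      by (intro sum.cong) (auto simp: \<alpha>_def)
    have "(\<Sum>i\<in>A. \<alpha> i * u i) = 0" if u: "u \<in> K" for u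
    proof -
      have "(\<lambda>i. k j * u i - u j * k i) \<in> K'"
        using psubset.prems(2)[OF u k(1)] by (simp add: K'_def)
      from \<alpha>'(2)[OF this] have "(\<Sum>i\<in>?B. \<alpha>' i * (k j * u i - u j * k i)) = 0" .
      moreover have "(\<Sum>i\<in>?B. \<alpha>' i * (k j * u i - u j * k i)) = (\<Sum>i\<in>?B. k j * \<alpha>' i * u i) - (\<Sum>i\<in>?B. \<alpha>' i * k i) * u j"
        unfolding sum_distrib_right sum_subtractf[symmetric] by (intro sum.cong) (simp_all add: algebra_simps)
      ultimately show ?thesis
        using \<alpha>B[of "(*)" u] by (simp add: sumA) (simp add: \<alpha>_def)
    qed
    moreover have "mod2 (\<alpha> i) = \<phi> i" if "i \<in> A" for i
    proof (cases "i = j")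
      case True
      have "mod2 (\<Sum>i\<in>?B. \<alpha>' i * k i) = (\<Sum>i\<in>?B. \<phi> i * mod2 (k i))"
        unfolding mod2.hom_sum by (intro sum.cong) (simp_all add: mod2.hom_mult \<alpha>')
      moreover have "\<phi> j + (\<Sum>i\<in>?B. \<phi> i * mod2 (k i)) = 0"
        using psubset.prems(4)[OF k(1)] unfolding sumA kj by (simp only: mult_1_right)
      ultimately have "\<phi> j = - mod2 (\<Sum>i\<in>?B. \<alpha>' i * k i)"
        by (simp only: eq_neg_iff_add_eq_0)
      moreover have "\<alpha> i = - (\<Sum>i\<in>?B. \<alpha>' i * k i)" using True by (simp add: \<alpha>_def)
      ultimately show ?thesis by (simp only: True mod2.hom_uminus)
    next
      case False
      then show ?thesis using that \<alpha>'(1)[of i] kj by (simp add: \<alpha>_def mod2.hom_mult)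
    qed
    ultimately show ?thesis by blast
  qed
qed

section \<open>Cohomology classes as local maps from the unit\<close>

text \<open>
  An element of bidegree \<open>(i, q)\<close> is a homogeneous map of that bidegree from the unit complex.
  Writing elements as columns makes the results on maps available for elements.
\<close>

definition col_mat :: "'a vec \<Rightarrow> 'a mat" where
  "col_mat v = mat (dim_vec v) 1 (\<lambda>(i, _). v $ i)"

lemma dim_col_mat [simp]: "dim_row (col_mat v) = dim_vec v" "dim_col (col_mat v) = 1"
  by (simp_all add: col_mat_def)

lemma col_mat_index [simp]: "i < dim_vec v \<Longrightarrow> col_mat v $$ (i, 0) = v $ i"
  by (simp add: col_mat_def)

lemma mult_vec_index:
  assumes "i < dim_row A" "dim_col A = dim_vec v"
  shows "(A *\<^sub>v v) $ i = (\<Sum>k<dim_vec v. A $$ (i, k) * v $ k)"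
  using assms by (simp add: scalar_prod_def atLeast0LessThan)

lemma mult_col_mat:
  assumes "dim_col A = dim_vec v"
  shows "A * col_mat v = col_mat (A *\<^sub>v v)"
proof (rule eq_matI)
  fix i j assume "i < dim_row (col_mat (A *\<^sub>v v))" "j < dim_col (col_mat (A *\<^sub>v v))"
  then show "(A * col_mat v) $$ (i, j) = col_mat (A *\<^sub>v v) $$ (i, j)"
    using assms by (simp add: mat_mult_index mult_vec_index del: index_mult_mat(1) index_mult_mat_vec)
qed auto

lemma col_mat_surj:
  assumes "dim_col M = 1"
  obtains v where "M = col_mat v" "dim_vec v = dim_row M"
proof
  show "M = col_mat (vec (dim_row M) (\<lambda>i. M $$ (i, 0)))"
    using assms by (intro eq_matI) (auto simp: col_mat_def)
qed simp

lemma col_mat_inject: "col_mat v = col_mat w \<longleftrightarrow> v = w"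
proof
  assume eq: "col_mat v = col_mat w"
  then have d: "dim_vec v = dim_vec w" by (metis dim_col_mat(1))
  show "v = w"
  proof (rule eq_vecI)
    fix i assume "i < dim_vec w"
    then show "v $ i = w $ i" using eq d by (metis col_mat_index)
  qed (use d in simp)
qed simp

lemma col_mat_add: "dim_vec v = dim_vec w \<Longrightarrow> col_mat (v + w) = col_mat v + col_mat w"
  by (intro eq_matI) auto

lemma col_mat_minus: "dim_vec v = dim_vec w \<Longrightarrow> col_mat (v - w) = col_mat v - col_mat w"
  by (intro eq_matI) auto

lemma map_col_mat: "map_mat f (col_mat v) = col_mat (map_vec f v)"
  by (intro eq_matI) auto

context graded_ring
begin

lemma bigraded_part_iff:
  "v \<in> bigraded_part R C i q \<longleftrightarrow> dim_vec v = rk C \<and>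
    (\<forall>j<rk C. (v $ j \<noteq> 0 \<longrightarrow> hdeg C j = i) \<and> v $ j \<in> R (q - qdeg C j))"
  unfolding bigraded_part_def carrier_vec_def by auto

lemma homog_col_mat:
  assumes "dim_vec v = rk C"
  shows "homog_map R i q unit_cplx C (col_mat v) \<longleftrightarrow> v \<in> bigraded_part R C i q"
  unfolding homog_map_iff bigraded_part_iff using assms by (simp add: col_mat_def)

lemma bigraded_part_dim: "v \<in> bigraded_part R C i q \<Longrightarrow> dim_vec v = rk C"
  by (simp add: bigraded_part_iff)

lemma bigraded_part_zero: "0\<^sub>v (rk C) \<in> bigraded_part R C i q"
  by (simp add: bigraded_part_iff)

lemma bigraded_part_add:
  assumes "v \<in> bigraded_part R C i q" "w \<in> bigraded_part R C i q"
  shows "v + w \<in> bigraded_part R C i q"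
proof -
  note d = bigraded_part_dim[OF assms(1)] bigraded_part_dim[OF assms(2)]
  have "homog_map R i q unit_cplx C (col_mat v + col_mat w)"
    using assms d by (intro homog_add) (simp_all add: homog_col_mat[unfolded One_nat_def])
  then show ?thesis using d homog_col_mat[of "v + w"] by (simp add: col_mat_add)
qed

lemma bigraded_part_minus:
  assumes "v \<in> bigraded_part R C i q" "w \<in> bigraded_part R C i q"
  shows "v - w \<in> bigraded_part R C i q"
proof -
  note d = bigraded_part_dim[OF assms(1)] bigraded_part_dim[OF assms(2)]
  have "homog_map R i q unit_cplx C (col_mat v - col_mat w)"
    using assms d by (intro homog_minus) (simp_all add: homog_col_mat[unfolded One_nat_def])
  then show ?thesis using d homog_col_mat[of "v - w"] by (simp add: col_mat_minus)
qed

lemma bigraded_part_mult: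
  assumes "homog_map R a b C C' M" "v \<in> bigraded_part R C i q" "i' = i + a" "q' = q + b"
  shows "M *\<^sub>v v \<in> bigraded_part R C' i' q'"
proof -
  note d = bigraded_part_dim[OF assms(2)] homog_dim[OF assms(1)]
  have "homog_map R i' q' unit_cplx C' (M * col_mat v)"
    using assms d by (intro homog_mult[OF assms(1)]) (simp_all add: homog_col_mat[unfolded One_nat_def])
  then show ?thesis using d homog_col_mat[of "M *\<^sub>v v"] by (simp add: mult_col_mat)
qed

lemma mult_vec_add: "dim_col A = dim_vec v \<Longrightarrow> dim_vec w = dim_vec v \<Longrightarrow> A *\<^sub>v (v + w) = A *\<^sub>v v + A *\<^sub>v (w :: 'r vec)"
  by (intro mult_add_distrib_mat_vec[of A "dim_row A" "dim_vec v"]) (auto intro: carrier_vecI)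

lemma mult_vec_minus: "dim_col A = dim_vec v \<Longrightarrow> dim_vec w = dim_vec v \<Longrightarrow> A *\<^sub>v (v - w) = A *\<^sub>v v - A *\<^sub>v (w :: 'r vec)"
  by (intro mult_minus_distrib_mat_vec[of A "dim_row A" "dim_vec v"]) (auto intro: carrier_vecI)

lemma mult_vec_assoc: "dim_col A = dim_row B \<Longrightarrow> dim_col B = dim_vec v \<Longrightarrow> (A * B) *\<^sub>v v = A *\<^sub>v (B *\<^sub>v (v :: 'r vec))"
  by (intro assoc_mult_mat_vec[of A "dim_row A" "dim_row B" _ "dim_vec v"]) (auto intro: carrier_vecI)

lemma coboundaries_zero: "is_complex R C \<Longrightarrow> 0\<^sub>v (rk C) \<in> coboundaries R C i q"
  unfolding coboundaries_def
  by (rule image_eqI[OF _ bigraded_part_zero], rule eq_vecI)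
     (simp_all add: mult_vec_index complexD del: index_mult_mat_vec)

lemma coboundaries_add:
  assumes "is_complex R C" "v \<in> coboundaries R C i q" "w \<in> coboundaries R C i q"
  shows "v + w \<in> coboundaries R C i q"
proof -
  obtain a b where a: "v = diff C *\<^sub>v a" "a \<in> bigraded_part R C (i - 1) q" and b: "w = diff C *\<^sub>v b" "b \<in> bigraded_part R C (i - 1) q"
    using assms(2,3) by (auto simp: coboundaries_def)
  have "v + w = diff C *\<^sub>v (a + b)"
    using a b bigraded_part_dim[OF a(2)] bigraded_part_dim[OF b(2)] complexD[OF assms(1)] by (simp add: mult_vec_add)
  then show ?thesis using bigraded_part_add[OF a(2) b(2)] by (auto simp: coboundaries_def)
qed

lemma coboundaries_minus:
  assumes "is_complex R C" "v \<in> coboundaries R C i q" "w \<in> coboundaries R C i q"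
  shows "v - w \<in> coboundaries R C i q"
proof -
  obtain a b where a: "v = diff C *\<^sub>v a" "a \<in> bigraded_part R C (i - 1) q" and b: "w = diff C *\<^sub>v b" "b \<in> bigraded_part R C (i - 1) q"
    using assms(2,3) by (auto simp: coboundaries_def)
  have "v - w = diff C *\<^sub>v (a - b)"
    using a b bigraded_part_dim[OF a(2)] bigraded_part_dim[OF b(2)] complexD[OF assms(1)] by (simp add: mult_vec_minus)
  then show ?thesis using bigraded_part_minus[OF a(2) b(2)] by (auto simp: coboundaries_def)
qed

lemma coboundaries_dim: "is_complex R C \<Longrightarrow> v \<in> coboundaries R C i q \<Longrightarrow> dim_vec v = rk C"
  by (auto simp: coboundaries_def complexD)

lemma coh_class_eq_iff:
  assumes C: "is_complex R C" and d: "dim_vec v = rk C" "dim_vec w = rk C"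
  shows "coh_class R C i q v = coh_class R C i q w \<longleftrightarrow> v - w \<in> coboundaries R C i q"
proof
  assume eq: "coh_class R C i q v = coh_class R C i q w"
  have "v + 0\<^sub>v (rk C) \<in> coh_class R C i q v"
    unfolding coh_class_def by (rule imageI) (rule coboundaries_zero[OF C])
  moreover have "v + 0\<^sub>v (rk C) = v" using d(1) by (intro right_zero_vec carrier_vecI)
  ultimately have "v \<in> coh_class R C i q w" using eq by simp
  then obtain b where b: "b \<in> coboundaries R C i q" "v = w + b" by (auto simp: coh_class_def)
  then have "v - w = b" using d coboundaries_dim[OF C b(1)] by (intro eq_vecI) auto
  then show "v - w \<in> coboundaries R C i q" using b by simp
next
  assume vw: "v - w \<in> coboundaries R C i q"
  have e: "v + b = w + ((v - w) + b)" "w + b = v + (b - (v - w))" if "b \<in> coboundaries R C i q" for b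
    using d coboundaries_dim[OF C that] by (auto intro!: eq_vecI)
  show "coh_class R C i q v = coh_class R C i q w"
  proof
    show "coh_class R C i q v \<subseteq> coh_class R C i q w"
    proof
      fix x assume "x \<in> coh_class R C i q v"
      then obtain b where "b \<in> coboundaries R C i q" "x = v + b" by (auto simp: coh_class_def)
      then show "x \<in> coh_class R C i q w"
        using e(1) coboundaries_add[OF C vw] unfolding coh_class_def by blast
    qed
    show "coh_class R C i q w \<subseteq> coh_class R C i q v"
    proof
      fix x assume "x \<in> coh_class R C i q w"
      then obtain b where "b \<in> coboundaries R C i q" "x = w + b" by (auto simp: coh_class_def)
      then show "x \<in> coh_class R C i q v"
        using e(2) coboundaries_minus[OF C _ vw] unfolding coh_class_def by blast
    qed
  qed
qed

lemma chain_map_col_mat: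
  assumes "is_complex R C" "dim_vec v = rk C"
  shows "chain_map R unit_cplx C (col_mat v) \<longleftrightarrow> v \<in> cocycles R C 0 0"
proof -
  note D = complexD[OF assms(1)]
  have "col_mat v * diff unit_cplx = col_mat (0\<^sub>v (rk C))"
    using assms(2) by (intro eq_matI) (auto simp: scalar_prod_def)
  then have "col_mat v * diff unit_cplx = diff C * col_mat v \<longleftrightarrow> diff C *\<^sub>v v = 0\<^sub>v (rk C)"
    using assms(2) D by (auto simp: mult_col_mat col_mat_inject)
  then show ?thesis
    unfolding chain_map_def cocycles_def using homog_col_mat[OF assms(2)] by simp
qed

lemma homotopic_col_mat:
  assumes "is_complex R C" "dim_vec v = rk C" "dim_vec w = rk C"
  shows "chain_homotopic R unit_cplx C (col_mat v) (col_mat w) \<longleftrightarrow> v - w \<in> coboundaries R C 0 0"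
proof -
  note D = complexD[OF assms(1)]
  have key: "col_mat v - col_mat w = diff C * col_mat u + col_mat u * diff unit_cplx \<longleftrightarrow> v - w = diff C *\<^sub>v u"
    if "dim_vec u = rk C" for u
  proof -
    have "diff C * col_mat u + col_mat u * diff unit_cplx = col_mat (diff C *\<^sub>v u)"
      using that D by (subst mult_col_mat) (auto intro!: eq_matI)
    then show ?thesis using assms by (simp add: col_mat_minus[symmetric] col_mat_inject)
  qed
  show ?thesis
  proof
    assume "chain_homotopic R unit_cplx C (col_mat v) (col_mat w)"
    then obtain K where K: "homog_map R (-1) 0 unit_cplx C K" "dim_row K = rk C" "dim_col K = 1"
      "col_mat v - col_mat w = diff C * K + K * diff unit_cplx"
      by (rule homotopicE) simp
    obtain u where u: "K = col_mat u" "dim_vec u = rk C"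
      using col_mat_surj[OF K(3)] K(2) by metis
    then show "v - w \<in> coboundaries R C 0 0"
      using K key[OF u(2)] homog_col_mat[OF u(2)] by (auto simp: coboundaries_def)
  next
    assume "v - w \<in> coboundaries R C 0 0"
    then obtain u where u: "v - w = diff C *\<^sub>v u" "u \<in> bigraded_part R C (-1) 0"
      by (auto simp: coboundaries_def)
    note d = bigraded_part_dim[OF u(2)]
    then show "chain_homotopic R unit_cplx C (col_mat v) (col_mat w)"
      unfolding chain_homotopic_def using key[OF d] u homog_col_mat[OF d] by blast
  qed
qed

end

lemma coh_map_coh_class:
  assumes C: "graded_ring R" "is_complex R C" and C': "graded_ring R'" "is_complex R' C'"
    and d: "dim_vec v = rk C" "\<And>w. dim_vec w = rk C \<Longrightarrow> dim_vec (\<phi> w) = rk C'"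
    and \<phi>: "\<And>b. b \<in> coboundaries R C i q \<Longrightarrow> \<phi> (v + b) - \<phi> v \<in> coboundaries R' C' i q"
  shows "coh_map R' C' i q \<phi> (coh_class R C i q v) = coh_class R' C' i q (\<phi> v)"
proof -
  have "coh_class R' C' i q (\<phi> w) = coh_class R' C' i q (\<phi> v)" if "w \<in> coh_class R C i q v" for w
  proof -
    obtain b where b: "b \<in> coboundaries R C i q" "w = v + b" using \<open>w \<in> coh_class R C i q v\<close> by (auto simp: coh_class_def)
    then have "dim_vec w = rk C" using graded_ring.coboundaries_dim[OF C b(1)] d by simp
    then show ?thesis
      using graded_ring.coh_class_eq_iff[OF C' d(2) d(2)] d(1) \<phi>[OF b(1)] b(2) by blast
  qed
  moreover have "coh_class R C i q v \<noteq> {}"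
    using graded_ring.coboundaries_zero[OF C] by (auto simp: coh_class_def)
  ultimately show ?thesis unfolding coh_map_def by blast
qed

lemma (in graded_ring) mult_vec_coboundary:
  assumes "is_complex R C" "is_complex R C'" "chain_map R C C' F" "dim_vec v = rk C" "b \<in> coboundaries R C i q"
  shows "F *\<^sub>v (v + b) - F *\<^sub>v v \<in> coboundaries R C' i q"
proof -
  note D = complexD[OF assms(1)] complexD[OF assms(2)] chain_mapD[OF assms(3)]
  obtain a where a: "b = diff C *\<^sub>v a" "a \<in> bigraded_part R C (i - 1) q"
    using assms(5) by (auto simp: coboundaries_def)
  note d = bigraded_part_dim[OF a(2)]
  have "F *\<^sub>v (v + b) - F *\<^sub>v v = F *\<^sub>v b"
    using D assms(4) d a by (simp add: mult_vec_add) (intro eq_vecI; simp)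
  also have "\<dots> = (F * diff C) *\<^sub>v a"
    unfolding a(1) using D(1-11) d by (simp add: mult_vec_assoc)
  also have "\<dots> = diff C' *\<^sub>v (F *\<^sub>v a)"
    unfolding D(12) using D(1-11) d by (simp add: mult_vec_assoc)
  finally show ?thesis
    using bigraded_part_mult[OF D(9) a(2)] by (auto simp: coboundaries_def)
qed

context graded_ring_hom
begin

lemma map_vec_mult: "dim_col A = dim_vec v \<Longrightarrow> map_vec \<phi> (A *\<^sub>v v) = map_mat \<phi> A *\<^sub>v map_vec \<phi> v"
  by (intro mult_mat_vec_hom[of A "dim_row A" "dim_vec v"]) (auto intro: carrier_vecI)

lemma bigraded_part_base_change:
  "v \<in> bigraded_part R C i q \<Longrightarrow> map_vec \<phi> v \<in> bigraded_part S (base_change \<phi> C) i q"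
  unfolding S.bigraded_part_iff R.bigraded_part_iff by (auto intro: map_mem) (metis hom_zero)?

lemma coboundary_base_change:
  assumes "is_complex R C" "dim_vec v = rk C" "b \<in> coboundaries R C i q"
  shows "map_vec \<phi> (v + b) - map_vec \<phi> v \<in> coboundaries S (base_change \<phi> C) i q"
proof -
  obtain a where a: "b = diff C *\<^sub>v a" "a \<in> bigraded_part R C (i - 1) q"
    using assms(3) by (auto simp: coboundaries_def)
  have "map_vec \<phi> (v + b) - map_vec \<phi> v = map_vec \<phi> b"
    using assms(2) R.coboundaries_dim[OF assms(1,3)] by (intro eq_vecI) (auto simp: hom_add)
  also have "\<dots> = map_mat \<phi> (diff C) *\<^sub>v map_vec \<phi> a"
    unfolding a(1) using R.bigraded_part_dim[OF a(2)] R.complexD[OF assms(1)] by (simp add: map_vec_mult)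
  finally show ?thesis using bigraded_part_base_change[OF a(2)] by (auto simp: coboundaries_def)
qed

lemma coh_map_base_change:
  assumes "is_complex R C" "dim_vec v = rk C"
  shows "coh_map S (base_change \<phi> C) i q (map_vec \<phi>) (coh_class R C i q v) = coh_class S (base_change \<phi> C) i q (map_vec \<phi> v)"
  by (rule coh_map_coh_class)
     (use assms in \<open>auto intro: coboundary_base_change is_complex_base_change R.graded_ring_axioms S.graded_ring_axioms\<close>)

end

definition full_witness :: "leo \<Rightarrow> int \<Rightarrow> int vec \<Rightarrow> bit poly vec \<Rightarrow> bool" where
  "full_witness X q a b \<longleftrightarrow>
     a \<in> cocycles trivial_grading (zpart X) 0 q \<and> b \<in> cocycles h_grading (hpart X) 0 q \<and>
     cmp X *\<^sub>v map_vec mod2 a - map_vec h_to_0 b \<in> coboundaries trivial_grading (cplx_h0 (hpart X)) 0 q \<and>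
     map_vec to_laurent b \<notin> coboundaries laurent_grading (cplx_hinv (hpart X)) 0 q"

lemma oddly_reduced_full_iff:
  assumes "X \<in> leo_triples"
  shows "oddly_reduced_full X q \<longleftrightarrow> even q \<and> (\<exists>a b. full_witness X q a b)"
proof -
  note X = leo_triplesD[OF assms]
  have "coh_map trivial_grading (cplx_h0 (hpart X)) 0 q (\<lambda>v. cmp X *\<^sub>v v)
          (coh_map trivial_grading (cplx_mod2 (zpart X)) 0 q (map_vec mod2) (coh_class trivial_grading (zpart X) 0 q a))
        = coh_map trivial_grading (cplx_h0 (hpart X)) 0 q (map_vec h_to_0) (coh_class h_grading (hpart X) 0 q b) \<and>
        coh_map laurent_grading (cplx_hinv (hpart X)) 0 q (map_vec to_laurent) (coh_class h_grading (hpart X) 0 q b)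
        \<noteq> coh_class laurent_grading (cplx_hinv (hpart X)) 0 q (0\<^sub>v (rk (hpart X)))
     \<longleftrightarrow> full_witness X q a b"
    if a: "a \<in> cocycles trivial_grading (zpart X) 0 q" and b: "b \<in> cocycles h_grading (hpart X) 0 q" for a b
  proof -
    have da: "dim_vec a = rk (zpart X)" and db: "dim_vec b = rk (hpart X)"
      using a b triv.bigraded_part_dim hgr.bigraded_part_dim by (auto simp: cocycles_def)
    note dims = triv.chain_mapD(2,3)[OF X(7)]
    have 1: "coh_map trivial_grading (cplx_mod2 (zpart X)) 0 q (map_vec mod2) (coh_class trivial_grading (zpart X) 0 q a)
      = coh_class trivial_grading (cplx_mod2 (zpart X)) 0 q (map_vec mod2 a)"
      by (rule mod2.coh_map_base_change[OF X(1) da])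
    have 2: "coh_map trivial_grading (cplx_h0 (hpart X)) 0 q (\<lambda>v. cmp X *\<^sub>v v) (coh_class trivial_grading (cplx_mod2 (zpart X)) 0 q (map_vec mod2 a))
      = coh_class trivial_grading (cplx_h0 (hpart X)) 0 q (cmp X *\<^sub>v map_vec mod2 a)"
      by (rule coh_map_coh_class[OF triv.graded_ring_axioms X(3) triv.graded_ring_axioms X(4)])
        (use da dims triv.mult_vec_coboundary[OF X(3,4,7)] in auto)
    have 3: "coh_map trivial_grading (cplx_h0 (hpart X)) 0 q (map_vec h_to_0) (coh_class h_grading (hpart X) 0 q b)
      = coh_class trivial_grading (cplx_h0 (hpart X)) 0 q (map_vec h_to_0 b)"
      by (rule h0.coh_map_base_change[OF X(2) db])
    have 4: "coh_map laurent_grading (cplx_hinv (hpart X)) 0 q (map_vec to_laurent) (coh_class h_grading (hpart X) 0 q b)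
      = coh_class laurent_grading (cplx_hinv (hpart X)) 0 q (map_vec to_laurent b)"
      by (rule hinv.coh_map_base_change[OF X(2) db])
    have 5: "map_vec to_laurent b - 0\<^sub>v (rk (hpart X)) = map_vec to_laurent b"
      using db by (intro eq_vecI) auto
    have "coh_class trivial_grading (cplx_h0 (hpart X)) 0 q (cmp X *\<^sub>v map_vec mod2 a)
        = coh_class trivial_grading (cplx_h0 (hpart X)) 0 q (map_vec h_to_0 b)
       \<longleftrightarrow> cmp X *\<^sub>v map_vec mod2 a - map_vec h_to_0 b \<in> coboundaries trivial_grading (cplx_h0 (hpart X)) 0 q"
      using dims db by (intro triv.coh_class_eq_iff[OF X(4)]) auto
    moreover have "coh_class laurent_grading (cplx_hinv (hpart X)) 0 q (map_vec to_laurent b)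
       = coh_class laurent_grading (cplx_hinv (hpart X)) 0 q (0\<^sub>v (rk (hpart X)))
       \<longleftrightarrow> map_vec to_laurent b \<in> coboundaries laurent_grading (cplx_hinv (hpart X)) 0 q"
      using db laur.coh_class_eq_iff[OF X(5), of "map_vec to_laurent b" "0\<^sub>v (rk (hpart X))" 0 q] unfolding 5 by simp
    ultimately show ?thesis
      unfolding 1 2 3 4 full_witness_def using a b by blast
  qed
  moreover have "\<exists>a b. full_witness X q a b \<Longrightarrow> \<exists>a\<in>cocycles trivial_grading (zpart X) 0 q. \<exists>b\<in>cocycles h_grading (hpart X) 0 q. full_witness X q a b"
    by (auto simp: full_witness_def)
  ultimately show ?thesis
    unfolding oddly_reduced_full_def cohomology_def bex_simps(7) by meson
qed

text \<open>
  The generators of the two unit complexes are sent to cocycles in bidegree zero.  The comparison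
  homotopy is a cochain bounding the difference of their reductions, and the localisation condition
  says that the second cocycle survives inverting \<open>h\<close>.
\<close>

lemma has_local_map_unit_iff:
  assumes "X \<in> leo_triples"
  shows "has_local_map unit_leo X \<longleftrightarrow> oddly_reduced_full X 0"
proof -
  note X = leo_triplesD[OF assms]
  note dims = triv.chain_mapD(2,3)[OF X(7)]
  have U: "cplx_mod2 (zpart unit_leo) = unit_cplx" "cplx_hinv (hpart unit_leo) = unit_cplx"
    unfolding unit_leo_sel by (rule base_change_line, simp add: mod2_zero, rule base_change_line, rule to_laurent_zero)
  have key: "local_map unit_leo X (col_mat a) (col_mat b) \<longleftrightarrow> full_witness X 0 a b"
    if d: "dim_vec a = rk (zpart X)" "dim_vec b = rk (hpart X)" for a b
  proof -
    have 1: "chain_homotopic trivial_grading (cplx_mod2 (zpart unit_leo)) (cplx_h0 (hpart X)) (cmp X * map_mat mod2 (col_mat a)) (map_mat h_to_0 (col_mat b) * cmp unit_leo)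
       \<longleftrightarrow> cmp X *\<^sub>v map_vec mod2 a - map_vec h_to_0 b \<in> coboundaries trivial_grading (cplx_h0 (hpart X)) 0 0"
      unfolding U using triv.homotopic_col_mat[OF X(4), of "cmp X *\<^sub>v map_vec mod2 a" "map_vec h_to_0 b"] d dims
      by (simp add: map_col_mat mult_col_mat)
    have z: "0\<^sub>m (rk (hpart X)) (rk (hpart unit_leo)) = col_mat (0\<^sub>v (rk (hpart X)))"
      by (intro eq_matI) (auto simp: col_mat_def)
    have "map_vec to_laurent b - 0\<^sub>v (rk (hpart X)) = map_vec to_laurent b"
      using d by (intro eq_vecI) auto
    then have 2: "chain_homotopic laurent_grading (cplx_hinv (hpart unit_leo)) (cplx_hinv (hpart X)) (map_mat to_laurent (col_mat b)) (0\<^sub>m (rk (hpart X)) (rk (hpart unit_leo)))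
       \<longleftrightarrow> map_vec to_laurent b \<in> coboundaries laurent_grading (cplx_hinv (hpart X)) 0 0"
      unfolding U z map_col_mat using laur.homotopic_col_mat[OF X(5), of "map_vec to_laurent b" "0\<^sub>v (rk (hpart X))"] d by simp
    show ?thesis
      unfolding local_map_iff[OF unit_leo_triples assms] 1 2 full_witness_def
      using triv.chain_map_col_mat[OF X(1) d(1)] hgr.chain_map_col_mat[OF X(2) d(2)] by auto
  qed
  show ?thesis
    unfolding oddly_reduced_full_iff[OF assms]
  proof safe
    assume "has_local_map unit_leo X"
    then obtain \<alpha> \<beta> where l: "local_map unit_leo X \<alpha> \<beta>" by (auto simp: has_local_map_def)
    then have ab: "chain_map trivial_grading (zpart unit_leo) (zpart X) \<alpha>" "chain_map h_grading (hpart unit_leo) (hpart X) \<beta>"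
      by (auto simp: local_map_def)
    have d: "dim_col \<alpha> = 1" "dim_row \<alpha> = rk (zpart X)" "dim_col \<beta> = 1" "dim_row \<beta> = rk (hpart X)"
      using triv.chain_mapD(2,3)[OF ab(1)] hgr.chain_mapD(2,3)[OF ab(2)] by auto
    obtain a where a: "\<alpha> = col_mat a" "dim_vec a = rk (zpart X)"
      using col_mat_surj[OF d(1)] d(2) by metis
    obtain b where b: "\<beta> = col_mat b" "dim_vec b = rk (hpart X)"
      using col_mat_surj[OF d(3)] d(4) by metis
    show "\<exists>a b. full_witness X 0 a b" using l key[OF a(2) b(2)] unfolding a(1) b(1) by blast
  next
    fix a b assume w: "full_witness X 0 a b"
    then have "dim_vec a = rk (zpart X)" "dim_vec b = rk (hpart X)"
      using triv.bigraded_part_dim hgr.bigraded_part_dim by (auto simp: full_witness_def cocycles_def)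
    then show "has_local_map unit_leo X" using key w by (auto simp: has_local_map_def)
  qed
qed

section \<open>Setting h to 1\<close>

lemma to_laurent_monom: "to_laurent (monom c k) = Poly_Mapping.single (int k) c"
  by (rule poly_mapping_eqI) (auto simp: lookup_to_laurent lookup_single when_def)

lemma to_laurent_inject: "to_laurent p = to_laurent q \<longleftrightarrow> p = q"
proof
  assume eq: "to_laurent p = to_laurent q"
  show "p = q"
  proof (rule poly_eqI)
    fix n
    show "coeff p n = coeff q n"
      using arg_cong[OF eq, of "\<lambda>f. Poly_Mapping.lookup f (int n)"] by (simp add: lookup_to_laurent)
  qed
qed simp

lemma h_homogeneous_monom:
  assumes "p \<in> h_grading r"
  shows "p = monom (poly p 1) (nat (- r div 2))" and "p \<noteq> 0 \<Longrightarrow> even r \<and> r \<le> 0"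
proof -
  have "p = monom (poly p 1) (nat (- r div 2)) \<and> (p \<noteq> 0 \<longrightarrow> even r \<and> r \<le> 0)"
  proof (cases "p = 0")
    case False
    then obtain n where "coeff p n \<noteq> 0" by (metis leading_coeff_0_iff)
    then have r: "r = - 2 * int n" using assms unfolding h_grading_def by blast
    have "p = monom (coeff p n) n"
      using assms r by (intro poly_eqI) (auto simp: h_grading_iff)
    moreover from this have "poly p 1 = coeff p n"
      by (metis mult.right_neutral poly_monom power_one)
    ultimately show ?thesis using r by simp
  qed simp
  then show "p = monom (poly p 1) (nat (- r div 2))" "p \<noteq> 0 \<Longrightarrow> even r \<and> r \<le> 0" by blast+
qed

lemma to_laurent_homogeneous:
  assumes "p \<in> h_grading r"
  shows "to_laurent p = Poly_Mapping.single (- r div 2) (poly p 1)"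
proof (cases "p = 0")
  case True
  then show ?thesis by (simp add: to_laurent_zero)
next
  case False
  then have "int (nat (- r div 2)) = - r div 2" using h_homogeneous_monom(2)[OF assms] by simp
  then show ?thesis using to_laurent_monom h_homogeneous_monom(1)[OF assms] by metis
qed

lemma laurent_homogeneous_lookup:
  assumes "x \<in> laurent_grading r"
  shows "x = Poly_Mapping.single (- r div 2) (Poly_Mapping.lookup x (- r div 2))"
    and "x \<noteq> 0 \<Longrightarrow> even r"
proof -
  have "x = Poly_Mapping.single (- r div 2) (Poly_Mapping.lookup x (- r div 2)) \<and> (x \<noteq> 0 \<longrightarrow> even r)"
  proof (cases "x = 0")
    case False
    then obtain n where n: "r = - 2 * n" "x = Poly_Mapping.single n 1"
      using assms laurent_homogeneous_single by blast
    then have "- r div 2 = n" by simp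
    then show ?thesis using n by simp
  qed simp
  then show "x = Poly_Mapping.single (- r div 2) (Poly_Mapping.lookup x (- r div 2))" "x \<noteq> 0 \<Longrightarrow> even r"
    by blast+
qed

lemma sum_single: "(\<Sum>j\<in>A. Poly_Mapping.single k (f j)) = Poly_Mapping.single k (sum f A)"
  by (induction A rule: infinite_finite_induct) (auto simp: single_add)

text \<open>
  With \<open>h\<close> set to one, \<open>D\<close> becomes a complex over the field with two elements, filtered by quantum
  degree.  The generators of even quantum degree span a direct summand, as no homogeneous entry of
  the differential connects generators whose quantum degrees differ in parity.
\<close>

definition even_chains :: "bit poly cplx \<Rightarrow> int \<Rightarrow> (nat \<Rightarrow> bit) set" where
  "even_chains D i = {u. \<forall>j. u j \<noteq> 0 \<longrightarrow> j < rk D \<and> hdeg D j = i \<and> even (qdeg D j)}"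

definition h1_diff :: "bit poly cplx \<Rightarrow> (nat \<Rightarrow> bit) \<Rightarrow> nat \<Rightarrow> bit" where
  "h1_diff D u i = (if i < rk D then \<Sum>j<rk D. poly (diff D $$ (i, j)) 1 * u j else 0)"

text \<open>
  For even \<open>q\<close> and an even chain \<open>u\<close>, the element of quantum degree \<open>q\<close> of the localised complex that
  specialises to \<open>u\<close> at \<open>h = 1\<close>.
\<close>

definition laurent_vec :: "bit poly cplx \<Rightarrow> int \<Rightarrow> (nat \<Rightarrow> bit) \<Rightarrow> (int \<Rightarrow>\<^sub>0 bit) vec" where
  "laurent_vec D q u = vec (rk D) (\<lambda>j. Poly_Mapping.single ((qdeg D j - q) div 2) (u j))"

text \<open>
  The same element before localisation; it is meaningful for \<open>u\<close> of filtration level at least \<open>q\<close>,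
  when all exponents of \<open>h\<close> are nonnegative.
\<close>

definition h_vec :: "bit poly cplx \<Rightarrow> int \<Rightarrow> (nat \<Rightarrow> bit) \<Rightarrow> bit poly vec" where
  "h_vec D q u = vec (rk D) (\<lambda>j. monom (u j) (nat ((qdeg D j - q) div 2)))"

lemma dim_laurent_vec [simp]: "dim_vec (laurent_vec D q u) = rk D"
  by (simp add: laurent_vec_def)

lemma dim_h_vec [simp]: "dim_vec (h_vec D q u) = rk D"
  by (simp add: h_vec_def)

lemma even_chainsD:
  assumes "u \<in> even_chains D i" "u j \<noteq> 0"
  shows "j < rk D" "hdeg D j = i" "even (qdeg D j)"
  using assms unfolding even_chains_def by blast+

lemma even_chains_zero: "(\<lambda>_. 0) \<in> even_chains D i"
  by (simp add: even_chains_def)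

lemma even_chains_add:
  assumes "u \<in> even_chains D i" "v \<in> even_chains D i"
  shows "(\<lambda>j. u j + c * v j) \<in> even_chains D i"
  unfolding even_chains_def
proof (intro CollectI allI impI)
  fix j assume "u j + c * v j \<noteq> 0"
  then have "u j \<noteq> 0 \<or> v j \<noteq> 0" by (metis add_0_right mult_zero_right)
  then show "j < rk D \<and> hdeg D j = i \<and> even (qdeg D j)"
    using assms even_chainsD by blast
qed

lemma h1_diff_add: "h1_diff D (\<lambda>j. u j + c * v j) = (\<lambda>i. h1_diff D u i + c * h1_diff D v i)"
proof
  fix i
  show "h1_diff D (\<lambda>j. u j + c * v j) i = h1_diff D u i + c * h1_diff D v i"
  proof (cases "i < rk D")
    case True
    have "(\<Sum>j<rk D. poly (diff D $$ (i, j)) 1 * (u j + c * v j)) =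
      (\<Sum>j<rk D. poly (diff D $$ (i, j)) 1 * u j) + c * (\<Sum>j<rk D. poly (diff D $$ (i, j)) 1 * v j)"
      unfolding sum_distrib_left sum.distrib[symmetric]
      by (intro sum.cong refl) (simp only: distrib_left mult.left_commute)
    then show ?thesis unfolding h1_diff_def using True by (simp only: if_True)
  qed (simp only: h1_diff_def if_False mult_zero_right add_0_right)
qed

lemma h1_diff_zero: "h1_diff D (\<lambda>_. 0) = (\<lambda>_. 0)"
  by (rule ext) (simp add: h1_diff_def)

lemma diff_h_entry:
  assumes "is_complex h_grading D" "i < rk D" "j < rk D"
  shows "diff D $$ (i, j) \<in> h_grading (qdeg D j - qdeg D i)"
    and "poly (diff D $$ (i, j)) 1 \<noteq> 0 \<Longrightarrow> hdeg D i = hdeg D j + 1 \<and> even (qdeg D j - qdeg D i)"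
proof -
  show 1: "diff D $$ (i, j) \<in> h_grading (qdeg D j - qdeg D i)"
    using hgr.complexD(1)[OF assms(1)] assms by (simp add: hgr.homog_map_iff)
  assume "poly (diff D $$ (i, j)) 1 \<noteq> 0"
  then have "diff D $$ (i, j) \<noteq> 0" by (metis poly_0)
  then show "hdeg D i = hdeg D j + 1 \<and> even (qdeg D j - qdeg D i)"
    using hgr.complexD(1)[OF assms(1)] assms(2,3) h_homogeneous_monom(2)[OF 1] unfolding hgr.homog_map_iff by blast
qed

lemma h1_diff_even_chains:
  assumes "is_complex h_grading D" "u \<in> even_chains D i" "i' = i + 1"
  shows "h1_diff D u \<in> even_chains D i'"
  unfolding even_chains_def
proof (intro CollectI allI impI)
  fix k assume k: "h1_diff D u k \<noteq> 0"
  then have kD: "k < rk D" by (metis h1_diff_def)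
  then have "(\<Sum>j<rk D. poly (diff D $$ (k, j)) 1 * u j) \<noteq> 0" using k by (metis h1_diff_def)
  then obtain j where j: "j < rk D" "poly (diff D $$ (k, j)) 1 * u j \<noteq> 0"
    by (meson lessThan_iff sum.neutral)
  then have nz: "poly (diff D $$ (k, j)) 1 \<noteq> 0" "u j \<noteq> 0" by (metis mult_zero_left, metis mult_zero_right)
  show "k < rk D \<and> hdeg D k = i' \<and> even (qdeg D k)"
    using diff_h_entry(2)[OF assms(1) kD j(1) nz(1)] even_chainsD[OF assms(2) nz(2)] kD assms(3) by simp
qed

lemma single_mem_laurent_grading:
  assumes "c \<noteq> 0 \<Longrightarrow> r = - 2 * k"
  shows "Poly_Mapping.single k c \<in> laurent_grading r"
  using assms by (cases "c = 0") (auto simp: laurent_grading_iff lookup_single when_def)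

lemma laurent_vec_bigraded:
  assumes "even q" "u \<in> even_chains D i"
  shows "laurent_vec D q u \<in> bigraded_part laurent_grading (cplx_hinv D) i q"
  unfolding laur.bigraded_part_iff
proof (intro conjI allI impI)
  fix j assume j: "j < rk (cplx_hinv D)"
  have e: "laurent_vec D q u $ j = Poly_Mapping.single ((qdeg D j - q) div 2) (u j)"
    using j by (simp add: laurent_vec_def)
  show "hdeg (cplx_hinv D) j = i" if "laurent_vec D q u $ j \<noteq> 0"
  proof -
    have "u j \<noteq> 0" using that unfolding e by (metis single_zero)
    then show ?thesis using even_chainsD[OF assms(2)] by simp
  qed
  show "laurent_vec D q u $ j \<in> laurent_grading (q - qdeg (cplx_hinv D) j)"
    unfolding e
  proof (rule single_mem_laurent_grading)
    assume "u j \<noteq> 0"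
    then have "even (qdeg D j)" by (rule even_chainsD(3)[OF assms(2)])
    then show "q - qdeg (cplx_hinv D) j = - 2 * ((qdeg D j - q) div 2)" using assms(1) by simp
  qed
qed simp

lemma bigraded_laurent_vec:
  assumes "even q" "w \<in> bigraded_part laurent_grading (cplx_hinv D) i q"
  obtains u where "u \<in> even_chains D i" "w = laurent_vec D q u"
proof
  define u where "u j = (if j < rk D then Poly_Mapping.lookup (w $ j) ((qdeg D j - q) div 2) else 0)" for j
  have w: "dim_vec w = rk D" "\<And>j. j < rk D \<Longrightarrow> w $ j \<noteq> 0 \<Longrightarrow> hdeg D j = i"
    "\<And>j. j < rk D \<Longrightarrow> w $ j \<in> laurent_grading (q - qdeg D j)"
    using assms(2) by (auto simp: laur.bigraded_part_iff)
  show "u \<in> even_chains D i"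
    unfolding even_chains_def
  proof (intro CollectI allI impI)
    fix j assume "u j \<noteq> 0"
    then have j: "j < rk D" "w $ j \<noteq> 0" unfolding u_def by (metis, metis lookup_zero)
    then show "j < rk D \<and> hdeg D j = i \<and> even (qdeg D j)"
      using w(2) laurent_homogeneous_lookup(2)[OF w(3)] assms(1) by auto
  qed
  show "w = laurent_vec D q u"
  proof (rule eq_vecI)
    fix j assume "j < dim_vec (laurent_vec D q u)"
    then have j: "j < rk D" by simp
    have e: "- (q - qdeg D j) = qdeg D j - q" by simp
    show "w $ j = laurent_vec D q u $ j"
      using laurent_homogeneous_lookup(1)[OF w(3)[OF j], unfolded e] j by (simp add: laurent_vec_def u_def)
  qed (simp add: w)
qed

lemma diff_laurent_vec:
  assumes D: "is_complex h_grading D" and u: "even q" "u \<in> even_chains D i"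
  shows "map_mat to_laurent (diff D) *\<^sub>v laurent_vec D q u = laurent_vec D q (h1_diff D u)"
proof (rule eq_vecI)
  note dD = hgr.complexD(2,3)[OF D]
  fix k assume "k < dim_vec (laurent_vec D q (h1_diff D u))"
  then have k: "k < rk D" by simp
  have "(map_mat to_laurent (diff D) *\<^sub>v laurent_vec D q u) $ k =
      (\<Sum>j<rk D. to_laurent (diff D $$ (k, j)) * Poly_Mapping.single ((qdeg D j - q) div 2) (u j))"
    using k dD by (subst mult_vec_index) (auto simp: laurent_vec_def)
  also have "\<dots> = (\<Sum>j<rk D. Poly_Mapping.single ((qdeg D k - q) div 2) (poly (diff D $$ (k, j)) 1 * u j))"
  proof (intro sum.cong refl)
    fix j assume "j \<in> {..<rk D}"
    then have j: "j < rk D" by simp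
    have "to_laurent (diff D $$ (k, j)) * Poly_Mapping.single ((qdeg D j - q) div 2) (u j) =
      Poly_Mapping.single (- (qdeg D j - qdeg D k) div 2 + (qdeg D j - q) div 2) (poly (diff D $$ (k, j)) 1 * u j)"
      unfolding to_laurent_homogeneous[OF diff_h_entry(1)[OF D k j]] by (rule mult_single)
    also have "\<dots> = Poly_Mapping.single ((qdeg D k - q) div 2) (poly (diff D $$ (k, j)) 1 * u j)"
    proof (cases "poly (diff D $$ (k, j)) 1 = 0 \<or> u j = 0")
      case True
      then have "poly (diff D $$ (k, j)) 1 * u j = 0" by (metis mult_zero_left mult_zero_right)
      then show ?thesis by (simp only: single_zero)
    next
      case False
      then have "even (qdeg D j - qdeg D k)" "even (qdeg D j)"
        using diff_h_entry(2)[OF D k j] even_chainsD[OF u(2)] by blast+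
      then have "- (qdeg D j - qdeg D k) div 2 + (qdeg D j - q) div 2 = (qdeg D k - q) div 2"
        using u(1) by presburger
      then show ?thesis by simp
    qed
    finally show "to_laurent (diff D $$ (k, j)) * Poly_Mapping.single ((qdeg D j - q) div 2) (u j) =
      Poly_Mapping.single ((qdeg D k - q) div 2) (poly (diff D $$ (k, j)) 1 * u j)" .
  qed
  also have "\<dots> = laurent_vec D q (h1_diff D u) $ k"
    unfolding sum_single using k by (simp only: laurent_vec_def h1_diff_def index_vec if_True)
  finally show "(map_mat to_laurent (diff D) *\<^sub>v laurent_vec D q u) $ k = laurent_vec D q (h1_diff D u) $ k" .
qed (simp add: hgr.complexD(2)[OF D])

lemma laurent_vec_inject:
  assumes "u \<in> even_chains D i" "v \<in> even_chains D i" "laurent_vec D q u = laurent_vec D q v"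
  shows "u = v"
proof
  fix j
  show "u j = v j"
  proof (cases "j < rk D")
    case True
    then have "Poly_Mapping.single ((qdeg D j - q) div 2) (u j) = Poly_Mapping.single ((qdeg D j - q) div 2) (v j)"
      using arg_cong[OF assms(3), of "\<lambda>w. w $ j"] by (simp add: laurent_vec_def)
    then show ?thesis by (metis lookup_single_eq)
  next
    case False
    then show ?thesis using even_chainsD(1)[OF assms(1)] even_chainsD(1)[OF assms(2)] by metis
  qed
qed

lemma laurent_vec_zero: "laurent_vec D q (\<lambda>_. 0) = 0\<^sub>v (rk D)"
  by (rule eq_vecI) (auto simp: laurent_vec_def)

text \<open>
  The identity is inherited from the localised complex, where it holds after homogenisation.
\<close>

lemma h1_diff_square:
  assumes D: "is_complex h_grading D" and u: "u \<in> even_chains D i"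
  shows "h1_diff D (h1_diff D u) = (\<lambda>_. 0)"
proof (rule laurent_vec_inject[where q = 0])
  note dL = laur.complexD[OF hinv.is_complex_base_change[OF D]]
  have u1: "h1_diff D u \<in> even_chains D (i + 1)" by (rule h1_diff_even_chains[OF D u refl])
  show "h1_diff D (h1_diff D u) \<in> even_chains D (i + 1 + 1)" by (rule h1_diff_even_chains[OF D u1 refl])
  show "(\<lambda>_. 0) \<in> even_chains D (i + 1 + 1)" by (rule even_chains_zero)
  have "laurent_vec D 0 (h1_diff D (h1_diff D u)) = map_mat to_laurent (diff D) *\<^sub>v (map_mat to_laurent (diff D) *\<^sub>v laurent_vec D 0 u)"
    using diff_laurent_vec[OF D _ u, of 0] diff_laurent_vec[OF D _ u1, of 0] by simp
  also have "\<dots> = (map_mat to_laurent (diff D) * map_mat to_laurent (diff D)) *\<^sub>v laurent_vec D 0 u"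
    using dL by (intro laur.mult_vec_assoc[symmetric]) auto
  also have "\<dots> = 0\<^sub>v (rk D)"
    using dL by (intro eq_vecI) (simp_all add: mult_vec_index del: index_mult_mat_vec)
  finally show "laurent_vec D 0 (h1_diff D (h1_diff D u)) = laurent_vec D 0 (\<lambda>_. 0)"
    by (simp add: laurent_vec_zero)
qed

lemma laurent_vec_coboundary_iff:
  assumes D: "is_complex h_grading D" and u: "even q" "u \<in> even_chains D i"
  shows "laurent_vec D q u \<in> coboundaries laurent_grading (cplx_hinv D) i q \<longleftrightarrow> u \<in> h1_diff D ` even_chains D (i - 1)"
proof
  assume "laurent_vec D q u \<in> coboundaries laurent_grading (cplx_hinv D) i q"
  then obtain w where w: "laurent_vec D q u = map_mat to_laurent (diff D) *\<^sub>v w" "w \<in> bigraded_part laurent_grading (cplx_hinv D) (i - 1) q"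
    by (auto simp: coboundaries_def)
  obtain e where e: "e \<in> even_chains D (i - 1)" "w = laurent_vec D q e"
    using u(1) w(2) by (rule bigraded_laurent_vec)
  have "laurent_vec D q u = laurent_vec D q (h1_diff D e)"
    unfolding w(1) e(2) by (rule diff_laurent_vec[OF D u(1) e(1)])
  then have "u = h1_diff D e"
    by (rule laurent_vec_inject[OF u(2) h1_diff_even_chains[OF D e(1)], rotated]) simp
  then show "u \<in> h1_diff D ` even_chains D (i - 1)" using e by blast
next
  assume "u \<in> h1_diff D ` even_chains D (i - 1)"
  then obtain e where e: "e \<in> even_chains D (i - 1)" "u = h1_diff D e" by blast
  have "laurent_vec D q u = diff (cplx_hinv D) *\<^sub>v laurent_vec D q e"
    unfolding e(2) using diff_laurent_vec[OF D u(1) e(1)] by simp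
  then show "laurent_vec D q u \<in> coboundaries laurent_grading (cplx_hinv D) i q"
    using laurent_vec_bigraded[OF u(1) e(1)] unfolding coboundaries_def by blast
qed

text \<open>
  The quantum filtration on the complex at \<open>h = 1\<close>: for even \<open>q\<close>, the even chains of level \<open>q\<close> are the
  specialisations of the elements of \<open>D\<close> of quantum degree \<open>q\<close>.
\<close>

definition supported_from :: "bit poly cplx \<Rightarrow> int \<Rightarrow> (nat \<Rightarrow> bit) \<Rightarrow> bool" where
  "supported_from D q u \<longleftrightarrow> (\<forall>j. u j \<noteq> 0 \<longrightarrow> q \<le> qdeg D j)"

lemma map_to_laurent_h_vec:
  assumes "supported_from D q u"
  shows "map_vec to_laurent (h_vec D q u) = laurent_vec D q u"
proof (rule eq_vecI)
  fix j assume "j < dim_vec (laurent_vec D q u)"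
  then have j: "j < rk D" by simp
  show "map_vec to_laurent (h_vec D q u) $ j = laurent_vec D q u $ j"
  proof (cases "u j = 0")
    case True
    then show ?thesis using j by (simp add: h_vec_def laurent_vec_def to_laurent_zero)
  next
    case False
    then have "q \<le> qdeg D j" using assms unfolding supported_from_def by blast
    then have "int (nat ((qdeg D j - q) div 2)) = (qdeg D j - q) div 2" by simp
    then show ?thesis using j by (simp add: h_vec_def laurent_vec_def to_laurent_monom)
  qed
qed simp

lemma monom_mem_h_grading:
  assumes "c \<noteq> 0 \<Longrightarrow> r = - 2 * int k"
  shows "monom c k \<in> h_grading r"
  using assms by (cases "c = 0") (auto simp: h_grading_iff)

lemma h_vec_bigraded:
  assumes "even q" "u \<in> even_chains D i" "supported_from D q u"
  shows "h_vec D q u \<in> bigraded_part h_grading D i q"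
  unfolding hgr.bigraded_part_iff
proof (intro conjI allI impI)
  fix j assume j: "j < rk D"
  have e: "h_vec D q u $ j = monom (u j) (nat ((qdeg D j - q) div 2))"
    using j by (simp add: h_vec_def)
  show "hdeg D j = i" if "h_vec D q u $ j \<noteq> 0"
  proof -
    have "u j \<noteq> 0" using that unfolding e by (metis monom_0 monom_eq_0)
    then show ?thesis using even_chainsD[OF assms(2)] by simp
  qed
  show "h_vec D q u $ j \<in> h_grading (q - qdeg D j)"
    unfolding e
  proof (rule monom_mem_h_grading)
    assume u: "u j \<noteq> 0"
    then have "even (qdeg D j)" by (rule even_chainsD(3)[OF assms(2)])
    moreover have "q \<le> qdeg D j" using u assms(3) unfolding supported_from_def by blast
    ultimately have "2 * ((qdeg D j - q) div 2) = qdeg D j - q" "0 \<le> (qdeg D j - q) div 2"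
      using assms(1) by simp_all
    then show "q - qdeg D j = - 2 * int (nat ((qdeg D j - q) div 2))"
      unfolding nat_0_le[OF \<open>0 \<le> (qdeg D j - q) div 2\<close>] by linarith
  qed
qed simp

lemma bigraded_h_vec:
  assumes "even q" "b \<in> bigraded_part h_grading D i q"
  obtains u where "u \<in> even_chains D i" "supported_from D q u" "b = h_vec D q u"
proof
  define u where "u j = (if j < rk D then poly (b $ j) 1 else 0)" for j
  have b: "dim_vec b = rk D" "\<And>j. j < rk D \<Longrightarrow> b $ j \<noteq> 0 \<Longrightarrow> hdeg D j = i"
    "\<And>j. j < rk D \<Longrightarrow> b $ j \<in> h_grading (q - qdeg D j)"
    using assms(2) by (auto simp: hgr.bigraded_part_iff)
  have u: "j < rk D \<and> hdeg D j = i \<and> even (qdeg D j) \<and> q \<le> qdeg D j" if "u j \<noteq> 0" for j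
  proof -
    have j: "j < rk D" "b $ j \<noteq> 0" using that unfolding u_def by (metis, metis poly_0)
    then show ?thesis using b(2) h_homogeneous_monom(2)[OF b(3)] assms(1) by auto
  qed
  then show "u \<in> even_chains D i" "supported_from D q u"
    unfolding even_chains_def supported_from_def by blast+
  show "b = h_vec D q u"
  proof (rule eq_vecI)
    fix j assume "j < dim_vec (h_vec D q u)"
    then have j: "j < rk D" by simp
    have e: "- (q - qdeg D j) = qdeg D j - q" by simp
    show "b $ j = h_vec D q u $ j"
      using h_homogeneous_monom(1)[OF b(3)[OF j], unfolded e] j by (simp add: h_vec_def u_def)
  qed (simp add: b)
qed

lemma h_vec_cocycle_iff:
  assumes D: "is_complex h_grading D" and u: "even q" "u \<in> even_chains D i" "supported_from D q u"
  shows "h_vec D q u \<in> cocycles h_grading D i q \<longleftrightarrow> h1_diff D u = (\<lambda>_. 0)"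
proof -
  note dD = hgr.complexD(2,3)[OF D]
  have inj: "map_vec to_laurent v = map_vec to_laurent w \<longleftrightarrow> v = w" for v w
    by (auto simp: to_laurent_inject vec_eq_iff)
  have "map_vec to_laurent (diff D *\<^sub>v h_vec D q u) = laurent_vec D q (h1_diff D u)"
    using dD diff_laurent_vec[OF D u(1,2)] by (subst hinv.map_vec_mult) (simp_all add: map_to_laurent_h_vec[OF u(3)])
  moreover have "map_vec to_laurent (0\<^sub>v (rk D)) = laurent_vec D q (\<lambda>_. 0)"
    by (simp add: hinv.vec_hom_zero laurent_vec_zero)
  ultimately have "diff D *\<^sub>v h_vec D q u = 0\<^sub>v (rk D) \<longleftrightarrow> laurent_vec D q (h1_diff D u) = laurent_vec D q (\<lambda>_. 0)"
    using inj by metis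
  also have "\<dots> \<longleftrightarrow> h1_diff D u = (\<lambda>_. 0)"
    using laurent_vec_inject[OF h1_diff_even_chains[OF D u(2) refl] even_chains_zero] by metis
  finally show ?thesis using h_vec_bigraded[OF u] by (simp add: cocycles_def)
qed

text \<open>
  The associated graded part in level \<open>q\<close>, which is the reduction modulo \<open>h\<close>.
\<close>

definition leading_part :: "bit poly cplx \<Rightarrow> int \<Rightarrow> (nat \<Rightarrow> bit) \<Rightarrow> bit vec" where
  "leading_part D q u = vec (rk D) (\<lambda>j. if qdeg D j = q then u j else 0)"

lemma dim_leading_part [simp]: "dim_vec (leading_part D q u) = rk D"
  by (simp add: leading_part_def)

lemma map_h_to_0_h_vec:
  assumes "even q" "u \<in> even_chains D i" "supported_from D q u"
  shows "map_vec h_to_0 (h_vec D q u) = leading_part D q u"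
proof (rule eq_vecI)
  fix j assume "j < dim_vec (leading_part D q u)"
  then have j: "j < rk D" by simp
  show "map_vec h_to_0 (h_vec D q u) $ j = leading_part D q u $ j"
  proof (cases "u j = 0")
    case True
    then show ?thesis using j by (simp add: h_vec_def leading_part_def h_to_0_def)
  next
    case False
    then have q: "q \<le> qdeg D j" "even (qdeg D j)"
      using assms(3) even_chainsD(3)[OF assms(2)] unfolding supported_from_def by blast+
    then have "2 * ((qdeg D j - q) div 2) = qdeg D j - q" using assms(1) by simp
    then have "nat ((qdeg D j - q) div 2) = 0 \<longleftrightarrow> qdeg D j = q"
      unfolding nat_0_iff using q(1) by linarith
    then show ?thesis using j by (auto simp: h_vec_def leading_part_def h_to_0_def poly_monom power_0_left)
  qed
qed simp

definition nontrivial_cocycle :: "bit poly cplx \<Rightarrow> (nat \<Rightarrow> bit) \<Rightarrow> bool" where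
  "nontrivial_cocycle D u \<longleftrightarrow> u \<in> even_chains D 0 \<and> h1_diff D u = (\<lambda>_. 0) \<and> u \<notin> h1_diff D ` even_chains D (- 1)"

text \<open>
  At \<open>h = 1\<close> the elements of all even quantum degrees live in one finite complex, and a cocycle of some
  filtration level also belongs to every lower level.  This makes the dependence on \<open>q\<close> transparent.
\<close>

lemma full_iff_h1:
  assumes X: "X \<in> leo_triples"
  shows "oddly_reduced_full X q \<longleftrightarrow> even q \<and>
     (\<exists>u. nontrivial_cocycle (hpart X) u \<and> supported_from (hpart X) q u \<and>
       (\<exists>a\<in>cocycles trivial_grading (zpart X) 0 q.
          cmp X *\<^sub>v map_vec mod2 a - leading_part (hpart X) q u \<in> coboundaries trivial_grading (cplx_h0 (hpart X)) 0 q))"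
proof (cases "even q")
  case q: True
  let ?D = "hpart X"
  note D = leo_triplesD(2)[OF X]
  have key: "full_witness X q a (h_vec ?D q u) \<longleftrightarrow> nontrivial_cocycle ?D u \<and> a \<in> cocycles trivial_grading (zpart X) 0 q \<and>
      cmp X *\<^sub>v map_vec mod2 a - leading_part ?D q u \<in> coboundaries trivial_grading (cplx_h0 ?D) 0 q"
    if u: "u \<in> even_chains ?D 0" "supported_from ?D q u" for a u
    unfolding full_witness_def nontrivial_cocycle_def h_vec_cocycle_iff[OF D q u] map_h_to_0_h_vec[OF q u]
      map_to_laurent_h_vec[OF u(2)] laurent_vec_coboundary_iff[OF D q u(1)] using u by auto
  show ?thesis
    unfolding oddly_reduced_full_iff[OF X]
  proof (intro conj_cong refl iffI)
    assume "\<exists>a b. full_witness X q a b"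
    then obtain a b where w: "full_witness X q a b" by blast
    then have "b \<in> bigraded_part h_grading ?D 0 q" by (auto simp: full_witness_def cocycles_def)
    with q obtain u where u: "u \<in> even_chains ?D 0" "supported_from ?D q u" "b = h_vec ?D q u"
      by (rule bigraded_h_vec)
    then show "\<exists>u. nontrivial_cocycle ?D u \<and> supported_from ?D q u \<and>
       (\<exists>a\<in>cocycles trivial_grading (zpart X) 0 q.
          cmp X *\<^sub>v map_vec mod2 a - leading_part ?D q u \<in> coboundaries trivial_grading (cplx_h0 ?D) 0 q)"
      using w key by blast
  next
    assume "\<exists>u. nontrivial_cocycle ?D u \<and> supported_from ?D q u \<and>
       (\<exists>a\<in>cocycles trivial_grading (zpart X) 0 q.
          cmp X *\<^sub>v map_vec mod2 a - leading_part ?D q u \<in> coboundaries trivial_grading (cplx_h0 ?D) 0 q)"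
    then show "\<exists>a b. full_witness X q a b"
      using key unfolding nontrivial_cocycle_def by metis
  qed
qed (simp add: oddly_reduced_full_def)

text \<open>
  The image of the generator of the line; it is no coboundary because a retraction onto the line
  sends it back to the generator.
\<close>

lemma ex_nontrivial_cocycle:
  assumes X: "X \<in> leo_triples"
  shows "\<exists>z. nontrivial_cocycle (hpart X) z"
proof -
  let ?D = "hpart X" and ?L = "cplx_hinv (hpart X)"
  note D = leo_triplesD(2)[OF X] and L = leo_triplesD(5)[OF X]
  obtain q F G where q: "even q" and FG: "chain_map laurent_grading ?L (laurent_line q) F" "chain_map laurent_grading (laurent_line q) ?L G"
    "chain_homotopic laurent_grading (laurent_line q) (laurent_line q) (F * G) (1\<^sub>m 1)"
    using leo_triplesD(8)[OF X] by (auto simp: homotopy_equivalent_def homotopy_equivalence_def)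
  note dL = laur.complexD[OF L]
  note dims = laur.chain_mapD[OF FG(1)] laur.chain_mapD[OF FG(2)]
  have FG1: "F * G = 1\<^sub>m 1"
    by (rule laur.homotopic_line_eq[OF FG(3)]) (use dims in auto)
  obtain g where g: "G = col_mat g" "dim_vec g = rk ?D"
  proof -
    have "dim_col G = 1" "dim_row G = rk ?D" using dims(6,7) by simp_all
    then show ?thesis using col_mat_surj[of G] that by metis
  qed
  have gb: "g \<in> bigraded_part laurent_grading ?L 0 q"
    using dims(5) g by (auto simp: laur.homog_map_iff laur.bigraded_part_iff)
  obtain z where z: "z \<in> even_chains ?D 0" "g = laurent_vec ?D q z"
    using q gb by (rule bigraded_laurent_vec)
  have "diff ?L * G = 0\<^sub>m (rk ?D) 1"
    using dims(8) dims(6,7) by simp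
  moreover have "0\<^sub>m (rk ?D) 1 = col_mat (0\<^sub>v (rk ?D) :: (int \<Rightarrow>\<^sub>0 bit) vec)"
    by (intro eq_matI) (auto simp: col_mat_def)
  moreover have "diff ?L * G = col_mat (diff ?L *\<^sub>v g)"
    unfolding g(1) using g(2) dL by (intro mult_col_mat) simp
  ultimately have "col_mat (diff ?L *\<^sub>v g) = col_mat (0\<^sub>v (rk ?D))" by simp
  then have "laurent_vec ?D q (h1_diff ?D z) = laurent_vec ?D q (\<lambda>_. 0)"
    using diff_laurent_vec[OF D q z(1)] unfolding col_mat_inject z(2) by (simp add: laurent_vec_zero)
  then have "h1_diff ?D z = (\<lambda>_. 0)"
    by (rule laurent_vec_inject[OF h1_diff_even_chains[OF D z(1) refl] even_chains_zero])
  moreover have "z \<notin> h1_diff ?D ` even_chains ?D (- 1)"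
  proof
    assume "z \<in> h1_diff ?D ` even_chains ?D (- 1)"
    then have "g \<in> coboundaries laurent_grading ?L 0 q"
      using laurent_vec_coboundary_iff[OF D q z(1)] z(2) by simp
    then obtain w where w: "g = diff ?L *\<^sub>v w" "w \<in> bigraded_part laurent_grading ?L (- 1) q"
      by (auto simp: coboundaries_def)
    have dw: "dim_vec w = rk ?D" using laur.bigraded_part_dim[OF w(2)] by simp
    have "F * G = F * (diff ?L * col_mat w)"
      unfolding g(1) w(1) using dw dL by (subst mult_col_mat) auto
    also have "\<dots> = (F * diff ?L) * col_mat w"
      by (rule mat_assoc[symmetric]) (use dims dL dw in simp_all)
    also have "\<dots> = 0\<^sub>m 1 1" unfolding dims(4) using dims(1-3) dw by simp
    finally have "(1\<^sub>m 1 :: (int \<Rightarrow>\<^sub>0 bit) mat) $$ (0, 0) = 0\<^sub>m 1 1 $$ (0, 0)" unfolding FG1 by simp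
    then show False by simp
  qed
  ultimately show ?thesis using z(1) unfolding nontrivial_cocycle_def by blast
qed


section \<open>The invariant\<close>

text \<open>
  Strictly below the filtration level of \<open>u\<close> the leading part is zero, and the integral cocycle
  zero matches it.  This is the effect of multiplying by a power of \<open>h\<close>.
\<close>

lemma full_from_low_degree:
  assumes X: "X \<in> leo_triples" and q: "even q"
    and u: "nontrivial_cocycle (hpart X) u" "supported_from (hpart X) p u" "q < p"
  shows "oddly_reduced_full X q"
proof -
  note XD = leo_triplesD[OF X]
  have "supported_from (hpart X) q u" using u(2,3) unfolding supported_from_def by force
  moreover have "0\<^sub>v (rk (zpart X)) \<in> cocycles trivial_grading (zpart X) 0 q"
    using triv.complexD[OF XD(1)]
    by (auto simp: cocycles_def triv.bigraded_part_zero mult_vec_index simp del: index_mult_mat_vec intro!: eq_vecI)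
  moreover have "cmp X *\<^sub>v map_vec mod2 (0\<^sub>v (rk (zpart X))) - leading_part (hpart X) q u = 0\<^sub>v (rk (hpart X))"
  proof (rule eq_vecI)
    fix j assume "j < dim_vec (0\<^sub>v (rk (hpart X)))"
    then have j: "j < rk (hpart X)" by simp
    have "(cmp X *\<^sub>v map_vec mod2 (0\<^sub>v (rk (zpart X)))) $ j = 0"
      using j triv.chain_mapD(2,3)[OF XD(7)] by (subst mult_vec_index) (simp_all add: mod2_zero)
    moreover have "leading_part (hpart X) q u $ j = 0"
    proof (cases "qdeg (hpart X) j = q")
      case True
      then have "u j = 0" using u(2,3) unfolding supported_from_def by (metis not_le)
      then show ?thesis using j by (simp add: leading_part_def)
    qed (use j in \<open>simp add: leading_part_def\<close>)
    ultimately show "(cmp X *\<^sub>v map_vec mod2 (0\<^sub>v (rk (zpart X))) - leading_part (hpart X) q u) $ j = 0\<^sub>v (rk (hpart X)) $ j"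
      using j by simp
  qed simp
  moreover have "0\<^sub>v (rk (hpart X)) \<in> coboundaries trivial_grading (cplx_h0 (hpart X)) 0 q"
    using triv.coboundaries_zero[OF XD(4)] by simp
  ultimately show ?thesis unfolding full_iff_h1[OF X] using q u(1) by metis
qed

lemma full_downward:
  assumes X: "X \<in> leo_triples" and "oddly_reduced_full X q" "even p" "p \<le> q"
  shows "oddly_reduced_full X p"
proof (cases "p = q")
  case False
  then show ?thesis using assms full_from_low_degree[OF X] unfolding full_iff_h1[OF X]
    by (metis order_le_neq_trans)
qed (use assms in simp)

lemma ex_full:
  assumes X: "X \<in> leo_triples"
  shows "\<exists>q. oddly_reduced_full X q"
proof -
  obtain z where z: "nontrivial_cocycle (hpart X) z" using ex_nontrivial_cocycle[OF X] by blast
  \<comment> \<open>a lower bound for the quantum degrees of all generators; \<open>2 * ?s - 2\<close> is even and below it\<close>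
  let ?s = "- (\<Sum>j<rk (hpart X). \<bar>qdeg (hpart X) j\<bar>)"
  have "supported_from (hpart X) ?s z"
    unfolding supported_from_def
  proof (intro allI impI)
    fix j assume "z j \<noteq> 0"
    then have "j < rk (hpart X)" using z even_chainsD(1) unfolding nontrivial_cocycle_def by blast
    then have "\<bar>qdeg (hpart X) j\<bar> \<le> (\<Sum>j<rk (hpart X). \<bar>qdeg (hpart X) j\<bar>)"
      by (intro member_le_sum) auto
    then show "?s \<le> qdeg (hpart X) j" by linarith
  qed
  moreover have "2 * ?s - 2 < ?s" 
  proof -
    have "0 \<le> (\<Sum>j<rk (hpart X). \<bar>qdeg (hpart X) j\<bar>)" by (intro sum_nonneg) simp
    then show ?thesis by linarith
  qed
  moreover have "even (2 * ?s - 2)" by simp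
  ultimately show ?thesis using full_from_low_degree[OF X _ z] by blast
qed

lemma full_bounded:
  assumes X: "X \<in> leo_triples" and "oddly_reduced_full X q"
  shows "q \<le> (\<Sum>j<rk (hpart X). \<bar>qdeg (hpart X) j\<bar>)"
proof -
  obtain u where u: "nontrivial_cocycle (hpart X) u" "supported_from (hpart X) q u"
    using assms(2) unfolding full_iff_h1[OF X] by blast
  have "u \<noteq> (\<lambda>_. 0)"
    using u(1) even_chains_zero h1_diff_zero unfolding nontrivial_cocycle_def by (metis image_eqI)
  then obtain j where j: "u j \<noteq> 0" by blast
  then have "j < rk (hpart X)" using u(1) even_chainsD(1) unfolding nontrivial_cocycle_def by blast
  then have "\<bar>qdeg (hpart X) j\<bar> \<le> (\<Sum>j<rk (hpart X). \<bar>qdeg (hpart X) j\<bar>)"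
    by (intro member_le_sum) auto
  then show ?thesis using u(2) j unfolding supported_from_def by fastforce
qed

text \<open>
  The maximum exists, since full degrees are bounded by the quantum degrees of the generators, and
  every even number below a full degree is full.
\<close>

lemma s_odd_nonneg_iff:
  assumes X: "X \<in> leo_triples"
  shows "s_odd X \<ge> 0 \<longleftrightarrow> oddly_reduced_full X 0"
proof -
  obtain p where p: "oddly_reduced_full X p" using ex_full[OF X] by blast
  let ?F = "{q. oddly_reduced_full X q \<and> p \<le> q}"
  have fin: "finite ?F"
    by (rule finite_subset[of _ "{p..(\<Sum>j<rk (hpart X). \<bar>qdeg (hpart X) j\<bar>)}"]) (use full_bounded[OF X] in auto)
  have max: "q \<le> Max ?F" if "oddly_reduced_full X q" for q
  proof (cases "p \<le> q")
    case True
    then show ?thesis using fin that by (intro Max_ge) auto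
  next
    case False
    then have "q \<le> p" by simp
    also have "p \<le> Max ?F" using fin p by (intro Max_ge) auto
    finally show ?thesis .
  qed
  have mem: "oddly_reduced_full X (Max ?F)"
    using Max_in[OF fin] p by blast
  have s: "s_odd X = Max ?F"
    unfolding s_odd_def using mem max by (intro Greatest_equality)
  show ?thesis unfolding s using mem max full_downward[OF X mem, of 0] by auto
qed

section \<open>Totality\<close>

section \<open>Functionals and their lifts\<close>

text \<open>
  The homogeneous functional with values in \<open>F\<^sub>2[h]\<close> that specialises to \<open>m\<close> at \<open>h = 1\<close>.  It exists if
  \<open>m\<close> vanishes on generators of positive quantum degree, because \<open>F\<^sub>2[h]\<close> is zero in positive degrees.
\<close>

definition h_row :: "bit poly cplx \<Rightarrow> (nat \<Rightarrow> bit) \<Rightarrow> bit poly mat" where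
  "h_row D m = mat 1 (rk D) (\<lambda>(_, j). monom (m j) (nat (- qdeg D j div 2)))"

lemma dim_h_row [simp]: "dim_row (h_row D m) = 1" "dim_col (h_row D m) = rk D"
  by (simp_all add: h_row_def)

lemma to_laurent_h_row:
  assumes m_pos: "\<And>j. qdeg D j > 0 \<Longrightarrow> m j = 0" and "j < rk D"
  shows "to_laurent (h_row D m $$ (0, j)) = Poly_Mapping.single (- qdeg D j div 2) (m j)"
proof (cases "m j = 0")
  case True
  then show ?thesis using assms(2) by (simp add: h_row_def to_laurent_zero)
next
  case False
  then have "\<not> 0 < qdeg D j" using m_pos[of j] by blast
  then have "int (nat (- qdeg D j div 2)) = - qdeg D j div 2" by simp
  then show ?thesis using assms(2) by (simp add: h_row_def to_laurent_monom)
qed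

lemma chain_map_h_row:
  assumes D: "is_complex h_grading D" and mE: "m \<in> even_chains D 0"
    and m_pos: "\<And>j. qdeg D j > 0 \<Longrightarrow> m j = 0"
    and m_diff: "\<And>k. k < rk D \<Longrightarrow> (\<Sum>i<rk D. m i * poly (diff D $$ (i, k)) 1) = 0"
  shows "chain_map h_grading D unit_cplx (h_row D m)"
  unfolding chain_map_def
proof
  let ?r = "h_row D m"
  have entry: "to_laurent (?r $$ (0, j)) = Poly_Mapping.single (- qdeg D j div 2) (m j)" if "j < rk D" for j
    using to_laurent_h_row[of D m j] m_pos that by blast
  note dD = hgr.complexD[OF D]
  show "homog_map h_grading 0 0 D (unit_cplx) ?r"
    unfolding hgr.homog_map_iff
  proof (intro conjI allI impI)
    fix i j assume "i < rk (unit_cplx)" and j: "j < rk D"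
    then have i: "i = 0" by simp
    have e: "?r $$ (i, j) = monom (m j) (nat (- qdeg D j div 2))" using j i by (simp add: h_row_def)
    show "hdeg (unit_cplx) i = hdeg D j + 0" if "?r $$ (i, j) \<noteq> 0"
    proof -
      have "m j \<noteq> 0" using that unfolding e by (metis monom_eq_0)
      then show ?thesis using even_chainsD(2)[OF mE, of j] i by simp
    qed
    show "?r $$ (i, j) \<in> h_grading (qdeg D j + 0 - qdeg (unit_cplx) i)"
      unfolding e
    proof (rule monom_mem_h_grading)
      assume mj: "m j \<noteq> 0"
      then have le: "- qdeg D j div 2 \<ge> 0" using m_pos[of j] by force
      have "2 * (- qdeg D j div 2) = - qdeg D j" using even_chainsD(3)[OF mE mj] by simp
      then show "qdeg D j + 0 - qdeg (unit_cplx) i = - 2 * int (nat (- qdeg D j div 2))"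
        unfolding nat_0_le[OF le] using i by simp
    qed
  qed (auto simp: h_row_def)
  have "?r * diff D = 0\<^sub>m 1 (rk D)"
  proof (rule eq_matI)
    fix i k assume "i < dim_row (0\<^sub>m 1 (rk D))" "k < dim_col (0\<^sub>m 1 (rk D))"
    then have i: "i = 0" and k: "k < rk D" by simp_all
    have "to_laurent ((?r * diff D) $$ (0, k)) = (\<Sum>j<rk D. to_laurent (?r $$ (0, j)) * to_laurent (diff D $$ (j, k)))"
      using k dD(2,3) by (subst mat_mult_index) (auto simp: h_row_def hinv.hom_sum hinv.hom_mult)
    also have "\<dots> = (\<Sum>j<rk D. Poly_Mapping.single (- qdeg D k div 2) (m j * poly (diff D $$ (j, k)) 1))"
    proof (intro sum.cong refl)
      fix j assume "j \<in> {..<rk D}"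
      then have j: "j < rk D" by simp
      have "to_laurent (?r $$ (0, j)) * to_laurent (diff D $$ (j, k)) =
        Poly_Mapping.single (- qdeg D j div 2 + - (qdeg D k - qdeg D j) div 2) (m j * poly (diff D $$ (j, k)) 1)"
        unfolding entry[OF j] to_laurent_homogeneous[OF diff_h_entry(1)[OF D j k]] by (rule mult_single)
      also have "\<dots> = Poly_Mapping.single (- qdeg D k div 2) (m j * poly (diff D $$ (j, k)) 1)"
      proof (cases "m j = 0 \<or> poly (diff D $$ (j, k)) 1 = 0")
        case True
        then have "m j * poly (diff D $$ (j, k)) 1 = 0" by (metis mult_zero_left mult_zero_right)
        then show ?thesis by (simp only: single_zero)
      next
        case False
        then have "even (qdeg D k - qdeg D j)" "even (qdeg D j)"
          using diff_h_entry(2)[OF D j k] even_chainsD[OF mE] by blast+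
        then have "- qdeg D j div 2 + - (qdeg D k - qdeg D j) div 2 = - qdeg D k div 2" by presburger
        then show ?thesis by simp
      qed
      finally show "to_laurent (?r $$ (0, j)) * to_laurent (diff D $$ (j, k)) =
        Poly_Mapping.single (- qdeg D k div 2) (m j * poly (diff D $$ (j, k)) 1)" .
    qed
    also have "\<dots> = to_laurent 0"
      unfolding sum_single m_diff[OF k] by (simp add: to_laurent_zero)
    finally show "(?r * diff D) $$ (i, k) = 0\<^sub>m 1 (rk D) $$ (i, k)"
      using k i by (simp only: to_laurent_inject index_zero_mat less_one)
  qed (use dD in \<open>auto simp: h_row_def\<close>)
  then show "?r * diff D = diff (unit_cplx) * ?r" by (simp add: h_row_def)
qed

text \<open>
  A null-homotopic functional vanishes on cocycles, but this one takes the value one on the cocycle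
  given by \<open>z\<close>.
\<close>

lemma h_row_not_null:
  assumes D: "is_complex h_grading D" and mE: "m \<in> even_chains D 0"
    and m_pos: "\<And>j. qdeg D j > 0 \<Longrightarrow> m j = 0"
    and zE: "z \<in> even_chains D 0" and zd: "h1_diff D z = (\<lambda>_. 0)" and mz: "(\<Sum>i<rk D. m i * z i) = 1"
  shows "\<not> chain_homotopic laurent_grading (cplx_hinv D) unit_cplx (map_mat to_laurent (h_row D m)) (0\<^sub>m 1 (rk D))"
proof
  let ?r = "h_row D m"
  have entry: "to_laurent (?r $$ (0, j)) = Poly_Mapping.single (- qdeg D j div 2) (m j)" if "j < rk D" for j
    using to_laurent_h_row[of D m j] m_pos that by blast
  note dD = hgr.complexD[OF D]
  assume "chain_homotopic laurent_grading (cplx_hinv D) (unit_cplx) (map_mat to_laurent ?r) (0\<^sub>m (1) (rk D))"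
  then obtain K where K: "dim_row K = 1" "dim_col K = rk D"
    "map_mat to_laurent ?r - 0\<^sub>m 1 (rk D) = 0\<^sub>m 1 1 * K + K * map_mat to_laurent (diff D)"
    by (rule laur.homotopicE) simp
  have "map_mat to_laurent ?r = map_mat to_laurent ?r - 0\<^sub>m 1 (rk D)"
    by (rule eq_matI) (auto simp: h_row_def)
  also have "\<dots> = K * map_mat to_laurent (diff D)"
    unfolding K(3) using K(1,2) dD(2,3) by (intro eq_matI) (auto simp del: index_mult_mat(1))
  finally have b: "map_mat to_laurent ?r = K * map_mat to_laurent (diff D)" .
  let ?z = "laurent_vec D 0 z"
  have "map_mat to_laurent ?r *\<^sub>v ?z = K *\<^sub>v (map_mat to_laurent (diff D) *\<^sub>v ?z)"
    unfolding b using K(2) dD(2,3) by (intro laur.mult_vec_assoc) auto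
  also have "\<dots> = K *\<^sub>v 0\<^sub>v (rk D)"
    using diff_laurent_vec[OF D _ zE, of 0] zd by (simp add: laurent_vec_zero)
  finally have "(map_mat to_laurent ?r *\<^sub>v ?z) $ 0 = 0"
    using K(1,2) by (simp add: mult_vec_index del: index_mult_mat_vec)
  moreover have "(map_mat to_laurent ?r *\<^sub>v ?z) $ 0 = (\<Sum>j<rk D. to_laurent (?r $$ (0, j)) * ?z $ j)"
    by (subst mult_vec_index) (auto simp: h_row_def)
  moreover have "(\<Sum>j<rk D. to_laurent (?r $$ (0, j)) * ?z $ j) = (\<Sum>j<rk D. Poly_Mapping.single 0 (m j * z j))"
  proof (intro sum.cong refl)
    fix j assume "j \<in> {..<rk D}"
    then have j: "j < rk D" by simp
    have "?z $ j = Poly_Mapping.single (qdeg D j div 2) (z j)" using j by (simp add: laurent_vec_def)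
    then have "to_laurent (?r $$ (0, j)) * ?z $ j = Poly_Mapping.single (- qdeg D j div 2 + qdeg D j div 2) (m j * z j)"
      unfolding entry[OF j] by (simp only: mult_single)
    also have "\<dots> = Poly_Mapping.single 0 (m j * z j)"
    proof (cases "m j = 0")
      case True
      then show ?thesis by (simp only: mult_zero_left single_zero)
    next
      case False
      then have "- qdeg D j div 2 + qdeg D j div 2 = 0" using even_chainsD(3)[OF mE False] by presburger
      then show ?thesis by simp
    qed
    finally show "to_laurent (?r $$ (0, j)) * ?z $ j = Poly_Mapping.single 0 (m j * z j)" .
  qed
  ultimately have "Poly_Mapping.single 0 (1 :: bit) = (0 :: int \<Rightarrow>\<^sub>0 bit)" unfolding sum_single mz by simp
  then show False by simp
qed

text \<open>
  The integral cocycles in bidegree zero are closed under division by two, so the functional \<open>\<psi>\<close> has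
  an integral lift that still vanishes on them.  The columns of the differential are among these
  cocycles, hence the lift is a chain map.
\<close>

lemma integral_cocycle_lift:
  assumes C: "is_complex trivial_grading C"
    and \<psi>: "chain_map trivial_grading (cplx_mod2 C) unit_cplx \<psi>"
    and kills: "\<And>a. a \<in> cocycles trivial_grading C 0 0 \<Longrightarrow> (\<psi> *\<^sub>v map_vec mod2 a) $ 0 = 0"
  obtains \<alpha> where "chain_map trivial_grading C unit_cplx \<alpha>" "map_mat mod2 \<alpha> = \<psi>"
proof -
  note dC = triv.complexD[OF C] and d\<psi> = triv.chain_mapD[OF \<psi>]
  have \<psi>_support: "hdeg C k = 0 \<and> qdeg C k = 0" if "k < rk C" "\<psi> $$ (0, k) \<noteq> 0" for k
    using d\<psi>(1) that unfolding triv.homog_map_iff trivial_grading_def by (auto split: if_splits)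
  define A where "A = {k. k < rk C \<and> hdeg C k = 0 \<and> qdeg C k = 0}"
  define K where "K = {u. (\<forall>k. k \<notin> A \<longrightarrow> u k = 0) \<and> vec (rk C) u \<in> cocycles trivial_grading C 0 0}"
  have finA: "finite A" unfolding A_def by simp
  have \<psi>_kills: "(\<Sum>k\<in>A. \<psi> $$ (0, k) * mod2 (u k)) = 0" if u: "u \<in> K" for u
  proof -
    let ?a = "vec (rk C) u"
    have "(\<Sum>k\<in>A. \<psi> $$ (0, k) * mod2 (u k)) = (\<Sum>k<rk C. \<psi> $$ (0, k) * mod2 (u k))"
    proof (rule sum.mono_neutral_left)
      show "\<forall>k\<in>{..<rk C} - A. \<psi> $$ (0, k) * mod2 (u k) = 0"
        using u unfolding K_def by (auto simp: mod2_zero)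
    qed (auto simp: A_def)
    also have "\<dots> = (\<psi> *\<^sub>v map_vec mod2 ?a) $ 0"
      using d\<psi>(2,3) by (subst mult_vec_index) auto
    also have "\<dots> = 0" using u by (intro kills) (simp add: K_def)
    finally show ?thesis .
  qed
  have "\<exists>\<alpha>. (\<forall>i\<in>A. mod2 (\<alpha> i) = \<psi> $$ (0, i)) \<and> (\<forall>u\<in>K. (\<Sum>i\<in>A. \<alpha> i * u i) = 0)"
  proof (rule integral_lift_of_annihilator[OF finA _ _ _ \<psi>_kills])
    show "u i = 0" if "u \<in> K" "i \<notin> A" for u i using that by (simp add: K_def)
    have lin: "diff C *\<^sub>v vec (rk C) (\<lambda>i. a * u i - b * v i) = a \<cdot>\<^sub>v (diff C *\<^sub>v vec (rk C) u) - b \<cdot>\<^sub>v (diff C *\<^sub>v vec (rk C) v)" for a b u v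
      using dC by (intro eq_vecI)
        (simp_all add: mult_vec_index sum_distrib_left sum_subtractf[symmetric] algebra_simps del: index_mult_mat_vec)
    have Kiff: "u \<in> K \<longleftrightarrow> (\<forall>k. k \<notin> A \<longrightarrow> u k = 0) \<and> diff C *\<^sub>v vec (rk C) u = 0\<^sub>v (rk C)" for u
      unfolding K_def cocycles_def triv.bigraded_part_iff A_def trivial_grading_def by auto
    show "(\<lambda>i. a * u i - b * v i) \<in> K" if "u \<in> K" "v \<in> K" for u v a b
      using that unfolding Kiff lin by auto
    show "u \<in> K" if "(\<lambda>i. 2 * u i) \<in> K" for u
    proof -
      have "diff C *\<^sub>v vec (rk C) (\<lambda>i. 2 * u i) = 2 \<cdot>\<^sub>v (diff C *\<^sub>v vec (rk C) u)"
        using lin[of 2 u 0 u] dC by (intro eq_vecI) (simp_all del: index_mult_mat_vec)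
      then have "2 \<cdot>\<^sub>v (diff C *\<^sub>v vec (rk C) u) = 0\<^sub>v (rk C)" using that unfolding Kiff by simp
      then have "(diff C *\<^sub>v vec (rk C) u) $ i = 0" if "i < rk C" for i
        using that dC(2) by (auto simp: vec_eq_iff simp del: index_mult_mat_vec)
      then have "diff C *\<^sub>v vec (rk C) u = 0\<^sub>v (rk C)" using dC(2) by (intro eq_vecI) auto
      then show ?thesis using that unfolding Kiff by auto
    qed
  qed
  then obtain \<alpha>' where \<alpha>': "\<And>i. i \<in> A \<Longrightarrow> mod2 (\<alpha>' i) = \<psi> $$ (0, i)" "\<And>u. u \<in> K \<Longrightarrow> (\<Sum>i\<in>A. \<alpha>' i * u i) = 0" by blast
  have dC_entry: "hdeg C j = hdeg C k + 1 \<and> qdeg C j = qdeg C k"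
    if "j < rk C" "k < rk C" "diff C $$ (j, k) \<noteq> 0" for j k
  proof -
    have "hdeg C j = hdeg C k + 1" "diff C $$ (j, k) \<in> trivial_grading (qdeg C k + 0 - qdeg C j)"
      using dC(1) that unfolding triv.homog_map_iff by blast+
    then show ?thesis using that(3) by (auto simp: trivial_grading_def split: if_splits)
  qed
  define \<alpha> where "\<alpha> = mat 1 (rk C) (\<lambda>(_, k). if k \<in> A then \<alpha>' k else 0)"
  have \<alpha>: "chain_map trivial_grading C (unit_cplx) \<alpha>"
    unfolding chain_map_def
  proof
    show "homog_map trivial_grading 0 0 C (unit_cplx) \<alpha>"
      unfolding triv.homog_map_iff by (auto simp: \<alpha>_def A_def trivial_grading_def)
    have "\<alpha> * diff C = 0\<^sub>m 1 (rk C)"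
    proof (rule eq_matI)
      fix i k assume "i < dim_row (0\<^sub>m 1 (rk C))" "k < dim_col (0\<^sub>m 1 (rk C))"
      then have i: "i = 0" and k: "k < rk C" by simp_all
      \<comment> \<open>the \<open>k\<close>-th column of the differential, a cocycle in \<open>K\<close> if the \<open>k\<close>-th generator has bidegree \<open>(-1, 0)\<close>\<close>
      let ?u = "\<lambda>j. if j \<in> A then diff C $$ (j, k) else 0"
      have entry: "(\<alpha> * diff C) $$ (0, k) = (\<Sum>j\<in>A. \<alpha>' j * diff C $$ (j, k))"
      proof -
        have "(\<alpha> * diff C) $$ (0, k) = (\<Sum>j<rk C. (if j \<in> A then \<alpha>' j else 0) * diff C $$ (j, k))"
          using k dC(2,3) by (subst mat_mult_index) (auto simp: \<alpha>_def)
        also have "\<dots> = (\<Sum>j\<in>A. (if j \<in> A then \<alpha>' j else 0) * diff C $$ (j, k))"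
          by (rule sum.mono_neutral_right) (auto simp: A_def)
        finally show ?thesis by simp
      qed
      show "(\<alpha> * diff C) $$ (i, k) = 0\<^sub>m 1 (rk C) $$ (i, k)"
      proof (cases "hdeg C k = - 1 \<and> qdeg C k = 0")
        case True
        have col: "?u j = diff C $$ (j, k)" if "j < rk C" for j
        proof (cases "diff C $$ (j, k) = 0")
          case False
          then have "j \<in> A" using dC_entry[OF that k] that True by (simp add: A_def)
          then show ?thesis by simp
        qed simp
        have "diff C *\<^sub>v vec (rk C) ?u = 0\<^sub>v (rk C)"
        proof (rule eq_vecI)
          fix j assume "j < dim_vec (0\<^sub>v (rk C))"
          then have j: "j < rk C" by simp
          have "(diff C *\<^sub>v vec (rk C) ?u) $ j = (\<Sum>i<rk C. diff C $$ (j, i) * ?u i)"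
            using dC(2,3) j by (subst mult_vec_index) auto
          also have "\<dots> = (\<Sum>i<rk C. diff C $$ (j, i) * diff C $$ (i, k))"
            by (intro sum.cong refl) (simp only: col lessThan_iff)
          also have "\<dots> = (diff C * diff C) $$ (j, k)"
            using dC(2,3) j k by (subst mat_mult_index) auto
          finally show "(diff C *\<^sub>v vec (rk C) ?u) $ j = 0\<^sub>v (rk C) $ j" using dC(4) j k by simp
        qed (use dC in simp)
        moreover have "vec (rk C) ?u \<in> bigraded_part trivial_grading C 0 0"
          unfolding triv.bigraded_part_iff by (auto simp: A_def trivial_grading_def)
        ultimately have "?u \<in> K" unfolding K_def cocycles_def by auto
        from \<alpha>'(2)[OF this] have "(\<Sum>j\<in>A. \<alpha>' j * diff C $$ (j, k)) = 0" by simp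
        then show ?thesis using entry i k by simp
      next
        case False
        have "(\<Sum>j\<in>A. \<alpha>' j * diff C $$ (j, k)) = 0"
        proof (rule sum.neutral, rule ballI)
          fix j assume j: "j \<in> A"
          have "diff C $$ (j, k) = 0"
          proof (rule ccontr)
            assume "diff C $$ (j, k) \<noteq> 0"
            then have "hdeg C k = - 1 \<and> qdeg C k = 0"
              using dC_entry[of j k] j k by (simp add: A_def)
            then show False using False by simp
          qed
          then show "\<alpha>' j * diff C $$ (j, k) = 0" by simp
        qed
        then show ?thesis using entry i k by simp
      qed
    qed (use dC in \<open>auto simp: \<alpha>_def\<close>)
    then show "\<alpha> * diff C = diff (unit_cplx) * \<alpha>" by (simp add: \<alpha>_def)
  qed
  have "map_mat mod2 \<alpha> = \<psi>"
  proof (rule eq_matI)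
    fix i k assume "i < dim_row \<psi>" "k < dim_col \<psi>"
    then have i: "i = 0" and k: "k < rk C" using d\<psi>(2,3) by simp_all
    show "map_mat mod2 \<alpha> $$ (i, k) = \<psi> $$ (i, k)"
    proof (cases "k \<in> A")
      case True
      then show ?thesis using i k \<alpha>'(1) by (simp add: \<alpha>_def)
    next
      case False
      then have "\<psi> $$ (0, k) = 0" using \<psi>_support[OF k] k unfolding A_def by blast
      then show ?thesis using i k False by (simp add: \<alpha>_def mod2_zero)
    qed
  qed (use d\<psi> in \<open>auto simp: \<alpha>_def\<close>)
  with \<alpha> show thesis by (rule that)
qed

text \<open>
  The cochains that are the sum of a boundary, of an element of positive filtration level and of the
  image of an integral cocycle under the comparison map.  The middle summand is expressed by comparing
  coordinates in nonpositive quantum degrees only.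
\<close>

definition obstruction_space :: "leo \<Rightarrow> (nat \<Rightarrow> bit) set" where
  "obstruction_space X = {w \<in> even_chains (hpart X) 0.
     \<exists>e\<in>even_chains (hpart X) (- 1). \<exists>a\<in>cocycles trivial_grading (zpart X) 0 0.
     \<forall>j<rk (hpart X). qdeg (hpart X) j \<le> 0 \<longrightarrow>
       w j = h1_diff (hpart X) e j + (cmp X *\<^sub>v map_vec mod2 a) $ j}"

text \<open>
  The rings \<open>\<int>\<close> and \<open>F\<^sub>2\<close> are concentrated in quantum degree zero, so maps over them preserve the
  quantum degrees of generators.
\<close>

lemma cocycle_image_support:
  assumes X: "X \<in> leo_triples" and a: "a \<in> cocycles trivial_grading (zpart X) 0 0"
    and j: "j < rk (hpart X)" "(cmp X *\<^sub>v map_vec mod2 a) $ j \<noteq> 0"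
  shows "hdeg (hpart X) j = 0 \<and> qdeg (hpart X) j = 0"
proof -
  have "cmp X *\<^sub>v map_vec mod2 a \<in> bigraded_part trivial_grading (cplx_h0 (hpart X)) 0 0"
    using triv.bigraded_part_mult[OF triv.chain_mapD(1)[OF leo_triplesD(7)[OF X]], of "map_vec mod2 a" 0 0]
      mod2.bigraded_part_base_change[of a "zpart X" 0 0] a
    by (simp add: cocycles_def)
  then show ?thesis
    using j unfolding triv.bigraded_part_iff trivial_grading_def by (auto split: if_splits)
qed

lemma mem_obstruction_space_no_cocycle:
  assumes X: "X \<in> leo_triples" and w: "w \<in> even_chains (hpart X) 0" and e: "e \<in> even_chains (hpart X) (- 1)"
    and we: "\<And>j. j < rk (hpart X) \<Longrightarrow> qdeg (hpart X) j \<le> 0 \<Longrightarrow> w j = h1_diff (hpart X) e j"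
  shows "w \<in> obstruction_space X"
proof -
  note dC = triv.complexD[OF leo_triplesD(1)[OF X]] and dims = triv.chain_mapD[OF leo_triplesD(7)[OF X]]
  have "0\<^sub>v (rk (zpart X)) \<in> cocycles trivial_grading (zpart X) 0 0"
    using dC by (auto simp: cocycles_def triv.bigraded_part_zero mult_vec_index simp del: index_mult_mat_vec intro!: eq_vecI)
  moreover have "(cmp X *\<^sub>v map_vec mod2 (0\<^sub>v (rk (zpart X)))) $ j = 0" if "j < rk (hpart X)" for j
    using that dims by (subst mult_vec_index) (simp_all add: mod2_zero)
  then have "\<forall>j<rk (hpart X). qdeg (hpart X) j \<le> 0 \<longrightarrow>
      w j = h1_diff (hpart X) e j + (cmp X *\<^sub>v map_vec mod2 (0\<^sub>v (rk (zpart X)))) $ j"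
    using we by (metis add_0_right)
  ultimately show ?thesis unfolding obstruction_space_def using w e by blast
qed

lemma obstruction_space_add:
  assumes X: "X \<in> leo_triples" and s: "s \<in> obstruction_space X" and t: "t \<in> obstruction_space X"
  shows "(\<lambda>i. s i + c * t i) \<in> obstruction_space X"
proof (cases "c = 0")
  case True
  then show ?thesis using s by (simp only: mult_zero_left add_0_right)
next
  case False
  then have c: "c = 1" by simp
  let ?D = "hpart X" and ?C = "zpart X" and ?f = "\<lambda>a. cmp X *\<^sub>v map_vec mod2 a"
  note XD = leo_triplesD[OF X]
  note dC = triv.complexD[OF XD(1)] and dims = triv.chain_mapD[OF XD(7)]
  have cocycle_dim: "dim_vec a = rk ?C" if "a \<in> cocycles trivial_grading ?C 0 0" for a
    using that triv.bigraded_part_dim by (auto simp: cocycles_def)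
  obtain e a where e: "e \<in> even_chains ?D (- 1)" and a: "a \<in> cocycles trivial_grading ?C 0 0"
    and sea: "\<And>j. j < rk ?D \<Longrightarrow> qdeg ?D j \<le> 0 \<Longrightarrow> s j = h1_diff ?D e j + ?f a $ j" and sE: "s \<in> even_chains ?D 0"
    using s unfolding obstruction_space_def by blast
  obtain e' a' where e': "e' \<in> even_chains ?D (- 1)" and a': "a' \<in> cocycles trivial_grading ?C 0 0"
    and tea: "\<And>j. j < rk ?D \<Longrightarrow> qdeg ?D j \<le> 0 \<Longrightarrow> t j = h1_diff ?D e' j + ?f a' $ j" and tE: "t \<in> even_chains ?D 0"
    using t unfolding obstruction_space_def by blast
  have aa: "a + a' \<in> cocycles trivial_grading ?C 0 0"
    using a a' cocycle_dim[OF a] cocycle_dim[OF a'] dC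
    by (auto simp: cocycles_def triv.mult_vec_add intro: triv.bigraded_part_add)
  have fa: "?f (a + a') = ?f a + ?f a'"
  proof -
    have "map_vec mod2 (a + a') = map_vec mod2 a + map_vec mod2 a'"
      using cocycle_dim[OF a] cocycle_dim[OF a'] by (intro eq_vecI) (auto simp: mod2.hom_add)
    then show ?thesis using cocycle_dim[OF a] cocycle_dim[OF a'] dims by (simp add: triv.mult_vec_add)
  qed
  have "s j + c * t j = h1_diff ?D (\<lambda>j. e j + 1 * e' j) j + ?f (a + a') $ j" if "j < rk ?D" "qdeg ?D j \<le> 0" for j
  proof -
    have "?f (a + a') $ j = ?f a $ j + ?f a' $ j" unfolding fa using that dims by simp
    then show ?thesis
      unfolding sea[OF that] tea[OF that] h1_diff_add c by (simp only: mult_1_left ac_simps)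
  qed
  then show ?thesis
    unfolding obstruction_space_def using even_chains_add[OF sE tE] even_chains_add[OF e e', of 1] aa by blast
qed

text \<open>
  Subtract the boundary from \<open>z\<close>: the difference represents the same class, has filtration level at
  least zero, and its leading part is the reduction of an integral cocycle.
\<close>

lemma full_if_cocycle_in_obstruction_space:
  assumes X: "X \<in> leo_triples" and z: "nontrivial_cocycle (hpart X) z" and zS: "z \<in> obstruction_space X"
  shows "oddly_reduced_full X 0"
proof -
  let ?D = "hpart X" and ?C = "zpart X" and ?f = "\<lambda>a. cmp X *\<^sub>v map_vec mod2 a"
  note XD = leo_triplesD[OF X]
  have zE: "z \<in> even_chains ?D 0" and zd: "h1_diff ?D z = (\<lambda>_. 0)" and zn: "z \<notin> h1_diff ?D ` even_chains ?D (- 1)"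
    using z by (auto simp: nontrivial_cocycle_def)
  obtain e a where e: "e \<in> even_chains ?D (- 1)" and a: "a \<in> cocycles trivial_grading ?C 0 0"
    and zea: "\<And>j. j < rk ?D \<Longrightarrow> qdeg ?D j \<le> 0 \<Longrightarrow> z j = h1_diff ?D e j + ?f a $ j"
    using zS unfolding obstruction_space_def by blast
  have eE: "h1_diff ?D e \<in> even_chains ?D 0" by (rule h1_diff_even_chains[OF XD(2) e]) simp
  define u where "u = (\<lambda>j. z j + (- 1) * h1_diff ?D e j)"
  have u_low: "u j = ?f a $ j" if "j < rk ?D" "qdeg ?D j \<le> 0" for j
    unfolding u_def zea[OF that] by (simp only: mult_minus1 add.assoc add.commute add.left_commute add_minus_cancel)
  have uE: "u \<in> even_chains ?D 0" unfolding u_def by (rule even_chains_add[OF zE eE])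
  have "h1_diff ?D u = (\<lambda>_. 0)"
    unfolding u_def h1_diff_add zd h1_diff_square[OF XD(2) e] by simp
  moreover have "u \<notin> h1_diff ?D ` even_chains ?D (- 1)"
  proof
    assume "u \<in> h1_diff ?D ` even_chains ?D (- 1)"
    then obtain e' where e': "e' \<in> even_chains ?D (- 1)" "u = h1_diff ?D e'" by blast
    have "z = (\<lambda>j. u j + 1 * h1_diff ?D e j)"
      unfolding u_def by (rule ext) (simp only: mult_1_left mult_minus1 diff_conv_add_uminus[symmetric] diff_add_cancel)
    also have "\<dots> = h1_diff ?D (\<lambda>j. e' j + 1 * e j)" unfolding e'(2) h1_diff_add ..
    finally show False using zn even_chains_add[OF e'(1) e] by blast
  qed
  ultimately have "nontrivial_cocycle ?D u" using uE by (simp add: nontrivial_cocycle_def)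
  moreover have "supported_from ?D 0 u"
    unfolding supported_from_def
  proof (intro allI impI)
    fix j assume uj: "u j \<noteq> 0"
    then have "j < rk ?D" by (rule even_chainsD(1)[OF uE])
    then show "0 \<le> qdeg ?D j" using uj u_low[of j] cocycle_image_support[OF X a, of j] by force
  qed
  moreover have "?f a - leading_part ?D 0 u \<in> coboundaries trivial_grading (cplx_h0 ?D) 0 0"
  proof -
    have "?f a - leading_part ?D 0 u = 0\<^sub>v (rk ?D)"
    proof (rule eq_vecI)
      fix j assume "j < dim_vec (0\<^sub>v (rk ?D))"
      then have j: "j < rk ?D" by simp
      have "leading_part ?D 0 u $ j = ?f a $ j"
      proof (cases "qdeg ?D j = 0")
        case True
        then show ?thesis using j u_low[OF j] by (simp add: leading_part_def)
      next
        case False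
        then have "?f a $ j = 0" using cocycle_image_support[OF X a j] by blast
        then show ?thesis using j False by (simp add: leading_part_def)
      qed
      then show "(?f a - leading_part ?D 0 u) $ j = 0\<^sub>v (rk ?D) $ j"
        using j by (simp only: index_minus_vec dim_leading_part index_zero_vec diff_self)
    qed simp
    then show ?thesis using triv.coboundaries_zero[OF XD(4)] by simp
  qed
  ultimately show ?thesis unfolding full_iff_h1[OF X] using a by auto
qed

text \<open>
  A nontrivial cocycle \<open>z\<close> lies outside the obstruction space, so some functional vanishes on the
  space and not on \<open>z\<close>.  It vanishes on positive filtration levels and on boundaries, which makes it
  a chain map to \<open>F\<^sub>2[h]\<close>, and its value on \<open>z\<close> makes it local.  It vanishes on reductions of integral
  cocycles, so that its composite with the comparison map lifts to a chain map to \<open>\<int>\<close>.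
\<close>

lemma has_local_map_to_unit:
  assumes X: "X \<in> leo_triples" and nf: "\<not> oddly_reduced_full X 0"
  shows "has_local_map X unit_leo"
proof -
  let ?D = "hpart X" and ?C = "zpart X" and ?f = "\<lambda>a. cmp X *\<^sub>v map_vec mod2 a" and ?S = "obstruction_space X"
  note XD = leo_triplesD[OF X]
  note dims = triv.chain_mapD[OF XD(7)]
  obtain z where z: "nontrivial_cocycle ?D z" using ex_nontrivial_cocycle[OF X] by blast
  then have zE: "z \<in> even_chains ?D 0" and zd: "h1_diff ?D z = (\<lambda>_. 0)"
    by (auto simp: nontrivial_cocycle_def)
  have SE: "s \<in> even_chains ?D 0" if "s \<in> ?S" for s using that unfolding obstruction_space_def by blast
  have "\<exists>l. (\<forall>s\<in>?S. (\<Sum>i\<in>{..<rk ?D}. l i * s i) = 0) \<and> (\<Sum>i\<in>{..<rk ?D}. l i * z i) \<noteq> 0"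
  proof (rule separating_functional)
    show "s i = 0" if "s \<in> ?S" "i \<notin> {..<rk ?D}" for s i
      using that even_chainsD(1)[OF SE, of s i] by blast
    show "z i = 0" if "i \<notin> {..<rk ?D}" for i using that even_chainsD(1)[OF zE, of i] by blast
    show "(\<lambda>_. 0) \<in> ?S"
      by (rule mem_obstruction_space_no_cocycle[OF X even_chains_zero even_chains_zero]) (simp add: h1_diff_zero)
    show "z \<notin> ?S" using full_if_cocycle_in_obstruction_space[OF X z] nf by blast
    show "(\<lambda>i. s i + c * t i) \<in> ?S" if "s \<in> ?S" "t \<in> ?S" for s t c
      by (rule obstruction_space_add[OF X that])
  qed simp
  then obtain l where l: "\<And>s. s \<in> ?S \<Longrightarrow> (\<Sum>i<rk ?D. l i * s i) = 0" "(\<Sum>i<rk ?D. l i * z i) \<noteq> 0" by blast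
  \<comment> \<open>restrict the functional to the generators that \<open>even_chains\<close> involves\<close>
  define m where "m j = (if j < rk ?D \<and> hdeg ?D j = 0 \<and> even (qdeg ?D j) then l j else 0)" for j
  have mE: "m \<in> even_chains ?D 0" unfolding m_def even_chains_def by auto
  have ml: "(\<Sum>i<rk ?D. m i * s i) = (\<Sum>i<rk ?D. l i * s i)" if "s \<in> even_chains ?D 0" for s
  proof (intro sum.cong refl)
    fix i assume "i \<in> {..<rk ?D}"
    show "m i * s i = l i * s i"
    proof (cases "s i = 0")
      case True
      then show ?thesis by (simp only: mult_zero_right)
    next
      case False
      then have "m i = l i" unfolding m_def using even_chainsD[OF that False] by simp
      then show ?thesis by simp
    qed
  qed
  have mS: "(\<Sum>i<rk ?D. m i * s i) = 0" if "s \<in> ?S" for s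
    using ml[OF SE[OF that]] l(1)[OF that] by simp
  have mz: "(\<Sum>i<rk ?D. m i * z i) = 1" using ml[OF zE] l(2) by simp
  have m_pos: "m j = 0" if "qdeg ?D j > 0" for j
  proof (rule ccontr)
    assume mj: "m j \<noteq> 0"
    note j = even_chainsD[OF mE mj]
    let ?e = "\<lambda>i. if i = j then 1 else (0 :: bit)"
    have "?e \<in> even_chains ?D 0" using j unfolding even_chains_def by auto
    then have "?e \<in> ?S"
      using that even_chains_zero[of ?D "- 1"] by (intro mem_obstruction_space_no_cocycle[OF X]) (auto simp: h1_diff_zero)
    from mS[OF this] have "(\<Sum>i<rk ?D. m i * ?e i) = 0" .
    moreover have "(\<Sum>i<rk ?D. m i * ?e i) = (\<Sum>i<rk ?D. if i = j then m j else 0)"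
      by (intro sum.cong refl) simp
    ultimately show False using j(1) mj by simp
  qed
  have m_diff: "(\<Sum>i<rk ?D. m i * poly (diff ?D $$ (i, k)) 1) = 0" if k: "k < rk ?D" for k
  proof (cases "hdeg ?D k = - 1 \<and> even (qdeg ?D k)")
    case True
    let ?e = "\<lambda>i. if i = k then 1 else (0 :: bit)"
    have e: "?e \<in> even_chains ?D (- 1)" using True k unfolding even_chains_def by auto
    have de: "h1_diff ?D ?e i = poly (diff ?D $$ (i, k)) 1" if "i < rk ?D" for i
    proof -
      have "(\<Sum>j<rk ?D. poly (diff ?D $$ (i, j)) 1 * ?e j) = (\<Sum>j<rk ?D. if j = k then poly (diff ?D $$ (i, k)) 1 else 0)"
        by (intro sum.cong refl) simp
      then show ?thesis using that k unfolding h1_diff_def by simp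
    qed
    have "h1_diff ?D ?e \<in> even_chains ?D 0" by (rule h1_diff_even_chains[OF XD(2) e]) simp
    then have "h1_diff ?D ?e \<in> ?S"
      using e by (intro mem_obstruction_space_no_cocycle[OF X]) auto
    then have "(\<Sum>i<rk ?D. m i * h1_diff ?D ?e i) = 0" by (rule mS)
    moreover have "(\<Sum>i<rk ?D. m i * h1_diff ?D ?e i) = (\<Sum>i<rk ?D. m i * poly (diff ?D $$ (i, k)) 1)"
      by (intro sum.cong refl) (simp only: de lessThan_iff)
    ultimately show ?thesis by (simp only:)
  next
    case False
    show ?thesis
    proof (intro sum.neutral ballI)
      fix i assume "i \<in> {..<rk ?D}"
      then have i: "i < rk ?D" by simp
      show "m i * poly (diff ?D $$ (i, k)) 1 = 0"
      proof (rule ccontr)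
        assume "m i * poly (diff ?D $$ (i, k)) 1 \<noteq> 0"
        then have "m i \<noteq> 0" "poly (diff ?D $$ (i, k)) 1 \<noteq> 0" by (metis mult_zero_left, metis mult_zero_right)
        then show False
          using False even_chainsD[OF mE, of i] diff_h_entry(2)[OF XD(2) i k] by auto
      qed
    qed
  qed
  define \<beta> where "\<beta> = h_row ?D m"
  have U: "cplx_hinv (hpart unit_leo) = unit_cplx" "cplx_h0 (hpart unit_leo) = unit_cplx"
    unfolding unit_leo_sel by (rule base_change_line, rule to_laurent_zero, rule base_change_line, rule h_to_0_zero)
  have \<beta>: "chain_map h_grading ?D (hpart unit_leo) \<beta>"
    unfolding \<beta>_def unit_leo_sel by (rule chain_map_h_row[OF XD(2) mE m_pos m_diff])
  have \<beta>_nonnull: "\<not> chain_homotopic laurent_grading (cplx_hinv ?D) (cplx_hinv (hpart unit_leo)) (map_mat to_laurent \<beta>) (0\<^sub>m (rk (hpart unit_leo)) (rk ?D))"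
    unfolding U \<beta>_def using h_row_not_null[OF XD(2) mE m_pos zE zd mz] by simp
  define \<psi> where "\<psi> = map_mat h_to_0 \<beta> * cmp X"
  have \<psi>_chain: "chain_map trivial_grading (cplx_mod2 ?C) (cplx_h0 (hpart unit_leo)) \<psi>"
    unfolding \<psi>_def
    by (rule triv.chain_map_mult[OF XD(3,4) leo_triplesD(4)[OF unit_leo_triples] h0.chain_map_base_change[OF XD(2) leo_triplesD(2)[OF unit_leo_triples] \<beta>] XD(7)])
  note d\<psi> = triv.chain_mapD[OF \<psi>_chain]
  have \<psi>_kills: "(\<psi> *\<^sub>v map_vec mod2 a) $ 0 = 0" if a: "a \<in> cocycles trivial_grading ?C 0 0" for a
  proof -
    have da: "dim_vec a = rk ?C" using a triv.bigraded_part_dim by (auto simp: cocycles_def)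
    have "\<psi> *\<^sub>v map_vec mod2 a = map_mat h_to_0 \<beta> *\<^sub>v ?f a"
      unfolding \<psi>_def using dims da by (intro triv.mult_vec_assoc) (auto simp: \<beta>_def h_row_def)
    also have "\<dots> $ 0 = (\<Sum>j<rk ?D. h_to_0 (\<beta> $$ (0, j)) * ?f a $ j)"
      using dims by (subst mult_vec_index) (auto simp: \<beta>_def h_row_def)
    also have "\<dots> = (\<Sum>j<rk ?D. m j * (if j < rk ?D then ?f a $ j else 0))"
    proof (intro sum.cong refl)
      fix j assume "j \<in> {..<rk ?D}"
      then have j: "j < rk ?D" by simp
      show "h_to_0 (\<beta> $$ (0, j)) * ?f a $ j = m j * (if j < rk ?D then ?f a $ j else 0)"
      proof (cases "?f a $ j = 0")
        case True
        then show ?thesis by (simp only: if_cancel mult_zero_right)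
      next
        case False
        then have "qdeg ?D j = 0" using cocycle_image_support[OF X a j] by blast
        then have "h_to_0 (\<beta> $$ (0, j)) = m j" using j by (simp add: \<beta>_def h_row_def h_to_0_def poly_monom)
        then show ?thesis using j by simp
      qed
    qed
    also have "\<dots> = 0"
    proof (rule mS)
      let ?w = "\<lambda>j. if j < rk ?D then ?f a $ j else 0"
      have "?w \<in> even_chains ?D 0"
        unfolding even_chains_def
      proof (intro CollectI allI impI)
        fix j assume w: "?w j \<noteq> 0"
        then have j: "j < rk ?D" by metis
        then show "j < rk ?D \<and> hdeg ?D j = 0 \<and> even (qdeg ?D j)" using cocycle_image_support[OF X a j] w by auto
      qed
      then show "?w \<in> ?S"
        unfolding obstruction_space_def using even_chains_zero a
        by (auto intro!: bexI[of _ "\<lambda>_. 0"] bexI[of _ a] simp: h1_diff_zero simp del: index_mult_mat_vec)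
    qed
    finally show ?thesis .
  qed
  obtain \<alpha> where \<alpha>: "chain_map trivial_grading ?C unit_cplx \<alpha>" "map_mat mod2 \<alpha> = \<psi>"
    using integral_cocycle_lift[OF XD(1) \<psi>_chain[unfolded U] \<psi>_kills] .
  have "chain_homotopic trivial_grading (cplx_mod2 ?C) (cplx_h0 (hpart unit_leo)) \<psi> \<psi>"
    using triv.homotopic_refl[OF XD(3) leo_triplesD(4)[OF unit_leo_triples] d\<psi>(2,3)] .
  moreover have "cmp unit_leo * map_mat mod2 \<alpha> = \<psi>" using \<alpha>(2) d\<psi>(2) by simp
  ultimately have "local_map X unit_leo \<alpha> \<beta>"
    unfolding local_map_iff[OF X unit_leo_triples] using \<alpha>(1) \<beta> \<beta>_nonnull unfolding \<psi>_def by auto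
  then show ?thesis by (auto simp: has_local_map_def)
qed

text \<open>
  If there is no map from \<open>X\<close> to \<open>Y\<close>, then \<open>Y \<otimes> X\<^sup>*\<close> maps to the unit; multiplying by \<open>X\<close> and
  cancelling gives a map from \<open>Y\<close> to \<open>X\<close>.
\<close>

lemma has_local_map_total:
  assumes X: "X \<in> leo_triples" and Y: "Y \<in> leo_triples"
  shows "has_local_map X Y \<or> has_local_map Y X"
proof (cases "has_local_map X Y")
  case False
  let ?W = "tensor_leo Y (dual_leo X)"
  have t: "dual_leo X \<in> leo_triples" "?W \<in> leo_triples" "tensor_leo (dual_leo X) X \<in> leo_triples"
    using X Y by (auto intro: tensor_leo_triples dual_leo_triples)
  have "\<not> oddly_reduced_full ?W 0"
    using False has_local_map_iff_unit_hom[OF X Y] has_local_map_unit_iff[OF t(2)] by simp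
  then have "has_local_map ?W unit_leo" by (rule has_local_map_to_unit[OF t(2)])
  then have "has_local_map (tensor_leo ?W X) (tensor_leo unit_leo X)"
    using X t by (intro tensor_local_map has_local_map_refl unit_leo_triples)
  then have 1: "has_local_map (tensor_leo Y (tensor_leo (dual_leo X) X)) X"
    using X Y t by (simp add: tensor_leo_assoc tensor_leo_unit)
  have "has_local_map unit_leo (tensor_leo X (dual_leo X))"
    using has_local_map_iff_unit_hom[OF X X] has_local_map_refl[OF X] by simp
  then have "has_local_map unit_leo (tensor_leo (dual_leo X) X)"
    using X t tensor_leo_commute[OF X t(1)] by (meson has_local_map_trans tensor_leo_triples unit_leo_triples)
  then have "has_local_map (tensor_leo Y unit_leo) (tensor_leo Y (tensor_leo (dual_leo X) X))"
    using Y t by (intro tensor_local_map has_local_map_refl unit_leo_triples)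
  then have "has_local_map Y (tensor_leo Y (tensor_leo (dual_leo X) X))"
    using Y by (simp add: tensor_leo_unit)
  then show ?thesis using 1 X Y t by (meson has_local_map_trans tensor_leo_triples)
qed simp

section \<open>The order and its positive cone\<close>

lemma linear_order_leo_order: "linear_order_on (carrier leo_group) leo_order"
  unfolding order_on_defs
proof (intro conjI)
  show "leo_order \<subseteq> carrier leo_group \<times> carrier leo_group" by (auto simp: leo_order_def)
  show "refl_on (carrier leo_group) leo_order"
    by (auto simp: refl_on_def carrier_leo_group leo_order_iff has_local_map_refl)
  show "trans leo_order"
  proof (rule transI)
    fix a b c assume ab: "(a, b) \<in> leo_order" and bc: "(b, c) \<in> leo_order"
    then have "a \<in> carrier leo_group" "b \<in> carrier leo_group" "c \<in> carrier leo_group" by (auto simp: leo_order_def)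
    then obtain X Y Z where X: "X \<in> leo_triples" "a = leo_class X" and Y: "Y \<in> leo_triples" "b = leo_class Y"
      and Z: "Z \<in> leo_triples" "c = leo_class Z" unfolding carrier_leo_group by blast
    have "has_local_map X Y" "has_local_map Y Z"
      using ab bc unfolding X Y Z leo_order_iff[OF X(1) Y(1)] leo_order_iff[OF Y(1) Z(1)] .
    then have "has_local_map X Z" by (rule has_local_map_trans[OF X(1) Y(1) Z(1)])
    then show "(a, c) \<in> leo_order" unfolding X Z leo_order_iff[OF X(1) Z(1)] .
  qed
  show "antisym leo_order"
  proof (rule antisymI)
    fix a b assume ab: "(a, b) \<in> leo_order" and ba: "(b, a) \<in> leo_order"
    then have "a \<in> carrier leo_group" "b \<in> carrier leo_group" by (auto simp: leo_order_def)
    then obtain X Y where "X \<in> leo_triples" "a = leo_class X" "Y \<in> leo_triples" "b = leo_class Y"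
      unfolding carrier_leo_group by blast
    then show "a = b" using ab ba by (auto simp: leo_order_iff leo_class_eq_iff)
  qed
  show "total_on (carrier leo_group) leo_order"
    using has_local_map_total by (auto simp: total_on_def carrier_leo_group leo_order_iff)
qed

lemma leo_order_positive_iff:
  assumes "X \<in> leo_triples"
  shows "(\<one>\<^bsub>leo_group\<^esub>, leo_class X) \<in> leo_order \<longleftrightarrow> s_odd X \<ge> 0"
  using assms by (simp add: one_leo_group leo_order_iff unit_leo_triples has_local_map_unit_iff s_odd_nonneg_iff)

text \<open>
  Translate by the inverse of \<open>a\<close>, respectively by \<open>a\<close>: the relation is determined by the elements
  above the identity.
\<close>

lemma (in comm_group) translation_invariant_iff_positive:
  assumes "translation_invariant G r" "a \<in> carrier G" "b \<in> carrier G"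
  shows "(a, b) \<in> r \<longleftrightarrow> (\<one>, b \<otimes> inv a) \<in> r"
proof
  assume "(a, b) \<in> r"
  then have "(a \<otimes> inv a, b \<otimes> inv a) \<in> r"
    using assms unfolding translation_invariant_def by blast
  then show "(\<one>, b \<otimes> inv a) \<in> r" using assms by simp
next
  assume "(\<one>, b \<otimes> inv a) \<in> r"
  then have "(\<one> \<otimes> a, b \<otimes> inv a \<otimes> a) \<in> r"
    using assms unfolding translation_invariant_def by blast
  then show "(a, b) \<in> r" using assms by (simp add: m_assoc)
qed

theorem theorem5p6:
  shows "comm_group leo_group
    \<and> linear_order_on (carrier leo_group) leo_order
    \<and> translation_invariant leo_group leo_order
    \<and> (\<forall>X\<in>leo_triples. (\<one>\<^bsub>leo_group\<^esub>, leo_class X) \<in> leo_order \<longleftrightarrow> s_odd X \<ge> 0)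
    \<and> (\<forall>r. linear_order_on (carrier leo_group) r
          \<and> translation_invariant leo_group r
          \<and> (\<forall>X\<in>leo_triples. (\<one>\<^bsub>leo_group\<^esub>, leo_class X) \<in> r \<longleftrightarrow> s_odd X \<ge> 0)
          \<longrightarrow> r = leo_order)"
proof (intro conjI allI impI ballI)
  interpret comm_group leo_group by (rule comm_group_leo_group)
  fix r assume r: "linear_order_on (carrier leo_group) r
          \<and> translation_invariant leo_group r
          \<and> (\<forall>X\<in>leo_triples. (\<one>\<^bsub>leo_group\<^esub>, leo_class X) \<in> r \<longleftrightarrow> s_odd X \<ge> 0)"
  have pos: "(\<one>\<^bsub>leo_group\<^esub>, c) \<in> r \<longleftrightarrow> (\<one>\<^bsub>leo_group\<^esub>, c) \<in> leo_order" if "c \<in> carrier leo_group" for c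
    using that r leo_order_positive_iff by (auto simp: carrier_leo_group)
  have "(a, b) \<in> r \<longleftrightarrow> (a, b) \<in> leo_order" if ab: "a \<in> carrier leo_group" "b \<in> carrier leo_group" for a b
    using translation_invariant_iff_positive[OF conjunct1[OF conjunct2[OF r]] ab]
      translation_invariant_iff_positive[OF translation_invariant_leo_order ab] pos ab by simp
  moreover have "r \<subseteq> carrier leo_group \<times> carrier leo_group" "leo_order \<subseteq> carrier leo_group \<times> carrier leo_group"
    using r linear_order_leo_order by (auto simp: order_on_defs)
  ultimately show "r = leo_order" by blast
qed (use comm_group_leo_group linear_order_leo_order translation_invariant_leo_order leo_order_positive_iff in auto)

end
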